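(* Assume $M=(M(t))_{t\ge0}$ is of class (HDol) or (HSqL), let $a,b:D[-\tau,0]\times[0,\infty)\to\mathbb R$ be time-proper locally Lipschitz, let $\Phi\in\mathbb D[-\tau,0]$, and suppose $X=(X(t))_{-\tau\le t<\infty}$ is a global solution to $$\mathrm dX(t)=a(X_t,t)\,\mathrm dt+b(X_{t-},t-)\,\mathrm dM(t)\ \text{ for } t\ge0,\qquad X(u)=\Phi(u)\ \text{ for } u\in[-\tau,0].$$ Suppose there is a constant $\alpha_{\max}\ge0$ or $\alpha_{\min}\ge0$ such that $$a(\varphi,t)\le\alpha_{\max}\ \text{ for all }\varphi\in D[-\tau,0],\,t\ge0,\qquad\text{or}\qquad a(\varphi,t)\ge-\alpha_{\min}\ \text{ for all }\varphi\in D[-\tau,0],\,t\ge0,$$ and suppose there is a constant $\beta\ge0$ with $b(\varphi,t)^2\le\beta^2$ for all $\varphi\in D[-\tau,0]$, $t\ge0$. If $(X(t))_{t\ge0}$ is bounded in probability, then so is $(\|X_t\|_\infty)_{t\ge0}$. In particular, if $(X(t))_{t\ge0}$ is bounded above in probability, then $(\sup_{\theta\in[-\tau,0]}X(t+\theta))_{t\ge0}$ is bounded above in probability, and if $(X(t))_{t\ge0}$ is bounded below in probability, then $(\inf_{\theta\in[-\tau,0]}X(t+\theta))_{t\ge0}$ is bounded below in probability.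
   Context: Fix $\tau>0$ and a filtered probability space $(\Omega,\mathcal F,\mathbb F=(\mathcal F_t)_{t\ge0},\mathbb P)$ satisfying the usual conditions; put $\mathcal F_s=\mathcal F_0$ for $-\tau\le s<0$. $D[-\tau,0]$, $D[-\tau,\infty)$ are the spaces of real càdlàg functions; $\|\varphi\|_\infty=\sup_{s\in[-\tau,0]}|\varphi(s)|$. $\mathbb D[-\tau,0]$ is the set of càdlàg processes $\Phi=(\Phi(u))_{u\in[-\tau,0]}$ with every $\Phi(u)$ $\mathcal F_0$-measurable. For a process $X$ on $[-\tau,\infty)$, $X_t(\theta)=X(t+\theta)$, $\theta\in[-\tau,0]$, $t\ge0$. A map $f:D[-\tau,0]\times[0,\infty)\to\mathbb R$ is time-proper locally Lipschitz if (i) for every $t\ge0$, $\varphi\mapsto f(\varphi,t)$ is locally Lipschitz: for every $n$ there is $K_n>0$ with $|f(\varphi,t)-f(\psi,t)|\le K_n\|\varphi-\psi\|_\infty$ whenever $\|\varphi\|_\infty\vee\|\psi\|_\infty\le n$; and (ii) for all $\psi\in D[-\tau,\infty)$ the map $t\mapsto f(\psi_t,t)$ is càdlàg on $[0,\infty)$. A global solution is an adapted càdlàg process $X$ on $[-\tau,\infty)$ with $X_0=\Phi$ a.s. and, a.s., $X(t)=\Phi(0)+\int_0^t a(X_s,s)\,\mathrm ds+\int_0^t b(X_{s-},s-)\,\mathrm dM(s)$ for all $t\ge0$, where $b(X_{s-},s-)$ denotes the left limit at $s$ of $u\mapsto b(X_u,u)$. (HDol): $M$ is a càdlàg square integrable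 $\mathbb F$-martingale whose Doléans measure $\mu_M(A)=\mathbb E\int_0^\infty\mathbf 1_A\,\mathrm d[M]$ on the predictable $\sigma$-algebra is absolutely continuous with respect to $\mathrm ds\times\mathbb P$, with Radon–Nikodym derivative bounded by some $\lambda>0$. (HSqL): $M$ is a square integrable Lévy process with respect to $\mathbb F$ (adapted, increments after time $s$ independent of $\mathcal F_s$). A real family $(Z_\eta)_{\eta\in I}$ is bounded above (resp. below) in probability if $\lim_{R\to\infty}\sup_\eta\mathbb P(Z_\eta\ge R)=0$ (resp. $\lim_{R\to\infty}\sup_\eta\mathbb P(Z_\eta\le-R)=0$), and bounded in probability if both hold. *)

theory Defs
  imports "HOL-Probability.Probability"
begin

section \<open>Cadlag paths and time-proper locally Lipschitz coefficients\<close>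

text \<open>At the left end point of an interval the left limit is taken along the trivial filter, at the
right end point right continuity is; both requirements are void there, as they should be.\<close>

definition cadlag_on :: "real set \<Rightarrow> (real \<Rightarrow> real) \<Rightarrow> bool" where
  "cadlag_on S x \<longleftrightarrow>
     (\<forall>t\<in>S. continuous (at t within S \<inter> {t..}) x \<and> (\<exists>l. (x \<longlongrightarrow> l) (at t within S \<inter> {..<t})))"

definition D_space :: "real set \<Rightarrow> (real \<Rightarrow> real) set" where
  "D_space S = {x \<in> extensional S. cadlag_on S x}"

definition left_lim :: "(real \<Rightarrow> real) \<Rightarrow> real \<Rightarrow> real" where
  "left_lim x t = Lim (at_left t) x"

text \<open>The segment $x_t$.\<close>

definition segment :: "real \<Rightarrow> (real \<Rightarrow> real) \<Rightarrow> real \<Rightarrow> (real \<Rightarrow> real)" where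
  "segment \<tau> x t = (\<lambda>\<theta>\<in>{-\<tau>..0}. x (t + \<theta>))"

definition sup_norm :: "real \<Rightarrow> (real \<Rightarrow> real) \<Rightarrow> real" where
  "sup_norm \<tau> \<phi> = (SUP s\<in>{-\<tau>..0}. \<bar>\<phi> s\<bar>)"

definition time_proper_locally_lipschitz :: "real \<Rightarrow> ((real \<Rightarrow> real) \<Rightarrow> real \<Rightarrow> real) \<Rightarrow> bool" where
  "time_proper_locally_lipschitz \<tau> f \<longleftrightarrow>
     (\<forall>t\<ge>0. \<forall>n::nat. \<exists>K>0. \<forall>\<phi>\<in>D_space {-\<tau>..0}. \<forall>\<psi>\<in>D_space {-\<tau>..0}.
        max (sup_norm \<tau> \<phi>) (sup_norm \<tau> \<psi>) \<le> real n \<longrightarrow>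
        \<bar>f \<phi> t - f \<psi> t\<bar> \<le> K * sup_norm \<tau> (\<lambda>s. \<phi> s - \<psi> s)) \<and>
     (\<forall>\<psi>\<in>D_space {-\<tau>..}. cadlag_on {0..} (\<lambda>t. f (segment \<tau> \<psi> t) t))"

section \<open>Filtrations and processes\<close>

text \<open>Filtrations are indexed by the whole real line and are constant on the negative half line,
so that adaptedness on $[-\tau,\infty)$ makes sense.\<close>

definition usual_conditions :: "'a measure \<Rightarrow> (real \<Rightarrow> 'a measure) \<Rightarrow> bool" where
  "usual_conditions P F \<longleftrightarrow>
     filtration (space P) F \<and> (\<forall>t. subalgebra P (F t)) \<and>
     complete_measure P \<and> null_sets P \<subseteq> sets (F 0) \<and>
     (\<forall>t\<ge>0. sets (F t) = (\<Inter>s\<in>{t<..}. sets (F s))) \<and>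
     (\<forall>s<0. F s = F 0)"

definition adapted_on :: "(real \<Rightarrow> 'a measure) \<Rightarrow> real set \<Rightarrow> (real \<Rightarrow> 'a \<Rightarrow> real) \<Rightarrow> bool" where
  "adapted_on F S Y \<longleftrightarrow> (\<forall>t\<in>S. Y t \<in> borel_measurable (F t))"

definition cadlag_process :: "'a measure \<Rightarrow> real set \<Rightarrow> (real \<Rightarrow> 'a \<Rightarrow> real) \<Rightarrow> bool" where
  "cadlag_process P S Y \<longleftrightarrow> (\<forall>\<omega>\<in>space P. cadlag_on S (\<lambda>t. Y t \<omega>))"

definition initial_processes ::
    "'a measure \<Rightarrow> (real \<Rightarrow> 'a measure) \<Rightarrow> real \<Rightarrow> (real \<Rightarrow> 'a \<Rightarrow> real) set" where
  "initial_processes P F \<tau> =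
     {\<Phi>. cadlag_process P {-\<tau>..0} \<Phi> \<and> (\<forall>u\<in>{-\<tau>..0}. \<Phi> u \<in> borel_measurable (F 0))}"

definition martingale :: "'a measure \<Rightarrow> (real \<Rightarrow> 'a measure) \<Rightarrow> (real \<Rightarrow> 'a \<Rightarrow> real) \<Rightarrow> bool" where
  "martingale P F M \<longleftrightarrow>
     adapted_on F {0..} M \<and> (\<forall>t\<ge>0. integrable P (M t)) \<and>
     (\<forall>s\<ge>0. \<forall>t\<ge>s. AE \<omega> in P. real_cond_exp P (F s) (M t) \<omega> = M s \<omega>)"

definition square_integrable :: "'a measure \<Rightarrow> (real \<Rightarrow> 'a \<Rightarrow> real) \<Rightarrow> bool" where
  "square_integrable P M \<longleftrightarrow> (\<forall>t\<ge>0. integrable P (\<lambda>\<omega>. (M t \<omega>)\<^sup>2))"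

section \<open>Stochastic integrals of left-continuous integrands\<close>

definition ucp_tendsto ::
    "'a measure \<Rightarrow> (nat \<Rightarrow> real \<Rightarrow> 'a \<Rightarrow> real) \<Rightarrow> (real \<Rightarrow> 'a \<Rightarrow> real) \<Rightarrow> bool" where
  "ucp_tendsto P Y Z \<longleftrightarrow>
     (\<forall>T\<ge>0. \<forall>\<epsilon>>0.
        (\<lambda>n. measure P {\<omega>\<in>space P. \<exists>t\<in>{0..T}. \<bar>Y n t \<omega> - Z t \<omega>\<bar> > \<epsilon>}) \<longlonglongrightarrow> 0)"

text \<open>The data \<open>(k, t, Y)\<close> represent the elementary predictable process
$\sum_{i<k} Y_i 1_{(t_i,t_{i+1}]}$ on $(0,\infty)\times\Omega$.\<close>

definition elementary :: "(real \<Rightarrow> 'a measure) \<Rightarrow> nat \<Rightarrow> (nat \<Rightarrow> real) \<Rightarrow> (nat \<Rightarrow> 'a \<Rightarrow> real) \<Rightarrow> bool" where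
  "elementary F k t Y \<longleftrightarrow>
     0 \<le> t 0 \<and> (\<forall>i<k. t i \<le> t (Suc i)) \<and> (\<forall>i<k. Y i \<in> borel_measurable (F (t i)))"

definition elementary_process ::
    "nat \<Rightarrow> (nat \<Rightarrow> real) \<Rightarrow> (nat \<Rightarrow> 'a \<Rightarrow> real) \<Rightarrow> real \<Rightarrow> 'a \<Rightarrow> real" where
  "elementary_process k t Y s \<omega> = (\<Sum>i<k. Y i \<omega> * indicator {t i<..t (Suc i)} s)"

definition elementary_integral ::
    "(real \<Rightarrow> 'a \<Rightarrow> real) \<Rightarrow> nat \<Rightarrow> (nat \<Rightarrow> real) \<Rightarrow> (nat \<Rightarrow> 'a \<Rightarrow> real) \<Rightarrow> real \<Rightarrow> 'a \<Rightarrow> real" where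
  "elementary_integral M k t Y s \<omega> =
     (\<Sum>i<k. Y i \<omega> * (M (min (t (Suc i)) s) \<omega> - M (min (t i) s) \<omega>))"

text \<open>\<open>has_stoch_integral P F M H I\<close>: the process \<open>I\<close> is a version of the stochastic integral
$\int_{(0,\cdot]} H\,dM$ of the adapted caglad process \<open>H\<close>.  The integral is the extension of the
elementary integral that is continuous under dominated pointwise convergence: \<open>I\<close> is the limit,
uniformly on compacts in probability, of the integrals of all sequences of elementary processes
that converge to \<open>H\<close> pointwise and are bounded, uniformly in the sequence index, on each path and
each bounded time interval.  Such sequences exist, because \<open>H\<close> is adapted and caglad (take the
values of \<open>H\<close> at the left end points of finer and finer grids).  By the dominated convergence
theorem for stochastic integrals the limit exists and is the Ito integral whenever \<open>M\<close> is a
semimartingale: the supremum of the sequence's absolute values over $(0,t]$ and over the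
sequence index is an adapted, finite, left-continuous increasing process, hence locally bounded.\<close>

definition has_stoch_integral ::
    "'a measure \<Rightarrow> (real \<Rightarrow> 'a measure) \<Rightarrow> (real \<Rightarrow> 'a \<Rightarrow> real) \<Rightarrow> (real \<Rightarrow> 'a \<Rightarrow> real) \<Rightarrow>
     (real \<Rightarrow> 'a \<Rightarrow> real) \<Rightarrow> bool" where
  "has_stoch_integral P F M H I \<longleftrightarrow>
     adapted_on F {0<..} H \<and>
     (\<forall>\<omega>\<in>space P. (\<forall>s>0. continuous (at_left s) (\<lambda>u. H u \<omega>)) \<and>
                   (\<forall>s\<ge>0. \<exists>l. ((\<lambda>u. H u \<omega>) \<longlongrightarrow> l) (at_right s))) \<and>
     adapted_on F {0..} I \<and> cadlag_process P {0..} I \<and>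
     (\<forall>(k :: nat \<Rightarrow> nat) (t :: nat \<Rightarrow> nat \<Rightarrow> real) (Y :: nat \<Rightarrow> nat \<Rightarrow> 'a \<Rightarrow> real).
        (\<forall>n. elementary F (k n) (t n) (Y n)) \<and>
        (\<forall>\<omega>\<in>space P. \<forall>s>0. (\<lambda>n. elementary_process (k n) (t n) (Y n) s \<omega>) \<longlonglongrightarrow> H s \<omega>) \<and>
        (\<forall>\<omega>\<in>space P. \<forall>T>0. \<exists>C. \<forall>n. \<forall>s\<in>{0<..T}. \<bar>elementary_process (k n) (t n) (Y n) s \<omega>\<bar> \<le> C)
        \<longrightarrow> ucp_tendsto P (\<lambda>n. elementary_integral M (k n) (t n) (Y n)) I)"

section \<open>Quadratic variation and Doleans measure\<close>

text \<open>\<open>Q\<close> is a version, with $Q(0)=0$, of the quadratic variation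
$[M] = M^2 - M(0)^2 - 2\int M_{-}\,dM$.\<close>

definition is_quadratic_variation ::
    "'a measure \<Rightarrow> (real \<Rightarrow> 'a measure) \<Rightarrow> (real \<Rightarrow> 'a \<Rightarrow> real) \<Rightarrow> (real \<Rightarrow> 'a \<Rightarrow> real) \<Rightarrow> bool" where
  "is_quadratic_variation P F M Q \<longleftrightarrow>
     adapted_on F {0..} Q \<and> cadlag_process P {0..} Q \<and>
     (\<forall>\<omega>\<in>space P. Q 0 \<omega> = 0 \<and> mono_on {0..} (\<lambda>t. Q t \<omega>)) \<and>
     (\<exists>I. has_stoch_integral P F M (\<lambda>s \<omega>. left_lim (\<lambda>u. M u \<omega>) s) I \<and>
          (AE \<omega> in P. \<forall>t\<ge>0. Q t \<omega> = (M t \<omega>)\<^sup>2 - (M 0 \<omega>)\<^sup>2 - 2 * I t \<omega>))"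

definition predictable :: "'a measure \<Rightarrow> (real \<Rightarrow> 'a measure) \<Rightarrow> (real \<times> 'a) measure" where
  "predictable P F =
     sigma ({0..} \<times> space P)
       ({{0} \<times> A |A. A \<in> sets (F 0)} \<union>
        {{s<..t} \<times> A |s t A. 0 \<le> s \<and> s \<le> t \<and> A \<in> sets (F s)})"

text \<open>The measure $ds\times P$ on the predictable sigma-algebra.\<close>

definition time_prob_measure :: "'a measure \<Rightarrow> (real \<Rightarrow> 'a measure) \<Rightarrow> (real \<times> 'a) measure" where
  "time_prob_measure P F =
     restr_to_subalg (restrict_space lborel {0..} \<Otimes>\<^sub>M P) (predictable P F)"

text \<open>$\mu_M(A)=E\int_0^\infty 1_A\,d[M]$, where \<open>Q\<close> is the quadratic variation of $M$. The paths of
\<open>Q\<close> are continued by $Q(0)=0$ to the negative half line, so that $\{0\}\times\Omega$ has no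
mass.\<close>

definition doleans_measure ::
    "'a measure \<Rightarrow> (real \<Rightarrow> 'a measure) \<Rightarrow> (real \<Rightarrow> 'a \<Rightarrow> real) \<Rightarrow> (real \<times> 'a) measure" where
  "doleans_measure P F Q =
     measure_of ({0..} \<times> space P) (sets (predictable P F))
       (\<lambda>A. \<integral>\<^sup>+\<omega>. (\<integral>\<^sup>+s. indicator A (s, \<omega>) \<partial>interval_measure (\<lambda>t. Q (max 0 t) \<omega>)) \<partial>P)"

section \<open>The two classes of driving noise\<close>

definition HDol :: "'a measure \<Rightarrow> (real \<Rightarrow> 'a measure) \<Rightarrow> (real \<Rightarrow> 'a \<Rightarrow> real) \<Rightarrow> bool" where
  "HDol P F M \<longleftrightarrow>
     cadlag_process P {0..} M \<and> martingale P F M \<and> square_integrable P M \<and>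
     (\<exists>Q. is_quadratic_variation P F M Q \<and>
        absolutely_continuous (time_prob_measure P F) (doleans_measure P F Q) \<and>
        (\<exists>c>0. AE z in time_prob_measure P F.
           RN_deriv (time_prob_measure P F) (doleans_measure P F Q) z \<le> ennreal c))"

definition levy_process :: "'a measure \<Rightarrow> (real \<Rightarrow> 'a measure) \<Rightarrow> (real \<Rightarrow> 'a \<Rightarrow> real) \<Rightarrow> bool" where
  "levy_process P F M \<longleftrightarrow>
     adapted_on F {0..} M \<and> cadlag_process P {0..} M \<and> (AE \<omega> in P. M 0 \<omega> = 0) \<and>
     (\<forall>s\<ge>0. \<forall>t\<ge>s.
        distr P borel (\<lambda>\<omega>. M t \<omega> - M s \<omega>) = distr P borel (M (t - s)) \<and>
        prob_space.indep_set P (sets (F s))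
          {(\<lambda>\<omega>. M t \<omega> - M s \<omega>) -` B \<inter> space P |B. B \<in> sets borel})"

definition HSqL :: "'a measure \<Rightarrow> (real \<Rightarrow> 'a measure) \<Rightarrow> (real \<Rightarrow> 'a \<Rightarrow> real) \<Rightarrow> bool" where
  "HSqL P F M \<longleftrightarrow> levy_process P F M \<and> square_integrable P M"

section \<open>Global solutions and boundedness in probability\<close>

definition global_solution ::
    "'a measure \<Rightarrow> (real \<Rightarrow> 'a measure) \<Rightarrow> real \<Rightarrow>
     ((real \<Rightarrow> real) \<Rightarrow> real \<Rightarrow> real) \<Rightarrow> ((real \<Rightarrow> real) \<Rightarrow> real \<Rightarrow> real) \<Rightarrow>
     (real \<Rightarrow> 'a \<Rightarrow> real) \<Rightarrow> (real \<Rightarrow> 'a \<Rightarrow> real) \<Rightarrow> (real \<Rightarrow> 'a \<Rightarrow> real) \<Rightarrow> bool" where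
  "global_solution P F \<tau> a b M \<Phi> X \<longleftrightarrow>
     adapted_on F {-\<tau>..} X \<and> cadlag_process P {-\<tau>..} X \<and>
     (AE \<omega> in P. \<forall>u\<in>{-\<tau>..0}. X u \<omega> = \<Phi> u \<omega>) \<and>
     (\<exists>I. has_stoch_integral P F M
             (\<lambda>s \<omega>. left_lim (\<lambda>u. b (segment \<tau> (\<lambda>v. X v \<omega>) u) u) s) I \<and>
          (AE \<omega> in P. \<forall>t\<ge>0.
             X t \<omega> = \<Phi> 0 \<omega> + (LBINT s:{0..t}. a (segment \<tau> (\<lambda>v. X v \<omega>) s) s) + I t \<omega>))"

definition bounded_above_in_prob :: "'a measure \<Rightarrow> 'i set \<Rightarrow> ('i \<Rightarrow> 'a \<Rightarrow> real) \<Rightarrow> bool" where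
  "bounded_above_in_prob P J Z \<longleftrightarrow>
     ((\<lambda>R. SUP \<eta>\<in>J. measure P {\<omega>\<in>space P. Z \<eta> \<omega> \<ge> R}) \<longlongrightarrow> 0) at_top"

definition bounded_below_in_prob :: "'a measure \<Rightarrow> 'i set \<Rightarrow> ('i \<Rightarrow> 'a \<Rightarrow> real) \<Rightarrow> bool" where
  "bounded_below_in_prob P J Z \<longleftrightarrow>
     ((\<lambda>R. SUP \<eta>\<in>J. measure P {\<omega>\<in>space P. Z \<eta> \<omega> \<le> - R}) \<longlongrightarrow> 0) at_top"

definition bounded_in_prob :: "'a measure \<Rightarrow> 'i set \<Rightarrow> ('i \<Rightarrow> 'a \<Rightarrow> real) \<Rightarrow> bool" where
  "bounded_in_prob P J Z \<longleftrightarrow> bounded_above_in_prob P J Z \<and> bounded_below_in_prob P J Z"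

end

theory Submission
  imports Defs
begin

text \<open>
For \<open>t \<le> \<tau>\<close> the window \<open>[t - \<tau>, t]\<close> lies in the fixed interval \<open>[-\<tau>, \<tau>]\<close>, on which cadlag paths are
bounded.  For \<open>t > \<tau>\<close> it is covered by \<open>[m\<tau>, (m + 2)\<tau>]\<close> for a suitable \<open>m \<ge> 0\<close>, and on that interval \<open>X\<close>
differs from its value at one of the end points by an increment of the drift integral and
an increment of the stochastic integral \<open>I\<close>.  A bound of \<open>a\<close> on one side only suffices for both
directions: if \<open>a \<le> \<alpha>\<close>, then \<open>X\<close> inside the interval lies at most \<open>2\<alpha>\<tau>\<close> plus noise above its value
at the left end point and at most \<open>2\<alpha>\<tau>\<close> plus noise below its value at the right end point; if
\<open>a \<ge> - \<alpha>\<close>, the end points are exchanged.  Boundedness in probability of \<open>X\<close> at the end points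
therefore passes to the whole window, once the noise is controlled by a bound on
\<open>sup {\<bar>I s - I (m\<tau>)\<bar> | m\<tau> \<le> s \<le> (m + 2)\<tau>}\<close> in probability that is uniform in \<open>m\<close>
(lemma \<open>stoch_integral_tight_on_windows\<close>).

This bound (\<open>stoch_integral_increment_bound\<close>) comes from discrete time.  The integrand is bounded by
\<open>\<beta>\<close> and \<open>I\<close> is a limit, uniformly on compacts in probability, of sums
\<open>\<Sum> H (t i) (M (t (i + 1)) - M (t i))\<close> along dyadic grids.  Write \<open>M t = N t + c t\<close>, where the increments of
\<open>N\<close> are orthogonal to the past.  The sums with \<open>N\<close> in place of \<open>M\<close> are discrete martingales, to which
Doob's \<open>L\<^sup>2\<close> inequality applies, and the drift contributes at most \<open>2\<bar>c\<bar>\<beta>\<tau>\<close>.  What is needed from the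
noise is only that \<open>E (N ((m + 2)\<tau>) - N (m\<tau>))\<^sup>2\<close> is bounded in \<open>m\<close>.

For a square integrable Levy process, \<open>N\<close> is the centred process, and stationarity makes this second
moment independent of \<open>m\<close> (\<open>levy_drift_decomposition\<close>).  For a martingale whose Doleans measure has a
density bounded by \<open>\<lambda>\<close>, \<open>N = M\<close>, the second moment is at most
\<open>E ([M] ((m + 2)\<tau>) - [M] (m\<tau>))\<close> (\<open>second_moment_increment_le_quadratic_variation\<close>), and this is the
Doleans measure of the strip \<open>(m\<tau>, (m + 2)\<tau>] \<times> \<Omega>\<close>, hence at most \<open>2\<lambda>\<tau>\<close>
(\<open>nn_integral_increment_le_of_RN_deriv_bound\<close>).
\<close>

section \<open>Cadlag paths\<close>

lemma cadlag_on_tendsto_right: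
  assumes "cadlag_on S x" "{t..v} \<subseteq> S" "t < v"
  shows "(x \<longlongrightarrow> x t) (at_right t)"
proof -
  have "(x \<longlongrightarrow> x t) (at t within S \<inter> {t..})"
    using assms(1) subsetD[OF assms(2), of t] assms(3) unfolding cadlag_on_def continuous_within by auto
  then have "(x \<longlongrightarrow> x t) (at t within {t..v})"
    by (rule tendsto_within_subset) (use assms in auto)
  then show ?thesis
    by (simp add: at_within_Icc_at_right[OF \<open>t < v\<close>])
qed

lemma cadlag_on_left_lim:
  assumes "cadlag_on S x" "{u..t} \<subseteq> S" "u < t"
  shows "(x \<longlongrightarrow> left_lim x t) (at_left t)"
proof -
  obtain l where "(x \<longlongrightarrow> l) (at t within S \<inter> {..<t})"
    using assms(1) subsetD[OF assms(2), of t] assms(3) unfolding cadlag_on_def by auto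
  then have "(x \<longlongrightarrow> l) (at t within {u..<t})"
    by (rule tendsto_within_subset) (use assms in auto)
  moreover have "at t within {u..<t} = at_left t"
    by (rule at_within_nhd[of t "{u<..}"]) (use assms(3) in auto)
  ultimately have l: "(x \<longlongrightarrow> l) (at_left t)"
    by simp
  then show ?thesis
    unfolding left_lim_def using tendsto_Lim[OF _ l] by simp
qed

text \<open>Concatenation of two intervals preserves boundedness, and the one-sided limits at a point bound the
path on a small interval around it; compactness in the form of Bolzano's principle does the rest.\<close>

lemma cadlag_on_bounded:
  assumes "cadlag_on S x" "{u..v} \<subseteq> S"
  shows "\<exists>B. \<forall>s\<in>{u..v}. \<bar>x s\<bar> \<le> B"
proof (cases "u \<le> v")
  case True
  define D where "D = {u..v}"
  have "\<exists>B. \<forall>s\<in>{u..v} \<inter> D. \<bar>x s\<bar> \<le> B"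
    using True
  proof (induction rule: Bolzano)
    case (trans a b c)
    from trans(1) obtain B where B: "\<forall>s\<in>{a..b} \<inter> D. \<bar>x s\<bar> \<le> B" ..
    from trans(2) obtain C where C: "\<forall>s\<in>{b..c} \<inter> D. \<bar>x s\<bar> \<le> C" ..
    have "\<bar>x s\<bar> \<le> max B C" if "s \<in> {a..c} \<inter> D" for s
      using bspec[OF B, of s] bspec[OF C, of s] that by (cases "s \<le> b") auto
    then show ?case by blast
  next
    case (local t)
    then have tS: "t \<in> S" using assms(2) by auto
    have r: "(x \<longlongrightarrow> x t) (at t within S \<inter> {t..})"
      using assms tS unfolding cadlag_on_def continuous_within by auto
    obtain l where l: "(x \<longlongrightarrow> l) (at t within S \<inter> {..<t})"
      using assms tS unfolding cadlag_on_def by auto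
    from tendstoD[OF r, of 1] obtain d1 where d1: "d1 > 0"
      "\<And>s. s \<in> S \<inter> {t..} \<Longrightarrow> s \<noteq> t \<Longrightarrow> dist s t < d1 \<Longrightarrow> dist (x s) (x t) < 1"
      by (auto simp: eventually_at)
    from tendstoD[OF l, of 1] obtain d2 where d2: "d2 > 0"
      "\<And>s. s \<in> S \<inter> {..<t} \<Longrightarrow> s \<noteq> t \<Longrightarrow> dist s t < d2 \<Longrightarrow> dist (x s) l < 1"
      by (auto simp: eventually_at)
    show ?case
    proof (rule exI[of _ "min d1 d2"], intro conjI allI impI)
      fix a b assume ab: "a \<le> t \<and> t \<le> b \<and> b - a < min d1 d2"
      have "\<bar>x s\<bar> \<le> max (\<bar>x t\<bar> + 1) (\<bar>l\<bar> + 1)" if s: "s \<in> {a..b} \<inter> D" for s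
      proof -
        have "s \<in> S" "dist s t < d1" "dist s t < d2"
          using s ab assms(2) by (auto simp: dist_real_def D_def)
        then consider "s = t" | "dist (x s) (x t) < 1" | "dist (x s) l < 1"
          using d1(2)[of s] d2(2)[of s] by fastforce
        then show ?thesis
          by cases (auto simp: dist_real_def)
      qed
      then show "\<exists>B. \<forall>s\<in>{a..b} \<inter> D. \<bar>x s\<bar> \<le> B" by blast
    qed (use d1 d2 in auto)
  qed
  then show ?thesis by (simp add: D_def)
qed auto

text \<open>Right continuity spreads a strict exceedance at \<open>s < v\<close> over an interval to the right of \<open>s\<close>, which
contains a point of every fine enough dyadic grid; the end point \<open>v\<close> is itself a grid point.\<close>

lemma exceeds_at_dyadic_point:
  fixes z :: "real \<Rightarrow> real"
  assumes s: "s \<in> {u..v}" "z s > R"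
    and right: "\<And>s. s \<in> {u..<v} \<Longrightarrow> (z \<longlongrightarrow> z s) (at_right s)"
  shows "\<exists>n. \<exists>j\<le>2 ^ n. z (u + (v - u) * real j / 2 ^ n) > R"
proof (cases "s = v")
  case True
  then show ?thesis using s by (intro exI[of _ 0] exI[of _ "1::nat"]) auto
next
  case False
  then have sv: "s < v" "u \<le> s" using s by auto
  from order_tendstoD(1)[OF right[of s] s(2)] sv obtain b where
    b: "b > s" "\<And>y. s < y \<Longrightarrow> y < b \<Longrightarrow> R < z y"
    by (auto simp: eventually_at_right_field)
  define L where "L = v - u"
  have L: "L > 0" using sv by (simp add: L_def)
  define c where "c = min b v - s"
  have c: "c > 0" using b sv by (simp add: c_def)
  obtain n where n: "L / c < 2 ^ n" using real_arch_pow[of 2 "L / c"] by auto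
  then have Ln: "L / 2 ^ n < c" using c L by (simp add: field_simps)
  define j where "j = nat (\<lfloor>(s - u) * 2 ^ n / L\<rfloor> + 1)"
  have nn: "(s - u) * 2 ^ n / L \<ge> 0" using sv L by simp
  have "real j = of_int (\<lfloor>(s - u) * 2 ^ n / L\<rfloor> + 1)"
    unfolding j_def using nn by (simp add: floor_le_iff le_floor_iff)
  then have j: "(s - u) * 2 ^ n / L < real j" "real j \<le> (s - u) * 2 ^ n / L + 1"
    by linarith+
  then have "s - u < L * real j / 2 ^ n" "L * real j / 2 ^ n \<le> s - u + L / 2 ^ n"
    using L by (auto simp: field_simps)
  then have p: "s < u + L * real j / 2 ^ n" "u + L * real j / 2 ^ n < min b v"
    using Ln by (auto simp: c_def)
  then have "L * real j / 2 ^ n \<le> L" by (simp add: L_def)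
  then have "real j \<le> 2 ^ n" using L by (simp add: field_simps)
  then have "j \<le> 2 ^ n" by (metis of_nat_le_iff of_nat_numeral of_nat_power)
  with p b(2) show ?thesis by (intro exI[of _ n] exI[of _ j]) (auto simp: L_def)
qed

text \<open>By right continuity, the path is the pointwise limit of its values at the first point of
\<open>\<int> / (n + 1)\<close> strictly to the right; these are step functions.\<close>

lemma cadlag_on_borel_measurable:
  assumes "cadlag_on {0..} x"
  shows "(\<lambda>s. x (max 0 s)) \<in> borel_measurable borel"
proof -
  define g where "g n s = (real_of_int \<lfloor>real (Suc n) * max 0 s\<rfloor> + 1) / real (Suc n)" for n :: nat and s
  have g: "max 0 s < g n s" "g n s \<le> max 0 s + 1 / real (Suc n)" for n s
  proof -
    define N where "N = real (Suc n)"
    have N: "N > 0" by (simp add: N_def)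
    have "N * max 0 s < real_of_int \<lfloor>N * max 0 s\<rfloor> + 1" "real_of_int \<lfloor>N * max 0 s\<rfloor> \<le> N * max 0 s"
      by linarith+
    then have "max 0 s < (real_of_int \<lfloor>N * max 0 s\<rfloor> + 1) / N"
      "(real_of_int \<lfloor>N * max 0 s\<rfloor> + 1) / N \<le> (N * max 0 s + 1) / N"
      using N unfolding pos_less_divide_eq[OF N] by (simp_all only: mult.commute[of N] divide_right_mono
        less_imp_le[OF N] add_right_mono)
    moreover have "(N * max 0 s + 1) / N = max 0 s + 1 / N"
      using N by (simp add: add_divide_distrib)
    ultimately show "max 0 s < g n s" "g n s \<le> max 0 s + 1 / real (Suc n)"
      unfolding g_def N_def by linarith+
  qed
  show ?thesis
  proof (rule borel_measurable_LIMSEQ_real)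
    show "(\<lambda>n. x (g n s)) \<longlonglongrightarrow> x (max 0 s)" for s
    proof -
      have "(\<lambda>n. g n s) \<longlonglongrightarrow> max 0 s"
      proof (rule real_tendsto_sandwich[of "\<lambda>_. max 0 s" _ _ "\<lambda>n. max 0 s + 1 / real (Suc n)"])
        show "(\<lambda>n. max 0 s + 1 / real (Suc n)) \<longlonglongrightarrow> max 0 s"
          using tendsto_add[OF tendsto_const LIMSEQ_inverse_real_of_nat] by (simp add: inverse_eq_divide)
      qed (use g in \<open>auto simp del: max.bounded_iff intro!: always_eventually less_imp_le[OF g(1)]\<close>)
      then have "filterlim (\<lambda>n. g n s) (at_right (max 0 s)) sequentially"
        unfolding filterlim_at
        by (intro conjI always_eventually allI) (use g(1) less_imp_neq[OF g(1), symmetric] in \<open>auto simp del: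
          max_less_iff_conj\<close>)
      moreover have "(x \<longlongrightarrow> x (max 0 s)) (at_right (max 0 s))"
        by (rule cadlag_on_tendsto_right[OF assms, of _ "max 0 s + 1"]) auto
      ultimately show ?thesis by (rule filterlim_compose[rotated])
    qed
    have "(\<lambda>i::int. x ((real_of_int i + 1) / real (Suc n))) \<circ> (\<lambda>s. \<lfloor>real (Suc n) * max 0 s\<rfloor>) \<in>
      borel_measurable borel" for n
      by (rule measurable_comp[where N = "count_space UNIV"]) measurable
    then show "(\<lambda>s. x (g n s)) \<in> borel_measurable borel" for n
      by (simp add: g_def comp_def)
  qed
qed

lemma Bex_abs_gt_iff_dyadic:
  fixes Z :: "real \<Rightarrow> 'a \<Rightarrow> real"
  assumes "u \<le> v" "\<And>s. s \<in> {u..<v} \<Longrightarrow> ((\<lambda>s. Z s \<omega>) \<longlongrightarrow> Z s \<omega>) (at_right s)"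
  shows "(\<exists>s\<in>{u..v}. \<bar>Z s \<omega>\<bar> > R) \<longleftrightarrow> (\<exists>n. \<exists>j\<le>2 ^ n. \<bar>Z (u + (v - u) * real j / 2 ^ n) \<omega>\<bar> > R)"
proof
  assume "\<exists>s\<in>{u..v}. \<bar>Z s \<omega>\<bar> > R"
  then obtain s where "s \<in> {u..v}" "\<bar>Z s \<omega>\<bar> > R" by auto
  from exceeds_at_dyadic_point[OF this(1), of R "\<lambda>s. \<bar>Z s \<omega>\<bar>", OF this(2)] assms(2)
  show "\<exists>n. \<exists>j\<le>2 ^ n. \<bar>Z (u + (v - u) * real j / 2 ^ n) \<omega>\<bar> > R"
    by (force intro: tendsto_rabs)
next
  assume "\<exists>n. \<exists>j\<le>2 ^ n. \<bar>Z (u + (v - u) * real j / 2 ^ n) \<omega>\<bar> > R"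
  then obtain n j where nj: "j \<le> 2 ^ n" "\<bar>Z (u + (v - u) * real j / 2 ^ n) \<omega>\<bar> > R" by auto
  have "real j \<le> 2 ^ n" using nj(1) by (metis of_nat_le_iff of_nat_numeral of_nat_power)
  then have "(v - u) * real j / 2 ^ n \<le> v - u"
    using mult_left_mono[of "real j" "2 ^ n" "v - u"] assms(1) by (simp add: field_simps)
  then have "u + (v - u) * real j / 2 ^ n \<in> {u..v}"
    using assms(1) by auto
  with nj(2) show "\<exists>s\<in>{u..v}. \<bar>Z s \<omega>\<bar> > R" by blast
qed

text \<open>The union over all times in the interval is a countable one, taken over the dyadic points.\<close>

lemma sets_Bex_abs_gt:
  fixes Z :: "real \<Rightarrow> 'a \<Rightarrow> real"
  assumes "u \<le> v" "\<And>s. s \<in> {u..v} \<Longrightarrow> Z s \<in> borel_measurable P"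
    and "\<And>s \<omega>. s \<in> {u..<v} \<Longrightarrow> \<omega> \<in> space P \<Longrightarrow> ((\<lambda>s. Z s \<omega>) \<longlongrightarrow> Z s \<omega>) (at_right s)"
  shows "{\<omega>\<in>space P. \<exists>s\<in>{u..v}. \<bar>Z s \<omega>\<bar> > R} \<in> sets P"
proof -
  have "{\<omega>\<in>space P. \<exists>s\<in>{u..v}. \<bar>Z s \<omega>\<bar> > R} =
    (\<Union>n. \<Union>j\<in>{..2 ^ n}. {\<omega>\<in>space P. \<bar>Z (u + (v - u) * real j / 2 ^ n) \<omega>\<bar> > R})"
  proof -
    have "(\<exists>s\<in>{u..v}. \<bar>Z s \<omega>\<bar> > R) \<longleftrightarrow> (\<exists>n. \<exists>j\<le>2 ^ n. \<bar>Z (u + (v - u) * real j / 2 ^ n) \<omega>\<bar> > R)"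
      if "\<omega> \<in> space P" for \<omega>
      by (rule Bex_abs_gt_iff_dyadic) (use assms(1,3) that in auto)
    then have "{\<omega>\<in>space P. \<exists>s\<in>{u..v}. \<bar>Z s \<omega>\<bar> > R} =
      {\<omega>\<in>space P. \<exists>n. \<exists>j\<le>2 ^ n. \<bar>Z (u + (v - u) * real j / 2 ^ n) \<omega>\<bar> > R}"
      by (intro Collect_cong conj_cong) auto
    then show ?thesis by auto
  qed
  moreover have "{\<omega>\<in>space P. \<bar>Z (u + (v - u) * real j / 2 ^ n) \<omega>\<bar> > R} \<in> sets P" if "j \<le> 2 ^ n" for n j
  proof -
    have "real j \<le> 2 ^ n" using that by (metis of_nat_le_iff of_nat_numeral of_nat_power)
    then have "(v - u) * real j / 2 ^ n \<le> v - u"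
      using mult_left_mono[of "real j" "2 ^ n" "v - u"] assms(1) by (simp add: field_simps)
    then have [measurable]: "Z (u + (v - u) * real j / 2 ^ n) \<in> borel_measurable P"
      using assms(1) by (intro assms(2)) auto
    show ?thesis by measurable
  qed
  ultimately show ?thesis by auto
qed

text \<open>As the level grows, the events decrease to the empty set, because every single path is bounded on a
compact interval.\<close>

lemma (in prob_space) cadlag_process_tight_on_compact:
  assumes "u \<le> v" "\<And>s. s \<in> {u..v} \<Longrightarrow> Z s \<in> borel_measurable M"
    and cad: "cadlag_process M S Z" "{u..v} \<subseteq> S" and "\<epsilon> > 0"
  shows "\<exists>K>0. {\<omega>\<in>space M. \<exists>s\<in>{u..v}. \<bar>Z s \<omega>\<bar> > K} \<in> sets M \<and>
     prob {\<omega>\<in>space M. \<exists>s\<in>{u..v}. \<bar>Z s \<omega>\<bar> > K} < \<epsilon>"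
proof -
  define A where "A n = {\<omega>\<in>space M. \<exists>s\<in>{u..v}. \<bar>Z s \<omega>\<bar> > real (Suc n)}" for n :: nat
  have A: "A n \<in> sets M" for n
    unfolding A_def
  proof (rule sets_Bex_abs_gt)
    fix s \<omega> assume "s \<in> {u..<v}" "\<omega> \<in> space M"
    then show "((\<lambda>s. Z s \<omega>) \<longlongrightarrow> Z s \<omega>) (at_right s)"
      using cad by (intro cadlag_on_tendsto_right[of S _ s v]) (auto simp: cadlag_process_def)
  qed (use assms in auto)
  have "decseq A"
    unfolding decseq_Suc_iff A_def by (force intro: less_trans[rotated])
  moreover have "(\<Inter>n. A n) = {}"
  proof -
    have "\<exists>n. \<omega> \<notin> A n" for \<omega>
    proof (cases "\<omega> \<in> space M")
      case True
      then obtain B where B: "\<forall>s\<in>{u..v}. \<bar>Z s \<omega>\<bar> \<le> B"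
        using cadlag_on_bounded[of S "\<lambda>s. Z s \<omega>" u v] cad by (auto simp: cadlag_process_def)
      obtain n where "B < real n" using reals_Archimedean2 by blast
      with B show ?thesis by (intro exI[of _ n]) (fastforce simp: A_def)
    qed (auto simp: A_def)
    then show ?thesis by blast
  qed
  ultimately have "(\<lambda>n. prob (A n)) \<longlonglongrightarrow> 0"
    using finite_Lim_measure_decseq[of A] A by auto
  then have "\<forall>\<^sub>F n in sequentially. prob (A n) < \<epsilon>"
    using \<open>\<epsilon> > 0\<close> by (rule order_tendstoD)
  then obtain n where "prob (A n) < \<epsilon>" by (auto simp: eventually_sequentially)
  then show ?thesis using A[of n] unfolding A_def by (intro exI[of _ "real (Suc n)"]) auto
qed

lemma cadlag_on_cong:
  assumes "\<And>t. t \<in> S \<Longrightarrow> x t = y t"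
  shows "cadlag_on S x \<longleftrightarrow> cadlag_on S y"
proof -
  have ev: "\<forall>\<^sub>F s in at t within S \<inter> A. x s = y s" for t A
    using assms by (auto simp: eventually_at_filter)
  show ?thesis
    unfolding cadlag_on_def continuous_within
    using assms by (auto simp: tendsto_cong[OF ev])
qed

lemma cadlag_on_shift:
  assumes x: "cadlag_on S x" and sub: "\<And>\<theta>. \<theta> \<in> T \<Longrightarrow> t + \<theta> \<in> S"
  shows "cadlag_on T (\<lambda>\<theta>. x (t + \<theta>))"
  unfolding cadlag_on_def continuous_within
proof (intro ballI conjI)
  fix \<theta> assume \<theta>: "\<theta> \<in> T"
  have shift: "filterlim (\<lambda>\<theta>. t + \<theta>) (at (t + \<theta>) within S \<inter> A) (at \<theta> within T \<inter> B)"
    if "\<And>\<eta>. \<eta> \<in> B \<Longrightarrow> t + \<eta> \<in> A" for A B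
  proof -
    have "((\<lambda>\<theta>. t + \<theta>) \<longlongrightarrow> t + \<theta>) (at \<theta> within T \<inter> B)" by (intro tendsto_intros)
    moreover have "\<forall>\<^sub>F \<eta> in at \<theta> within T \<inter> B. t + \<eta> \<in> S \<inter> A \<and> t + \<eta> \<noteq> t + \<theta>"
      using that sub by (auto simp: eventually_at_filter)
    ultimately show ?thesis unfolding filterlim_at by blast
  qed
  have "(x \<longlongrightarrow> x (t + \<theta>)) (at (t + \<theta>) within S \<inter> {t + \<theta>..})"
    using x sub[OF \<theta>] unfolding cadlag_on_def continuous_within by auto
  from filterlim_compose[OF this shift[where B = "{\<theta>..}"]] show "((\<lambda>\<theta>. x (t + \<theta>)) \<longlongrightarrow> x (t + \<theta>)) (at \<theta> within T
    \<inter> {\<theta>..})"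
    by auto
  obtain l where "(x \<longlongrightarrow> l) (at (t + \<theta>) within S \<inter> {..<t + \<theta>})"
    using x sub[OF \<theta>] unfolding cadlag_on_def by auto
  from filterlim_compose[OF this shift[where B = "{..<\<theta>}"]] show "\<exists>l. ((\<lambda>\<theta>. x (t + \<theta>)) \<longlongrightarrow> l) (at \<theta> within T \<inter> {..<\<theta>})"
    by auto
qed

lemma segment_in_D_space:
  assumes "cadlag_on {-\<tau>..} x" "t \<ge> 0"
  shows "segment \<tau> x t \<in> D_space {-\<tau>..0}"
proof -
  have "cadlag_on {-\<tau>..0} (\<lambda>\<theta>. x (t + \<theta>))"
    by (rule cadlag_on_shift[OF assms(1)]) (use assms(2) in auto)
  then have "cadlag_on {-\<tau>..0} (segment \<tau> x t)"
    by (subst cadlag_on_cong[where y = "\<lambda>\<theta>. x (t + \<theta>)"]) (auto simp: segment_def)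
  then show ?thesis by (auto simp: D_space_def segment_def)
qed

text \<open>The coefficient only sees the segments of the path, and these do not change when the path is
restricted to \<open>[-\<tau>, \<infinity>)\<close>, which makes it an element of the space of paths.\<close>

lemma cadlag_on_coefficient:
  assumes f: "time_proper_locally_lipschitz \<tau> f" and x: "cadlag_on {-\<tau>..} x"
  shows "cadlag_on {0..} (\<lambda>t. f (segment \<tau> x t) t)"
proof -
  define y where "y = restrict x {-\<tau>..}"
  have "cadlag_on {-\<tau>..} y"
    using x by (subst cadlag_on_cong[where y = x]) (auto simp: y_def)
  then have "y \<in> D_space {-\<tau>..}" by (auto simp: D_space_def y_def)
  then have "cadlag_on {0..} (\<lambda>t. f (segment \<tau> y t) t)"
    using f unfolding time_proper_locally_lipschitz_def by blast
  moreover have "segment \<tau> y t = segment \<tau> x t" if "t \<ge> 0" for t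
    using that by (auto simp: segment_def y_def fun_eq_iff)
  ultimately show ?thesis
    by (subst cadlag_on_cong[where y = "\<lambda>t. f (segment \<tau> y t) t"]) auto
qed

lemma cadlag_on_left_lim_abs_le:
  assumes "cadlag_on {0..} x" "s > 0" "\<And>t. t \<ge> 0 \<Longrightarrow> \<bar>x t\<bar> \<le> \<beta>"
  shows "\<bar>left_lim x s\<bar> \<le> \<beta>"
proof (rule tendsto_upperbound)
  show "((\<lambda>t. \<bar>x t\<bar>) \<longlongrightarrow> \<bar>left_lim x s\<bar>) (at_left s)"
    by (intro tendsto_rabs cadlag_on_left_lim[OF assms(1), of 0]) (use assms(2) in auto)
  show "\<forall>\<^sub>F t in at_left s. \<bar>x t\<bar> \<le> \<beta>"
    unfolding eventually_at_left_field using assms(2,3) by (intro exI[of _ 0]) auto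
qed simp

lemma set_integrable_cadlag:
  assumes f: "cadlag_on {0..} f" and A: "A \<in> sets borel" "A \<subseteq> {0..t}"
  shows "set_integrable lborel A f"
proof -
  obtain B where B: "\<forall>s\<in>{0..t}. \<bar>f s\<bar> \<le> B"
    using cadlag_on_bounded[OF f, of 0 t] by auto
  have "integrable lborel (\<lambda>s. indicator A s *\<^sub>R f (max 0 s))"
  proof (rule integrableI_bounded_set_indicator[where B = B])
    show "(\<lambda>s. f (max 0 s)) \<in> borel_measurable lborel"
      using cadlag_on_borel_measurable[OF f] by simp
    have "emeasure lborel A \<le> emeasure lborel {0..t}" using A by (intro emeasure_mono) auto
    also have "\<dots> < \<infinity>" by (simp add: emeasure_lborel_Icc_eq)
    finally show "emeasure lborel A < \<infinity>" .
    show "AE s in lborel. s \<in> A \<longrightarrow> norm (f (max 0 s)) \<le> B" using B A(2) by (auto simp: max_def)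
  qed (use A in simp)
  moreover have "(\<lambda>s. indicator A s *\<^sub>R f (max 0 s)) = (\<lambda>s. indicator A s *\<^sub>R f s)"
    using A(2) by (auto simp: fun_eq_iff indicator_def max_def)
  ultimately show ?thesis unfolding set_integrable_def by simp
qed

lemma set_integral_cadlag_increment:
  assumes f: "cadlag_on {0..} f" and st: "0 \<le> s" "s \<le> t"
  shows "(\<And>r. r \<ge> 0 \<Longrightarrow> f r \<le> \<alpha>) \<Longrightarrow> (LBINT r:{0..t}. f r) - (LBINT r:{0..s}. f r) \<le> \<alpha> * (t - s)"
    and "(\<And>r. r \<ge> 0 \<Longrightarrow> f r \<ge> \<alpha>) \<Longrightarrow> (LBINT r:{0..t}. f r) - (LBINT r:{0..s}. f r) \<ge> \<alpha> * (t - s)"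
proof -
  note int = set_integrable_cadlag[OF f, of _ t]
  have "{0..t} = {0..s} \<union> {s<..t}" using st by auto
  moreover have "(LBINT r:{0..s} \<union> {s<..t}. f r) = (LBINT r:{0..s}. f r) + (LBINT r:{s<..t}. f r)"
    using st by (intro set_integral_Un int) auto
  ultimately have split: "(LBINT r:{0..t}. f r) - (LBINT r:{0..s}. f r) = (LBINT r:{s<..t}. f r)"
    by simp
  have cint: "set_integrable lborel {s<..t} (\<lambda>_. \<alpha>)"
    unfolding set_integrable_def by (intro integrable_real_indicator integrable_scaleR_left) (use st in auto)
  have const: "(LBINT r:{s<..t}. \<alpha>) = \<alpha> * (t - s)" using st by (simp add: set_lebesgue_integral_def)
  show "(LBINT r:{0..t}. f r) - (LBINT r:{0..s}. f r) \<le> \<alpha> * (t - s)" if "\<And>r. r \<ge> 0 \<Longrightarrow> f r \<le> \<alpha>"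
    unfolding split const[symmetric] using st that by (intro set_integral_mono int cint) auto
  show "(LBINT r:{0..t}. f r) - (LBINT r:{0..s}. f r) \<ge> \<alpha> * (t - s)" if "\<And>r. r \<ge> 0 \<Longrightarrow> f r \<ge> \<alpha>"
    unfolding split const[symmetric] using st that by (intro set_integral_mono int cint) auto
qed

section \<open>Orthogonal differences in discrete time\<close>

lemma integrable_mult_of_squares:
  fixes f g :: "'a \<Rightarrow> real"
  assumes [measurable]: "f \<in> borel_measurable M" "g \<in> borel_measurable M"
    and "integrable M (\<lambda>x. (f x)\<^sup>2)" "integrable M (\<lambda>x. (g x)\<^sup>2)"
  shows "integrable M (\<lambda>x. f x * g x)"
proof (rule Bochner_Integration.integrable_bound)
  show "integrable M (\<lambda>x. (f x)\<^sup>2 + (g x)\<^sup>2)" using assms by auto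
  show "AE x in M. norm (f x * g x) \<le> norm ((f x)\<^sup>2 + (g x)\<^sup>2)"
  proof (rule AE_I2)
    fix x
    have "2 * (\<bar>f x\<bar> * \<bar>g x\<bar>) \<le> (f x)\<^sup>2 + (g x)\<^sup>2"
      using sum_squares_bound[of "\<bar>f x\<bar>" "\<bar>g x\<bar>"] by (simp add: mult.assoc)
    moreover have "0 \<le> \<bar>f x\<bar> * \<bar>g x\<bar>" by simp
    ultimately show "norm (f x * g x) \<le> norm ((f x)\<^sup>2 + (g x)\<^sup>2)"
      by (simp add: abs_mult del: zero_le_mult_iff mult_nonneg_nonneg)
  qed
qed measurable

lemma integrable_add_square:
  fixes f g :: "'a \<Rightarrow> real"
  assumes [measurable]: "f \<in> borel_measurable M" "g \<in> borel_measurable M"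
    and "integrable M (\<lambda>x. (f x)\<^sup>2)" "integrable M (\<lambda>x. (g x)\<^sup>2)"
  shows "integrable M (\<lambda>x. (f x + g x)\<^sup>2)"
  unfolding power2_sum using integrable_mult_of_squares[OF assms] assms
  by (auto simp: mult.assoc)

lemma integrable_mult_bounded_square:
  fixes f g :: "'a \<Rightarrow> real"
  assumes [measurable]: "f \<in> borel_measurable M" "g \<in> borel_measurable M"
    and "\<And>x. x \<in> space M \<Longrightarrow> \<bar>f x\<bar> \<le> B" "integrable M (\<lambda>x. (g x)\<^sup>2)"
  shows "integrable M (\<lambda>x. (f x * g x)\<^sup>2)"
proof (rule Bochner_Integration.integrable_bound)
  show "integrable M (\<lambda>x. B\<^sup>2 * (g x)\<^sup>2)" using assms by auto
  show "AE x in M. norm ((f x * g x)\<^sup>2) \<le> norm (B\<^sup>2 * (g x)\<^sup>2)"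
  proof (rule AE_I2)
    fix x assume "x \<in> space M"
    then have "(f x)\<^sup>2 \<le> B\<^sup>2" using assms(3) by (metis abs_ge_zero order_trans abs_of_nonneg abs_le_square_iff)
    then show "norm ((f x * g x)\<^sup>2) \<le> norm (B\<^sup>2 * (g x)\<^sup>2)"
      by (simp add: power_mult_distrib mult_right_mono)
  qed
qed measurable

definition running_max :: "(nat \<Rightarrow> real) \<Rightarrow> nat \<Rightarrow> real" where
  "running_max s n = Max ((\<lambda>i. \<bar>s i\<bar>) ` {..n})"

lemma running_max_0: "running_max s 0 = \<bar>s 0\<bar>"
  by (simp add: running_max_def)

lemma running_max_Suc: "running_max s (Suc n) = max (running_max s n) \<bar>s (Suc n)\<bar>"
  by (simp add: running_max_def atMost_Suc max.commute)

lemma running_max_ge: "i \<le> n \<Longrightarrow> \<bar>s i\<bar> \<le> running_max s n"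
  by (simp add: running_max_def)

lemma running_max_nonneg: "0 \<le> running_max s n"
  using running_max_ge[of 0 n s] by linarith

lemma running_max_attained: "\<exists>i\<le>n. running_max s n = \<bar>s i\<bar>"
proof -
  have "running_max s n \<in> (\<lambda>i. \<bar>s i\<bar>) ` {..n}"
    unfolding running_max_def by (rule Max_in) auto
  then show ?thesis by auto
qed

text \<open>The pathwise form of Doob's \<open>L\<^sup>2\<close> inequality.  Write \<open>R\<close> for the running maximum.  Since
\<open>sgn (s i) * (s (Suc i) - s i) \<le> \<bar>s (Suc i)\<bar> - \<bar>s i\<bar>\<close>, the left-hand side is at most
\<open>\<Sum> R i (\<bar>s (Suc i)\<bar> - \<bar>s i\<bar>)\<close>, which is summed by parts: \<open>R\<close> increases only at times when
\<open>\<bar>s\<bar> = R\<close>, so that \<open>\<Sum> \<bar>s (Suc i)\<bar> (R (Suc i) - R i)\<close> is at least half the final value of \<open>R\<^sup>2\<close>.\<close>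

lemma sum_running_max_sgn_le:
  assumes "s 0 = 0"
  shows "(\<Sum>i<n. running_max s i * sgn (s i) * (s (Suc i) - s i))
    \<le> running_max s n * \<bar>s n\<bar> - (running_max s n)\<^sup>2 / 2"
proof (induction n)
  case 0
  then show ?case using assms by (simp add: running_max_0)
next
  case (Suc n)
  define R where "R = running_max s n"
  have R: "R \<ge> 0" unfolding R_def by (rule running_max_nonneg)
  have "sgn (s n) * (s (Suc n) - s n) \<le> \<bar>s (Suc n)\<bar> - \<bar>s n\<bar>"
    by (cases "s n" "0::real" rule: linorder_cases) auto
  from mult_left_mono[OF this R]
  have "R * sgn (s n) * (s (Suc n) - s n) \<le> R * \<bar>s (Suc n)\<bar> - R * \<bar>s n\<bar>"
    by (simp add: algebra_simps)
  with Suc have "(\<Sum>i<Suc n. running_max s i * sgn (s i) * (s (Suc i) - s i))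
      \<le> R * \<bar>s (Suc n)\<bar> - R\<^sup>2 / 2"
    by (simp add: R_def)
  also have "\<dots> \<le> max R \<bar>s (Suc n)\<bar> * \<bar>s (Suc n)\<bar> - (max R \<bar>s (Suc n)\<bar>)\<^sup>2 / 2"
    using sum_squares_bound[of R "\<bar>s (Suc n)\<bar>"]
    by (cases "R \<le> \<bar>s (Suc n)\<bar>") (auto simp: max_def power2_eq_square field_simps)
  finally show ?case by (simp add: running_max_Suc R_def)
qed

lemma running_max_square_le:
  assumes "s 0 = 0"
  shows "(running_max s n)\<^sup>2 + 4 * (\<Sum>i<n. running_max s i * sgn (s i) * (s (Suc i) - s i)) \<le> 4 * (s n)\<^sup>2"
  using sum_running_max_sgn_le[where s = s, OF assms, of n] sum_squares_bound[of "running_max s n" "2 * \<bar>s n\<bar>"]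
  by (simp add: power2_eq_square)

text \<open>The martingale property enters all estimates only through orthogonality of the differences to the
square integrable variables known before.  In this form it is inherited at once by transforms with
bounded coefficients, and it can be checked for martingales and for centred processes with
independent increments alike.\<close>

locale orthogonal_differences = prob_space M for M :: "'a measure" +
  fixes G :: "nat \<Rightarrow> 'a measure" and D :: "nat \<Rightarrow> 'a \<Rightarrow> real"
  assumes subalg: "subalgebra M (G i)"
    and G_mono: "i \<le> j \<Longrightarrow> sets (G i) \<subseteq> sets (G j)"
    and D_meas: "D i \<in> borel_measurable (G (Suc i))"
    and D_square: "integrable M (\<lambda>x. (D i x)\<^sup>2)"
    and D_orth: "W \<in> borel_measurable (G i) \<Longrightarrow> integrable M (\<lambda>x. (W x)\<^sup>2) \<Longrightarrow> (\<integral>x. W x * D i x \<partial>M) = 0"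
begin

lemma measurable_G_mono: "f \<in> borel_measurable (G i) \<Longrightarrow> i \<le> j \<Longrightarrow> f \<in> borel_measurable (G j)"
  using subalg[of i] subalg[of j] G_mono[of i j]
  by (auto simp: measurable_def subalgebra_def)

lemma measurable_G: "f \<in> borel_measurable (G i) \<Longrightarrow> f \<in> borel_measurable M"
  using measurable_from_subalg[OF subalg] by blast

definition psum :: "nat \<Rightarrow> 'a \<Rightarrow> real" where
  "psum n x = (\<Sum>i<n. D i x)"

lemma psum_0 [simp]: "psum 0 x = 0" and psum_Suc: "psum (Suc n) x = psum n x + D n x"
  by (simp_all add: psum_def)

lemma psum_meas: "psum n \<in> borel_measurable (G n)"
proof -
  have "D i \<in> borel_measurable (G n)" if "i < n" for i
    using measurable_G_mono[OF D_meas, of i n] that by auto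
  then show ?thesis unfolding psum_def[abs_def] by (intro borel_measurable_sum) auto
qed

lemma psum_square: "integrable M (\<lambda>x. (psum n x)\<^sup>2)"
proof (induction n)
  case (Suc n)
  then show ?case unfolding psum_Suc
    by (intro integrable_add_square D_square measurable_G[OF psum_meas] measurable_G[OF D_meas])
qed simp

text \<open>The mixed terms vanish by orthogonality.\<close>

lemma expectation_psum_square:
  "expectation (\<lambda>x. (psum n x)\<^sup>2) = (\<Sum>i<n. expectation (\<lambda>x. (D i x)\<^sup>2))"
proof (induction n)
  case (Suc n)
  have i: "integrable M (\<lambda>x. psum n x * D n x)"
    by (intro integrable_mult_of_squares psum_square D_square measurable_G[OF psum_meas] measurable_G[OF D_meas])
  have "expectation (\<lambda>x. (psum (Suc n) x)\<^sup>2)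
    = expectation (\<lambda>x. (psum n x)\<^sup>2 + (D n x)\<^sup>2 + 2 * (psum n x * D n x))"
    by (simp add: psum_Suc power2_sum mult.assoc)
  also have "\<dots> = expectation (\<lambda>x. (psum n x)\<^sup>2) + expectation (\<lambda>x. (D n x)\<^sup>2) + 2 * expectation (\<lambda>x. psum n x
    * D n x)"
    using i psum_square[of n] D_square[of n] by simp
  also have "expectation (\<lambda>x. psum n x * D n x) = 0"
    by (rule D_orth[OF psum_meas psum_square])
  finally show ?case using Suc by simp
qed simp

lemma running_max_meas: "(\<lambda>x. running_max (\<lambda>i. psum i x) n) \<in> borel_measurable (G n)"
proof (induction n)
  case (Suc n)
  note [measurable] = measurable_G_mono[OF Suc, of "Suc n", simplified] psum_meas[of "Suc n"]
  show ?case unfolding running_max_Suc by measurable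
qed (simp add: running_max_0)

lemma running_max_square: "integrable M (\<lambda>x. (running_max (\<lambda>i. psum i x) n)\<^sup>2)"
proof (rule Bochner_Integration.integrable_bound)
  show "integrable M (\<lambda>x. \<Sum>i\<le>n. (psum i x)\<^sup>2)" using psum_square by auto
  show "(\<lambda>x. (running_max (\<lambda>i. psum i x) n)\<^sup>2) \<in> borel_measurable M"
    using measurable_G[OF running_max_meas] by measurable
  show "AE x in M. norm ((running_max (\<lambda>i. psum i x) n)\<^sup>2) \<le> norm (\<Sum>i\<le>n. (psum i x)\<^sup>2)"
  proof (rule AE_I2)
    fix x
    obtain i where "i \<le> n" "running_max (\<lambda>i. psum i x) n = \<bar>psum i x\<bar>"
      using running_max_attained[of n "\<lambda>i. psum i x"] by auto
    then have "(running_max (\<lambda>i. psum i x) n)\<^sup>2 \<le> (\<Sum>i\<le>n. (psum i x)\<^sup>2)"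
      by (auto intro!: member_le_sum)
    then show "norm ((running_max (\<lambda>i. psum i x) n)\<^sup>2) \<le> norm (\<Sum>i\<le>n. (psum i x)\<^sup>2)"
      by simp
  qed
qed

text \<open>The integrated pathwise inequality: the coefficients \<open>R * sgn\<close> of the differences depend on the past
only, so that their sum has expectation 0.\<close>

lemma doob_L2:
  "expectation (\<lambda>x. (running_max (\<lambda>i. psum i x) n)\<^sup>2) \<le> 4 * expectation (\<lambda>x. (psum n x)\<^sup>2)"
proof -
  let ?R = "\<lambda>i x. running_max (\<lambda>i. psum i x) i"
  define W where "W i x = ?R i x * sgn (psum i x)" for i x
  have W_meas: "W i \<in> borel_measurable (G i)" for i
    unfolding W_def[abs_def] using running_max_meas psum_meas by measurable
  have W_sq: "integrable M (\<lambda>x. (W i x)\<^sup>2)" for i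
  proof (rule Bochner_Integration.integrable_bound[OF running_max_square[of i]])
    show "(\<lambda>x. (W i x)\<^sup>2) \<in> borel_measurable M" using measurable_G[OF W_meas] by measurable
    show "AE x in M. norm ((W i x)\<^sup>2) \<le> norm ((?R i x)\<^sup>2)"
      by (auto simp: W_def sgn_if power_mult_distrib)
  qed
  have int: "integrable M (\<lambda>x. W i x * D i x)" for i
    by (intro integrable_mult_of_squares W_sq D_square measurable_G[OF W_meas] measurable_G[OF D_meas])
  have "expectation (\<lambda>x. (?R n x)\<^sup>2) = expectation (\<lambda>x. (?R n x)\<^sup>2 + 4 * (\<Sum>i<n. W i x * D i x))"
    using int running_max_square[of n] D_orth[OF W_meas W_sq] by simp
  also have "\<dots> \<le> expectation (\<lambda>x. 4 * (psum n x)\<^sup>2)"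
  proof (rule integral_mono)
    fix x
    show "(?R n x)\<^sup>2 + 4 * (\<Sum>i<n. W i x * D i x) \<le> 4 * (psum n x)\<^sup>2"
      using running_max_square_le[of "\<lambda>i. psum i x" n] by (simp add: W_def psum_Suc)
  qed (use int running_max_square[of n] psum_square[of n] in auto)
  finally show ?thesis by simp
qed

lemma maximal_inequality:
  assumes "R > 0"
  shows "prob {x\<in>space M. running_max (\<lambda>i. psum i x) n \<ge> R} \<le> 4 * expectation (\<lambda>x. (psum n x)\<^sup>2) / R\<^sup>2"
proof -
  have "{x\<in>space M. running_max (\<lambda>i. psum i x) n \<ge> R} = {x\<in>space M. (running_max (\<lambda>i. psum i x) n)\<^sup>2 \<ge> R\<^sup>2}"
    using assms running_max_nonneg by (auto simp: power_mono_iff)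
  also have "prob \<dots> \<le> expectation (\<lambda>x. (running_max (\<lambda>i. psum i x) n)\<^sup>2) / R\<^sup>2"
    using assms running_max_square[of n] by (intro integral_Markov_inequality_measure[where A = "{}"]) auto
  also have "\<dots> \<le> 4 * expectation (\<lambda>x. (psum n x)\<^sup>2) / R\<^sup>2"
    by (intro divide_right_mono doob_L2) auto
  finally show ?thesis .
qed

text \<open>Testing \<open>Y i * D i\<close> against \<open>W\<close> is testing \<open>D i\<close> against \<open>Y i * W\<close>.\<close>

lemma transform:
  assumes Y: "\<And>i. Y i \<in> borel_measurable (G i)" and B: "\<And>i x. x \<in> space M \<Longrightarrow> \<bar>Y i x\<bar> \<le> B"
  shows "orthogonal_differences M G (\<lambda>i x. Y i x * D i x)"
proof
  fix i
  note [measurable] = Y[of i] measurable_G_mono[OF Y[of i], of "Suc i", simplified] D_meas[of i]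
  show "(\<lambda>x. Y i x * D i x) \<in> borel_measurable (G (Suc i))" by measurable
  show "integrable M (\<lambda>x. (Y i x * D i x)\<^sup>2)"
    by (intro integrable_mult_bounded_square D_square measurable_G[OF Y] measurable_G[OF D_meas]) (rule B)
  fix W :: "'a \<Rightarrow> real" assume W: "W \<in> borel_measurable (G i)" "integrable M (\<lambda>x. (W x)\<^sup>2)"
  have "integrable M (\<lambda>x. (Y i x * W x)\<^sup>2)"
    using B W by (intro integrable_mult_bounded_square W measurable_G[OF Y] measurable_G[OF W(1)])
  then have "(\<integral>x. (Y i x * W x) * D i x \<partial>M) = 0"
    using W by (intro D_orth) measurable
  then show "(\<integral>x. W x * (Y i x * D i x) \<partial>M) = 0" by (simp add: ac_simps)
qed (use subalg G_mono in auto)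

lemma expectation_transform_le:
  assumes Y: "\<And>i. Y i \<in> borel_measurable (G i)" and B: "\<And>i x. x \<in> space M \<Longrightarrow> \<bar>Y i x\<bar> \<le> B"
  shows "expectation (\<lambda>x. (\<Sum>i<n. Y i x * D i x)\<^sup>2) \<le> B\<^sup>2 * expectation (\<lambda>x. (psum n x)\<^sup>2)"
proof -
  interpret T: orthogonal_differences M G "\<lambda>i x. Y i x * D i x" by (rule transform[OF assms])
  have "expectation (\<lambda>x. (\<Sum>i<n. Y i x * D i x)\<^sup>2) = (\<Sum>i<n. expectation (\<lambda>x. (Y i x * D i x)\<^sup>2))"
    using T.expectation_psum_square[of n] by (simp add: T.psum_def)
  also have "\<dots> \<le> (\<Sum>i<n. expectation (\<lambda>x. B\<^sup>2 * (D i x)\<^sup>2))"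
  proof (intro sum_mono integral_mono)
    fix i x assume "x \<in> space M"
    then have "(Y i x)\<^sup>2 \<le> B\<^sup>2" using B by (metis abs_ge_zero order_trans abs_of_nonneg abs_le_square_iff)
    then show "(Y i x * D i x)\<^sup>2 \<le> B\<^sup>2 * (D i x)\<^sup>2"
      by (simp add: power_mult_distrib mult_right_mono)
  qed (use T.D_square D_square in auto)
  also have "\<dots> = B\<^sup>2 * expectation (\<lambda>x. (psum n x)\<^sup>2)"
    by (simp add: expectation_psum_square sum_distrib_left)
  finally show ?thesis .
qed

text \<open>A bound for the second moment by a truncation of the sum of squares \<open>V\<close>, which can be passed to
the limit when \<open>V\<close> converges in probability only.  Stop when \<open>V\<close> exceeds \<open>K\<close>, that is, split the
differences by means of the indicators \<open>A i\<close> of \<open>V i \<le> K\<close>.  Up to stopping, the sum of squares is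
at most \<open>K\<close> plus the square of the last difference, which is at most \<open>(2R)\<^sup>2\<close>.  The second moment of
the differences after stopping is that of their sum; this sum is a difference of two values of the
path, hence at most \<open>2R\<close>, and it vanishes unless \<open>V\<close> exceeds \<open>K\<close>.\<close>

lemma second_moment_le_truncated:
  fixes n :: nat and K :: real
  assumes K: "K > 0"
  defines "V \<equiv> \<lambda>j x. \<Sum>i<j. (D i x)\<^sup>2"
    and "R \<equiv> \<lambda>x. running_max (\<lambda>i. psum i x) n"
  shows "expectation (\<lambda>x. (psum n x)\<^sup>2) \<le>
    expectation (\<lambda>x. min (V n x) (K + 4 * (R x)\<^sup>2)) + 4 * expectation (\<lambda>x. (R x)\<^sup>2 * min 1 (V n x / K))"
proof -
  define A where "A i x = (if V i x \<le> K then 1 else 0 :: real)" for i x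
  have V_meas: "V j \<in> borel_measurable (G j)" for j
    unfolding V_def using measurable_G_mono[OF D_meas, of _ j]
    by (intro borel_measurable_sum borel_measurable_power) auto
  have A_meas: "A i \<in> borel_measurable (G i)" for i
    unfolding A_def[abs_def] using V_meas[of i] by measurable
  have A'_meas: "(\<lambda>x. 1 - A i x) \<in> borel_measurable (G i)" for i using A_meas[of i] by measurable
  interpret T: orthogonal_differences M G "\<lambda>i x. (1 - A i x) * D i x"
    by (rule transform[OF A'_meas, where B = 1]) (auto simp: A_def)
  interpret U: orthogonal_differences M G "\<lambda>i x. A i x * D i x"
    by (rule transform[OF A_meas, where B = 1]) (auto simp: A_def)
  have V_mono: "V i x \<le> V j x" if "i \<le> j" for i j x
    unfolding V_def using that by (intro sum_mono2) auto
  have V_nn: "0 \<le> V j x" for j x unfolding V_def by (intro sum_nonneg) auto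
  have R_ge: "\<bar>psum j x\<bar> \<le> R x" if "j \<le> n" for j x
    unfolding R_def by (rule running_max_ge[OF that])
  have diff_le: "(psum i x - psum j x)\<^sup>2 \<le> 4 * (R x)\<^sup>2" if "i \<le> n" "j \<le> n" for i j x
  proof -
    have "\<bar>psum i x - psum j x\<bar> \<le> 2 * R x" using R_ge[OF that(1), of x] R_ge[OF that(2), of x] by linarith
    then have "(psum i x - psum j x)\<^sup>2 \<le> (2 * R x)\<^sup>2" using abs_le_square_iff by (metis abs_ge_self order_trans)
    then show ?thesis by (simp add: power_mult_distrib)
  qed
  have U_le: "(\<Sum>i<n. (A i x * D i x)\<^sup>2) \<le> min (V n x) (K + 4 * (R x)\<^sup>2)" for x
  proof -
    have "(\<Sum>i<j. (A i x * D i x)\<^sup>2) \<le> V j x" for j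
      unfolding V_def by (intro sum_mono) (auto simp: A_def)
    moreover have "(\<Sum>i<j. (A i x * D i x)\<^sup>2) \<le> K + 4 * (R x)\<^sup>2" if "j \<le> n" for j
      using that
    proof (induction j)
      case (Suc j)
      show ?case
      proof (cases "V j x \<le> K")
        case True
        have "(\<Sum>i<Suc j. (A i x * D i x)\<^sup>2) \<le> V (Suc j) x" by fact
        also have "\<dots> \<le> K + (D j x)\<^sup>2" using True by (simp add: V_def)
        also have "(D j x)\<^sup>2 = (psum (Suc j) x - psum j x)\<^sup>2" by (simp add: psum_Suc)
        also have "\<dots> \<le> 4 * (R x)\<^sup>2" using Suc.prems by (intro diff_le) auto
        finally show ?thesis by simp
      next
        case False
        then show ?thesis using Suc by (simp add: A_def)
      qed
    qed (use K in simp)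
    ultimately show ?thesis by auto
  qed
  have T_le: "(T.psum n x)\<^sup>2 \<le> 4 * ((R x)\<^sup>2 * min 1 (V n x / K))" for x
  proof -
    have ex: "\<exists>i\<le>j. T.psum j x = psum j x - psum i x \<and> (V j x \<le> K \<longrightarrow> i = j)" for j
    proof (induction j)
      case (Suc j)
      show ?case
      proof (cases "V j x \<le> K")
        case True
        then have "T.psum j x = 0" using Suc by auto
        moreover have "A j x = 1" using True by (simp add: A_def)
        ultimately show ?thesis by (intro exI[of _ "Suc j"]) (simp add: T.psum_Suc)
      next
        case False
        then have "\<not> V (Suc j) x \<le> K" using V_mono[of j "Suc j" x] by simp
        moreover obtain i where "i \<le> j" "T.psum j x = psum j x - psum i x" using Suc by auto
        moreover have "A j x = 0" using False by (simp add: A_def)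
        ultimately show ?thesis
          by (intro exI[of _ i]) (simp add: T.psum_Suc psum_Suc)
      qed
    qed simp
    show ?thesis
    proof (cases "V n x \<le> K")
      case True
      then have "T.psum n x = 0" using ex[of n] by auto
      moreover have "0 \<le> (R x)\<^sup>2 * min 1 (V n x / K)" using V_nn[of n x] K by simp
      ultimately show ?thesis by simp
    next
      case False
      obtain i where i: "i \<le> n" "T.psum n x = psum n x - psum i x" using ex[of n] by auto
      have "min 1 (V n x / K) = 1" using False K by (simp add: min_def field_simps)
      then show ?thesis using diff_le[of n i x] i by simp
    qed
  qed
  have V_int: "integrable M (V n)" unfolding V_def using D_square by auto
  have R_int: "integrable M (\<lambda>x. (R x)\<^sup>2)" unfolding R_def by (rule running_max_square)
  note [measurable] = measurable_G[OF V_meas[of n]] borel_measurable_integrable[OF R_int]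
  have int1: "integrable M (\<lambda>x. min (V n x) (K + 4 * (R x)\<^sup>2))"
    by (rule Bochner_Integration.integrable_bound[OF V_int]) (use V_nn K in auto)
  have int2: "integrable M (\<lambda>x. (R x)\<^sup>2 * min 1 (V n x / K))"
  proof (rule Bochner_Integration.integrable_bound[OF R_int])
    show "AE x in M. norm ((R x)\<^sup>2 * min 1 (V n x / K)) \<le> norm ((R x)\<^sup>2)"
      using V_nn K by (auto simp: abs_mult intro!: mult_left_le)
  qed measurable
  have "expectation (\<lambda>x. (psum n x)\<^sup>2) = (\<Sum>i<n. expectation (\<lambda>x. (D i x)\<^sup>2))"
    by (rule expectation_psum_square)
  also have "\<dots> = (\<Sum>i<n. expectation (\<lambda>x. (A i x * D i x)\<^sup>2) + expectation (\<lambda>x. ((1 - A i x) * D i x)\<^sup>2))"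
  proof (rule sum.cong)
    fix i
    have "expectation (\<lambda>x. (A i x * D i x)\<^sup>2) + expectation (\<lambda>x. ((1 - A i x) * D i x)\<^sup>2)
      = expectation (\<lambda>x. (A i x * D i x)\<^sup>2 + ((1 - A i x) * D i x)\<^sup>2)"
      using U.D_square T.D_square by simp
    also have "\<dots> = expectation (\<lambda>x. (D i x)\<^sup>2)"
      by (intro Bochner_Integration.integral_cong) (auto simp: A_def)
    finally show "expectation (\<lambda>x. (D i x)\<^sup>2) = expectation (\<lambda>x. (A i x * D i x)\<^sup>2) + expectation (\<lambda>x. ((1 - A
      i x) * D i x)\<^sup>2)" ..
  qed simp
  also have "\<dots> = expectation (\<lambda>x. \<Sum>i<n. (A i x * D i x)\<^sup>2) + expectation (\<lambda>x. (T.psum n x)\<^sup>2)"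
    using U.D_square by (simp add: sum.distrib T.expectation_psum_square)
  also have "expectation (\<lambda>x. \<Sum>i<n. (A i x * D i x)\<^sup>2) \<le> expectation (\<lambda>x. min (V n x) (K + 4 * (R x)\<^sup>2))"
    by (intro integral_mono U_le int1) (use U.D_square in auto)
  also have "expectation (\<lambda>x. (T.psum n x)\<^sup>2) \<le> expectation (\<lambda>x. 4 * ((R x)\<^sup>2 * min 1 (V n x / K)))"
    by (intro integral_mono T_le T.psum_square) (use int2 in auto)
  finally show ?thesis by simp
qed

end

section \<open>Stochastic integrals along dyadic grids\<close>

locale filtered_space = prob_space P for P :: "'a measure" +
  fixes F :: "real \<Rightarrow> 'a measure"
  assumes F_sub: "subalgebra P (F t)"
    and F_mono: "s \<le> t \<Longrightarrow> sets (F s) \<subseteq> sets (F t)"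
begin

lemma measurable_F: "f \<in> borel_measurable (F t) \<Longrightarrow> f \<in> borel_measurable P"
  using measurable_from_subalg[OF F_sub] by blast

lemma measurable_F_mono: "f \<in> borel_measurable (F s) \<Longrightarrow> s \<le> t \<Longrightarrow> f \<in> borel_measurable (F t)"
  using F_sub[of s] F_sub[of t] F_mono[of s t]
  by (auto simp: measurable_def subalgebra_def)

end

lemma filtered_space_of_usual_conditions:
  assumes "prob_space P" "usual_conditions P F"
  shows "filtered_space P F"
  using assms unfolding filtered_space_def filtered_space_axioms_def usual_conditions_def
  by (auto dest: filtration.sets_F_mono)

text \<open>The continuous-time counterpart of orthogonal differences; sampling along a grid leads from one to
the other.\<close>

definition orthogonal_increments ::
    "'a measure \<Rightarrow> (real \<Rightarrow> 'a measure) \<Rightarrow> (real \<Rightarrow> 'a \<Rightarrow> real) \<Rightarrow> bool" where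
  "orthogonal_increments P F N \<longleftrightarrow>
     adapted_on F {0..} N \<and> square_integrable P N \<and>
     (\<forall>s\<ge>0. \<forall>t\<ge>s. \<forall>W\<in>borel_measurable (F s). integrable P (\<lambda>\<omega>. (W \<omega>)\<^sup>2) \<longrightarrow>
        (\<integral>\<omega>. W \<omega> * (N t \<omega> - N s \<omega>) \<partial>P) = 0)"

definition grid :: "real \<Rightarrow> nat \<Rightarrow> nat \<Rightarrow> real" where
  "grid h n i = h * real i / 2 ^ n"

lemma grid_mono: "h \<ge> 0 \<Longrightarrow> i \<le> j \<Longrightarrow> grid h n i \<le> grid h n j"
  by (auto simp: grid_def intro!: divide_right_mono mult_left_mono)

lemma grid_nonneg: "h \<ge> 0 \<Longrightarrow> 0 \<le> grid h n i"
  by (simp add: grid_def)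

lemma grid_0 [simp]: "grid h n 0 = 0"
  by (simp add: grid_def)

lemma grid_refine: "p \<le> n \<Longrightarrow> grid h n (i * 2 ^ (n - p)) = grid h p i"
proof -
  assume "p \<le> n"
  then have "(2::real) ^ n = 2 ^ (n - p) * 2 ^ p" by (simp flip: power_add)
  then show ?thesis by (simp add: grid_def)
qed

lemma grid_Suc: "grid h n (Suc i) = grid h n i + h / 2 ^ n"
  by (simp add: grid_def ring_distribs add_divide_distrib)

lemma grid_unit: "grid h n (u * 2 ^ n) = real u * h"
  by (simp add: grid_def)

text \<open>The cells are open on the left, which is why the index is a ceiling minus one.\<close>

lemma grid_cell_iff:
  assumes "h > 0" "s > 0"
  shows "s \<in> {grid h n i<..grid h n (Suc i)} \<longleftrightarrow> i = nat (\<lceil>s * 2 ^ n / h\<rceil> - 1)"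
proof -
  have pos: "s * 2 ^ n / h > 0" using assms by simp
  have "s \<in> {grid h n i<..grid h n (Suc i)} \<longleftrightarrow> real i < s * 2 ^ n / h \<and> s * 2 ^ n / h \<le> real i + 1"
    using assms by (auto simp: grid_def field_simps)
  also have "\<dots> \<longleftrightarrow> \<lceil>s * 2 ^ n / h\<rceil> = int i + 1"
    by (auto simp: ceiling_eq_iff)
  also have "\<dots> \<longleftrightarrow> i = nat (\<lceil>s * 2 ^ n / h\<rceil> - 1)"
    using pos by (auto simp: zero_less_ceiling[symmetric] simp del: zero_less_ceiling zero_less_divide_iff)
  finally show ?thesis .
qed

lemma elementary_process_grid:
  fixes n :: nat
  assumes "h > 0" "s > 0"
  defines "i \<equiv> nat (\<lceil>s * 2 ^ n / h\<rceil> - 1)"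
  shows "elementary_process k (grid h n) Y s \<omega> = (if i < k then Y i \<omega> else 0)"
proof -
  have "elementary_process k (grid h n) Y s \<omega> = (\<Sum>j<k. if j = i then Y j \<omega> else 0)"
    unfolding elementary_process_def indicator_def grid_cell_iff[OF assms(1,2)] i_def
    by (intro sum.cong) auto
  then show ?thesis by simp
qed

lemma elementary_integral_at_node:
  assumes "\<And>i j. i \<le> j \<Longrightarrow> t i \<le> t j" "j \<le> k"
  shows "elementary_integral M k t Y (t j) \<omega> = (\<Sum>i<j. Y i \<omega> * (M (t (Suc i)) \<omega> - M (t i) \<omega>))"
proof -
  have "elementary_integral M k t Y (t j) \<omega>
    = (\<Sum>i<k. if i < j then Y i \<omega> * (M (t (Suc i)) \<omega> - M (t i) \<omega>) else 0)"
    unfolding elementary_integral_def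
  proof (rule sum.cong)
    fix i
    show "Y i \<omega> * (M (min (t (Suc i)) (t j)) \<omega> - M (min (t i) (t j)) \<omega>)
      = (if i < j then Y i \<omega> * (M (t (Suc i)) \<omega> - M (t i) \<omega>) else 0)"
      using assms(1)[of i j] assms(1)[of "Suc i" j] assms(1)[of j i] assms(1)[of j "Suc i"]
      by (cases "i < j") (auto simp: min_def)
  qed simp
  also have "\<dots> = (\<Sum>i\<in>{..<k} \<inter> {i. i < j}. Y i \<omega> * (M (t (Suc i)) \<omega> - M (t i) \<omega>))"
    by (simp add: sum.inter_restrict)
  also have "{..<k} \<inter> {i. i < j} = {..<j}" using assms(2) by auto
  finally show ?thesis .
qed

lemma elementary_integral_grid_increment:
  assumes "h \<ge> 0" "k + l \<le> K"
  shows "elementary_integral M K (grid h n) Y (grid h n (k + l)) \<omega> - elementary_integral M K (grid h n) Y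
    (grid h n k) \<omega>
    = (\<Sum>i<l. Y (k + i) \<omega> * (M (grid h n (Suc (k + i))) \<omega> - M (grid h n (k + i)) \<omega>))"
proof -
  have "elementary_integral M K (grid h n) Y (grid h n j) \<omega>
    = (\<Sum>i<j. Y i \<omega> * (M (grid h n (Suc i)) \<omega> - M (grid h n i) \<omega>))" if "j \<le> k + l" for j
    using that assms by (intro elementary_integral_at_node grid_mono) auto
  moreover have "(\<Sum>i<k + l. f i) = (\<Sum>i<k. f i) + (\<Sum>i<l. f (k + i))" for f :: "nat \<Rightarrow> real"
    by (induction l) simp_all
  ultimately show ?thesis by simp
qed

lemma tendsto_right_stopped:
  fixes x :: "real \<Rightarrow> real"
  assumes "(x \<longlongrightarrow> x s) (at_right s)"
  shows "((\<lambda>s. x (min a s)) \<longlongrightarrow> x (min a s)) (at_right s)"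
proof (cases "s < a")
  case True
  then have "\<forall>\<^sub>F y in at_right s. x y = x (min a y)"
    using eventually_at_right_field[of "\<lambda>y. x y = x (min a y)" s] by (auto intro!: exI[of _ a])
  from Lim_transform_eventually[OF assms this] show ?thesis using True by simp
next
  case False
  then have "\<forall>\<^sub>F y in at_right s. x a = x (min a y)"
    using eventually_at_right_field[of "\<lambda>y. x a = x (min a y)" s]
    by (auto intro!: exI[of _ "s + 1"] simp: min_def)
  from Lim_transform_eventually[OF tendsto_const this] show ?thesis using False by (simp add: min_def)
qed

context filtered_space
begin

lemma orthogonal_differences_grid:
  assumes N: "orthogonal_increments P F N" and h: "h \<ge> 0"
  shows "orthogonal_differences P (\<lambda>i. F (grid h n (k + i)))
    (\<lambda>i \<omega>. N (grid h n (Suc (k + i))) \<omega> - N (grid h n (k + i)) \<omega>)"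
proof
  fix i
  let ?s = "grid h n (k + i)" and ?t = "grid h n (Suc (k + i))"
  have st: "0 \<le> ?s" "?s \<le> ?t" using h by (auto intro: grid_nonneg grid_mono)
  have meas: "N ?s \<in> borel_measurable (F ?s)" "N ?t \<in> borel_measurable (F ?t)"
    and sq: "integrable P (\<lambda>\<omega>. (N ?s \<omega>)\<^sup>2)" "integrable P (\<lambda>\<omega>. (N ?t \<omega>)\<^sup>2)"
    using N st unfolding orthogonal_increments_def adapted_on_def square_integrable_def by auto
  have meas': "N ?s \<in> borel_measurable (F ?t)" by (rule measurable_F_mono[OF meas(1) st(2)])
  show "(\<lambda>\<omega>. N ?t \<omega> - N ?s \<omega>) \<in> borel_measurable (F (grid h n (k + Suc i)))"
    using meas meas' by simp
  show "integrable P (\<lambda>\<omega>. (N ?t \<omega> - N ?s \<omega>)\<^sup>2)"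
    using integrable_add_square[of "N ?t" P "\<lambda>\<omega>. - N ?s \<omega>"] sq measurable_F[OF meas(1)] measurable_F[OF meas(2)]
    by simp
  show "(\<integral>\<omega>. W \<omega> * (N ?t \<omega> - N ?s \<omega>) \<partial>P) = 0"
    if "W \<in> borel_measurable (F ?s)" "integrable P (\<lambda>\<omega>. (W \<omega>)\<^sup>2)" for W
    using N st that unfolding orthogonal_increments_def by auto
qed (use F_sub F_mono grid_mono h in auto)

text \<open>An admissible approximation of the integrand \<open>H\<close> is obtained by freezing, on each dyadic cell, a
process \<open>G\<close> at the left end point.  These points tend to \<open>s\<close> strictly from the left, so that it is
the left limit of \<open>G\<close> that has to be \<open>H\<close>; this covers both a left-continuous \<open>G = H\<close> and the left
limits \<open>H\<close> of a cadlag \<open>G\<close>.\<close>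

lemma ucp_tendsto_grid:
  assumes I: "has_stoch_integral P F M H I" and h: "h > 0"
    and G_meas: "\<And>t. t \<ge> 0 \<Longrightarrow> G t \<in> borel_measurable (F t)"
    and G_bdd: "\<And>\<omega> T. \<omega> \<in> space P \<Longrightarrow> \<exists>C. \<forall>s\<in>{0..T}. \<bar>G s \<omega>\<bar> \<le> C"
    and G_lim: "\<And>\<omega> s. \<omega> \<in> space P \<Longrightarrow> s > 0 \<Longrightarrow> ((\<lambda>u. G u \<omega>) \<longlongrightarrow> H s \<omega>) (at_left s)"
  shows "ucp_tendsto P (\<lambda>n. elementary_integral M (n * 2 ^ n) (grid h n) (\<lambda>i. G (grid h n i))) I"
proof -
  define ix where "ix n s = nat (\<lceil>s * 2 ^ n / h\<rceil> - 1)" for n :: nat and s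
  have ix: "grid h n (ix n s) < s" "s \<le> grid h n (Suc (ix n s))" if "s > 0" for n s
    using grid_cell_iff[OF h that, of n "ix n s"] by (auto simp: ix_def)
  note ep = elementary_process_grid[OF h, folded ix_def]
  have el: "elementary F (n * 2 ^ n) (grid h n) (\<lambda>i. G (grid h n i))" for n
    using h unfolding elementary_def by (auto intro!: G_meas grid_nonneg grid_mono)
  have conv: "(\<lambda>n. elementary_process (n * 2 ^ n) (grid h n) (\<lambda>i. G (grid h n i)) s \<omega>) \<longlonglongrightarrow> H s \<omega>"
    if \<omega>: "\<omega> \<in> space P" and s: "s > 0" for \<omega> s
  proof -
    have "(\<lambda>n. grid h n (ix n s)) \<longlonglongrightarrow> s"
    proof (rule real_tendsto_sandwich[of "\<lambda>n. s - h * (1 / 2) ^ n" _ _ "\<lambda>_. s"])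
      have "(\<lambda>n. h * (1 / 2) ^ n) \<longlonglongrightarrow> h * 0"
        by (intro tendsto_mult tendsto_const LIMSEQ_power_zero) simp
      from tendsto_diff[OF tendsto_const this]
      show "(\<lambda>n. s - h * (1 / 2) ^ n) \<longlonglongrightarrow> s" by simp
      have "s - h * (1 / 2) ^ n \<le> grid h n (ix n s)" for n
        using ix(2)[OF s, of n] by (simp add: grid_Suc power_one_over)
      then show "\<forall>\<^sub>F n in sequentially. s - h * (1 / 2) ^ n \<le> grid h n (ix n s)" by simp
      show "\<forall>\<^sub>F n in sequentially. grid h n (ix n s) \<le> s"
        by (intro always_eventually allI less_imp_le ix s)
    qed simp
    then have "filterlim (\<lambda>n. grid h n (ix n s)) (at_left s) sequentially"
      unfolding filterlim_at
      by (intro conjI always_eventually allI)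
        (use ix(1)[OF s] less_imp_neq[OF ix(1)[OF s]] in auto)
    from filterlim_compose[OF G_lim[OF \<omega> s] this]
    have lim: "(\<lambda>n. G (grid h n (ix n s)) \<omega>) \<longlonglongrightarrow> H s \<omega>" .
    obtain n0 :: nat where n0: "s / h \<le> real n0" using real_arch_simple by blast
    have "\<forall>\<^sub>F n in sequentially. G (grid h n (ix n s)) \<omega>
      = elementary_process (n * 2 ^ n) (grid h n) (\<lambda>i. G (grid h n i)) s \<omega>"
      unfolding eventually_sequentially
    proof (intro exI allI impI)
      fix n assume "n0 \<le> n"
      then have "s / h \<le> real n" using n0 by linarith
      then have "s \<le> real n * h" using h by (simp add: field_simps)
      with ix(1)[OF s, of n] have "grid h n (ix n s) < grid h n (n * 2 ^ n)"
        unfolding grid_unit by linarith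
      then have "ix n s < n * 2 ^ n" using grid_mono[of h "n * 2 ^ n" "ix n s" n] h by linarith
      then show "G (grid h n (ix n s)) \<omega>
        = elementary_process (n * 2 ^ n) (grid h n) (\<lambda>i. G (grid h n i)) s \<omega>"
        by (simp add: ep[OF s])
    qed
    from Lim_transform_eventually[OF lim this] show ?thesis .
  qed
  have bdd: "\<exists>C. \<forall>n. \<forall>s\<in>{0<..T}.
      \<bar>elementary_process (n * 2 ^ n) (grid h n) (\<lambda>i. G (grid h n i)) s \<omega>\<bar> \<le> C"
    if \<omega>: "\<omega> \<in> space P" for \<omega> T
  proof -
    obtain C where C: "\<forall>s\<in>{0..T}. \<bar>G s \<omega>\<bar> \<le> C" using G_bdd[OF \<omega>] by blast
    show ?thesis
    proof (intro exI allI ballI)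
      fix n s assume s: "s \<in> {0<..T}"
      then have "grid h n (ix n s) \<in> {0..T}" using ix(1)[of s n] h grid_nonneg[of h n "ix n s"] by auto
      then have "\<bar>G (grid h n (ix n s)) \<omega>\<bar> \<le> \<bar>C\<bar>" using C by fastforce
      then show "\<bar>elementary_process (n * 2 ^ n) (grid h n) (\<lambda>i. G (grid h n i)) s \<omega>\<bar> \<le> \<bar>C\<bar>"
        using s by (simp add: ep)
    qed
  qed
  from I[unfolded has_stoch_integral_def] have
    "(\<forall>n. elementary F (k n) (t n) (Y n)) \<and>
      (\<forall>\<omega>\<in>space P. \<forall>s>0. (\<lambda>n. elementary_process (k n) (t n) (Y n) s \<omega>) \<longlonglongrightarrow> H s \<omega>) \<and>
      (\<forall>\<omega>\<in>space P. \<forall>T>0. \<exists>C. \<forall>n. \<forall>s\<in>{0<..T}. \<bar>elementary_process (k n) (t n) (Y n) s \<omega>\<bar> \<le> C)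
      \<longrightarrow> ucp_tendsto P (\<lambda>n. elementary_integral M (k n) (t n) (Y n)) I" for k t Y
    by blast
  from this[of "\<lambda>n. n * 2 ^ n" "grid h" "\<lambda>n i. G (grid h n i)"]
  show ?thesis using el conv bdd by simp
qed

lemma sets_elementary_integral_deviation:
  assumes M: "cadlag_process P {0..} M" "adapted_on F {0..} M"
    and I: "cadlag_process P {0..} I" "adapted_on F {0..} I"
    and t: "\<And>i. 0 \<le> t i" and Y: "\<And>i. Y i \<in> borel_measurable P" and T: "0 \<le> T"
  shows "{\<omega>\<in>space P. \<exists>s\<in>{0..T}. \<bar>elementary_integral M k t Y s \<omega> - I s \<omega>\<bar> > \<epsilon>} \<in> sets P"
proof (rule sets_Bex_abs_gt[OF T])
  fix s assume "s \<in> {0..T}"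
  then have [measurable]: "I s \<in> borel_measurable P" "\<And>i. M (min (t i) s) \<in> borel_measurable P"
    using M I t by (auto simp: adapted_on_def intro!: measurable_F)
  note [measurable] = Y
  show "(\<lambda>\<omega>. elementary_integral M k t Y s \<omega> - I s \<omega>) \<in> borel_measurable P"
    unfolding elementary_integral_def by measurable
next
  fix s \<omega> assume s: "s \<in> {0..<T}" "\<omega> \<in> space P"
  then have "((\<lambda>s. M s \<omega>) \<longlongrightarrow> M s \<omega>) (at_right s)" "((\<lambda>s. I s \<omega>) \<longlongrightarrow> I s \<omega>) (at_right s)"
    using M I by (auto simp: cadlag_process_def intro!: cadlag_on_tendsto_right[of "{0..}" _ s T])
  then show "((\<lambda>s. elementary_integral M k t Y s \<omega> - I s \<omega>) \<longlongrightarrow>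
      elementary_integral M k t Y s \<omega> - I s \<omega>) (at_right s)"
    unfolding elementary_integral_def by (intro tendsto_intros tendsto_right_stopped)
qed

lemma sets_increment_exceeds:
  assumes I: "cadlag_process P {0..} I" "adapted_on F {0..} I" and uv: "0 \<le> u" "u \<le> v"
  shows "{\<omega>\<in>space P. \<exists>s\<in>{u..v}. \<bar>I s \<omega> - I u \<omega>\<bar> > R} \<in> sets P"
proof (rule sets_Bex_abs_gt[OF uv(2)])
  fix s assume "s \<in> {u..v}"
  then have [measurable]: "I s \<in> borel_measurable P" "I u \<in> borel_measurable P"
    using I uv by (auto simp: adapted_on_def intro!: measurable_F)
  show "(\<lambda>\<omega>. I s \<omega> - I u \<omega>) \<in> borel_measurable P" by measurable
next
  fix s \<omega> assume s: "s \<in> {u..<v}" "\<omega> \<in> space P"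
  then have "((\<lambda>s. I s \<omega>) \<longlongrightarrow> I s \<omega>) (at_right s)"
    using I uv by (intro cadlag_on_tendsto_right[of "{0..}" _ s v]) (auto simp: cadlag_process_def)
  then show "((\<lambda>s. I s \<omega> - I u \<omega>) \<longlongrightarrow> I s \<omega> - I u \<omega>) (at_right s)"
    by (intro tendsto_intros)
qed

text \<open>Doob's inequality for the martingale part of the integral sums over one interval.  The drift part
is a Riemann sum of an integrand bounded by \<open>\<bar>c\<bar> \<beta>\<close> and is estimated on each path.\<close>

lemma transform_maximal_inequality:
  assumes N: "orthogonal_increments P F N" and h: "h > 0" and k: "k = u * 2 ^ n" and uv: "u \<le> v"
    and m: "m = (v - u) * 2 ^ n"
    and M: "\<And>t \<omega>. t \<ge> 0 \<Longrightarrow> \<omega> \<in> space P \<Longrightarrow> M t \<omega> = N t \<omega> + c * t"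
    and C: "expectation (\<lambda>\<omega>. (N (real v * h) \<omega> - N (real u * h) \<omega>)\<^sup>2) \<le> C"
    and Y: "\<And>i. Y i \<in> borel_measurable (F (grid h n i))"
      "\<And>i \<omega>. \<omega> \<in> space P \<Longrightarrow> \<bar>Y i \<omega>\<bar> \<le> \<beta>"
    and R: "R > 0"
  shows "\<exists>B\<in>sets P. prob B \<le> 4 * \<beta>\<^sup>2 * C / R\<^sup>2 \<and> (\<forall>\<omega>\<in>space P - B. \<forall>j\<le>m.
    \<bar>\<Sum>i<j. Y (k + i) \<omega> * (M (grid h n (Suc (k + i))) \<omega> - M (grid h n (k + i)) \<omega>)\<bar>
      < R + \<bar>c\<bar> * \<beta> * (real (v - u) * h))"
proof -
  let ?D = "\<lambda>i \<omega>. N (grid h n (Suc (k + i))) \<omega> - N (grid h n (k + i)) \<omega>"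
  let ?G = "\<lambda>i. F (grid h n (k + i))"
  interpret D: orthogonal_differences P ?G ?D
    by (rule orthogonal_differences_grid[OF N]) (use h in simp)
  have Y': "Y (k + i) \<in> borel_measurable (?G i)" for i by (rule Y)
  interpret T: orthogonal_differences P ?G "\<lambda>i \<omega>. Y (k + i) \<omega> * ?D i \<omega>"
    by (rule D.transform[where B = \<beta>]) (use Y in auto)
  obtain \<omega>0 where "\<omega>0 \<in> space P" using not_empty by auto
  with Y(2)[of \<omega>0 0] have \<beta>: "\<beta> \<ge> 0" by linarith
  have "D.psum m \<omega> = N (real v * h) \<omega> - N (real u * h) \<omega>" for \<omega>
  proof -
    have "D.psum m \<omega> = N (grid h n (k + m)) \<omega> - N (grid h n k) \<omega>"
      unfolding D.psum_def using sum_lessThan_telescope[of "\<lambda>i. N (grid h n (k + i)) \<omega>" m] by simp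
    moreover have "k + m = v * 2 ^ n" using uv by (simp add: k m flip: add_mult_distrib)
    ultimately show ?thesis by (simp only: k grid_unit)
  qed
  then have "expectation (\<lambda>\<omega>. (D.psum m \<omega>)\<^sup>2) \<le> C" using C by simp
  then have "\<beta>\<^sup>2 * expectation (\<lambda>\<omega>. (D.psum m \<omega>)\<^sup>2) \<le> \<beta>\<^sup>2 * C"
    by (intro mult_left_mono) auto
  then have "expectation (\<lambda>\<omega>. (T.psum m \<omega>)\<^sup>2) \<le> \<beta>\<^sup>2 * C"
    using D.expectation_transform_le[of "\<lambda>i. Y (k + i)" \<beta> m] Y by (auto simp: T.psum_def)
  then have "4 * expectation (\<lambda>\<omega>. (T.psum m \<omega>)\<^sup>2) / R\<^sup>2 \<le> 4 * \<beta>\<^sup>2 * C / R\<^sup>2"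
    by (intro divide_right_mono) auto
  with T.maximal_inequality[OF R, of m]
  have prob: "prob {\<omega>\<in>space P. running_max (\<lambda>i. T.psum i \<omega>) m \<ge> R} \<le> 4 * \<beta>\<^sup>2 * C / R\<^sup>2"
    by linarith
  have meas: "{\<omega>\<in>space P. running_max (\<lambda>i. T.psum i \<omega>) m \<ge> R} \<in> sets P"
    using T.measurable_G[OF T.running_max_meas[of m]] by measurable
  have "\<bar>\<Sum>i<j. Y (k + i) \<omega> * (M (grid h n (Suc (k + i))) \<omega> - M (grid h n (k + i)) \<omega>)\<bar>
      < R + \<bar>c\<bar> * \<beta> * (real (v - u) * h)"
    if \<omega>: "\<omega> \<in> space P" and max: "\<not> running_max (\<lambda>i. T.psum i \<omega>) m \<ge> R" and j: "j \<le> m" for \<omega> j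
  proof -
    have eq: "(\<Sum>i<j. Y (k + i) \<omega> * (M (grid h n (Suc (k + i))) \<omega> - M (grid h n (k + i)) \<omega>))
      = T.psum j \<omega> + (\<Sum>i<j. c * Y (k + i) \<omega> * (h / 2 ^ n))"
    proof -
      have "M (grid h n (Suc (k + i))) \<omega> - M (grid h n (k + i)) \<omega> = ?D i \<omega> + c * (h / 2 ^ n)" for i
        using M[OF grid_nonneg \<omega>, of h n "k + i"] M[OF grid_nonneg \<omega>, of h n "Suc (k + i)"] h
        by (simp add: grid_Suc distrib_left)
      then show ?thesis
        unfolding T.psum_def sum.distrib[symmetric] by (intro sum.cong) (simp_all add: distrib_left)
    qed
    have "\<bar>\<Sum>i<j. c * Y (k + i) \<omega> * (h / 2 ^ n)\<bar> \<le> (\<Sum>i<j. \<bar>c\<bar> * \<beta> * (h / 2 ^ n))"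
    proof (rule order_trans[OF sum_abs], rule sum_mono)
      fix i
      have "\<bar>c\<bar> * \<bar>Y (k + i) \<omega>\<bar> * (h / 2 ^ n) \<le> \<bar>c\<bar> * \<beta> * (h / 2 ^ n)"
        using Y(2)[OF \<omega>] h by (intro mult_right_mono mult_left_mono) auto
      then show "\<bar>c * Y (k + i) \<omega> * (h / 2 ^ n)\<bar> \<le> \<bar>c\<bar> * \<beta> * (h / 2 ^ n)"
        using h by (simp add: abs_mult)
    qed
    also have "\<dots> = \<bar>c\<bar> * \<beta> * (real j * h / 2 ^ n)" by simp
    also have "\<dots> \<le> \<bar>c\<bar> * \<beta> * (real (v - u) * h)"
    proof (rule mult_left_mono)
      have "real j \<le> real (v - u) * 2 ^ n" using j unfolding m
        by (metis of_nat_le_iff of_nat_mult of_nat_numeral of_nat_power)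
      then show "real j * h / 2 ^ n \<le> real (v - u) * h"
        using h by (simp add: field_simps)
    qed (use \<beta> in auto)
    finally have "\<bar>\<Sum>i<j. c * Y (k + i) \<omega> * (h / 2 ^ n)\<bar> \<le> \<bar>c\<bar> * \<beta> * (real (v - u) * h)" .
    moreover have "\<bar>T.psum j \<omega>\<bar> < R"
      using running_max_ge[OF j, of "\<lambda>i. T.psum i \<omega>"] max by linarith
    ultimately show ?thesis unfolding eq by linarith
  qed
  with prob meas show ?thesis
    by (intro bexI[of _ "{\<omega>\<in>space P. running_max (\<lambda>i. T.psum i \<omega>) m \<ge> R}"]) auto
qed

text \<open>The maximal inequality passes to the stochastic integral in two steps: on a fixed dyadic grid of
level \<open>p\<close> the integral is compared with the integral sums of level \<open>n \<ge> p\<close>, whose nodes contain that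
grid, with an error of at most \<open>R / 2\<close> at each of the two times outside an event of vanishing probability;
then \<open>p\<close> tends to infinity, and right continuity extends the estimate to all times.\<close>

lemma stoch_integral_increment_bound:
  assumes N: "orthogonal_increments P F N" and M_cad: "cadlag_process P {0..} M"
    and M_ad: "adapted_on F {0..} M"
    and M: "\<And>t \<omega>. t \<ge> 0 \<Longrightarrow> \<omega> \<in> space P \<Longrightarrow> M t \<omega> = N t \<omega> + c * t"
    and C: "expectation (\<lambda>\<omega>. (N (real v * h) \<omega> - N (real u * h) \<omega>)\<^sup>2) \<le> C"
    and I: "has_stoch_integral P F M H I"
    and H: "\<And>s \<omega>. s > 0 \<Longrightarrow> \<omega> \<in> space P \<Longrightarrow> \<bar>H s \<omega>\<bar> \<le> \<beta>"
    and h: "h > 0" and uv: "u \<le> v" and R: "R > 0"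
  shows "prob {\<omega>\<in>space P. \<exists>s\<in>{real u * h..real v * h}.
      \<bar>I s \<omega> - I (real u * h) \<omega>\<bar> > 2 * R + \<bar>c\<bar> * \<beta> * (real (v - u) * h)} \<le> 4 * \<beta>\<^sup>2 * C / R\<^sup>2"
proof -
  define K where "K = \<bar>c\<bar> * \<beta> * (real (v - u) * h)"
  \<comment> \<open>The integrand is given on \<open>(0, \<infinity>)\<close> only; its value at the first node is arbitrary.\<close>
  define G where "G t = (if t > 0 then H t else (\<lambda>_. 0))" for t :: real
  define J where "J n = elementary_integral M (n * 2 ^ n) (grid h n) (\<lambda>i. G (grid h n i))" for n
  obtain \<omega>0 where "\<omega>0 \<in> space P" using not_empty by auto
  with H[of 1 \<omega>0] have \<beta>: "\<beta> \<ge> 0" by auto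
  have I_cad: "cadlag_process P {0..} I" and I_ad: "adapted_on F {0..} I"
    and H_ad: "adapted_on F {0<..} H"
    and H_left: "\<And>\<omega> s. \<omega> \<in> space P \<Longrightarrow> s > 0 \<Longrightarrow> continuous (at_left s) (\<lambda>u. H u \<omega>)"
    using I unfolding has_stoch_integral_def by blast+
  have G_meas: "G t \<in> borel_measurable (F t)" if "t \<ge> 0" for t
    using H_ad by (auto simp: G_def adapted_on_def)
  have G_bdd: "\<bar>G t \<omega>\<bar> \<le> \<beta>" if "\<omega> \<in> space P" for t \<omega>
    using H[of t \<omega>] that \<beta> by (simp add: G_def)
  have ucp: "ucp_tendsto P J I"
    unfolding J_def
  proof (rule ucp_tendsto_grid[OF I h G_meas])
    show "\<exists>C. \<forall>s\<in>{0..T}. \<bar>G s \<omega>\<bar> \<le> C" if "\<omega> \<in> space P" for \<omega> T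
      using G_bdd[OF that] by blast
    show "((\<lambda>u. G u \<omega>) \<longlongrightarrow> H s \<omega>) (at_left s)" if "\<omega> \<in> space P" "s > 0" for \<omega> s
    proof (rule Lim_transform_eventually)
      show "((\<lambda>u. H u \<omega>) \<longlongrightarrow> H s \<omega>) (at_left s)"
        using H_left[OF that] by (simp add: continuous_within)
      show "\<forall>\<^sub>F u in at_left s. H u \<omega> = G u \<omega>"
        using that(2) unfolding eventually_at_left_field G_def by (auto intro!: exI[of _ 0])
    qed
  qed
  define E where "E n = {\<omega>\<in>space P. \<exists>s\<in>{0..real v * h}. \<bar>J n s \<omega> - I s \<omega>\<bar> > R / 2}" for n
  have E_lim: "(\<lambda>n. prob (E n)) \<longlonglongrightarrow> 0"
    using ucp[unfolded ucp_tendsto_def, rule_format, of "real v * h" "R / 2"] h R unfolding E_def by simp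
  have E_sets: "E n \<in> sets P" for n
    unfolding E_def J_def
    by (rule sets_elementary_integral_deviation[OF M_cad M_ad I_cad I_ad])
      (use h in \<open>auto intro!: grid_nonneg measurable_F[OF G_meas]\<close>)
  define A where "A p = {\<omega>\<in>space P. \<exists>j\<le>2 ^ p.
      \<bar>I (grid h p (u * 2 ^ p + (v - u) * j)) \<omega> - I (real u * h) \<omega>\<bar> > 2 * R + K}" for p
  have A_sets: "A p \<in> sets P" for p
  proof -
    have [measurable]: "I (grid h p i) \<in> borel_measurable P" "I (real u * h) \<in> borel_measurable P" for i
      using I_ad h by (auto simp: adapted_on_def intro!: measurable_F grid_nonneg)
    show ?thesis unfolding A_def by measurable
  qed
  have A_bound: "prob (A p) \<le> 4 * \<beta>\<^sup>2 * C / R\<^sup>2" for p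
  proof -
    have step: "prob (A p) \<le> prob (E n) + 4 * \<beta>\<^sup>2 * C / R\<^sup>2" if n: "n \<ge> max p v" for n
    proof -
      define k where "k = u * 2 ^ n"
      define m where "m = (v - u) * 2 ^ n"
      have km: "k + m = v * 2 ^ n" using uv by (simp add: k_def m_def flip: add_mult_distrib)
      also have "\<dots> \<le> n * 2 ^ n" using n by simp
      finally have kmn: "k + m \<le> n * 2 ^ n" .
      obtain B where B: "B \<in> sets P" "prob B \<le> 4 * \<beta>\<^sup>2 * C / R\<^sup>2"
        "\<And>\<omega> j. \<omega> \<in> space P - B \<Longrightarrow> j \<le> m \<Longrightarrow>
          \<bar>\<Sum>i<j. G (grid h n (k + i)) \<omega> * (M (grid h n (Suc (k + i))) \<omega> - M (grid h n (k + i)) \<omega>)\<bar> < R + K"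
      proof -
        have "G (grid h n i) \<in> borel_measurable (F (grid h n i))" for i
          using h by (intro G_meas grid_nonneg) simp
        from transform_maximal_inequality[OF N h k_def uv m_def M C, where Y = "\<lambda>i. G (grid h n i)",
            OF _ _ this G_bdd R, folded K_def]
        show ?thesis using that by blast
      qed
      have "A p \<subseteq> E n \<union> B"
      proof
        fix \<omega> assume "\<omega> \<in> A p"
        then obtain j where \<omega>: "\<omega> \<in> space P" and j: "j \<le> 2 ^ p"
          and big: "\<bar>I (grid h p (u * 2 ^ p + (v - u) * j)) \<omega> - I (real u * h) \<omega>\<bar> > 2 * R + K"
          by (auto simp: A_def)
        define l where "l = (v - u) * j * 2 ^ (n - p)"
        have node: "grid h p (u * 2 ^ p + (v - u) * j) = grid h n (k + l)"
        proof -
          have "(u * 2 ^ p + (v - u) * j) * 2 ^ (n - p) = u * (2 ^ p * 2 ^ (n - p)) + l"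
            by (simp add: l_def algebra_simps)
          also have "(2::nat) ^ p * 2 ^ (n - p) = 2 ^ n" using n by (simp flip: power_add)
          finally show ?thesis using n by (simp add: k_def flip: grid_refine[of p n])
        qed
        have "l \<le> (v - u) * 2 ^ p * 2 ^ (n - p)" unfolding l_def using j by simp
        also have "\<dots> = m" unfolding m_def using n by (simp add: mult.assoc flip: power_add)
        finally have l: "l \<le> m" .
        have u_node: "real u * h = grid h n k" by (simp add: k_def grid_unit)
        have nodes: "grid h n (k + l) \<in> {0..real v * h}" "grid h n k \<in> {0..real v * h}"
          using l km grid_mono[of h "k + l" "v * 2 ^ n" n] grid_mono[of h k "v * 2 ^ n" n] h
          by (auto simp: grid_unit intro: grid_nonneg)
        show "\<omega> \<in> E n \<union> B"
        proof (rule ccontr)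
          assume out: "\<omega> \<notin> E n \<union> B"
          have "J n (grid h n (k + l)) \<omega> - J n (grid h n k) \<omega>
            = (\<Sum>i<l. G (grid h n (k + i)) \<omega> * (M (grid h n (Suc (k + i))) \<omega> - M (grid h n (k + i)) \<omega>))"
            unfolding J_def using l kmn h by (intro elementary_integral_grid_increment) auto
          then have "\<bar>J n (grid h n (k + l)) \<omega> - J n (grid h n k) \<omega>\<bar> < R + K"
            using B(3)[of \<omega> l] out \<omega> l by auto
          moreover have "\<bar>J n (grid h n (k + l)) \<omega> - I (grid h n (k + l)) \<omega>\<bar> \<le> R / 2"
            "\<bar>J n (grid h n k) \<omega> - I (grid h n k) \<omega>\<bar> \<le> R / 2"
          proof -
            have "\<bar>J n s \<omega> - I s \<omega>\<bar> \<le> R / 2" if "s \<in> {0..real v * h}" for s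
            proof (rule ccontr)
              assume "\<not> \<bar>J n s \<omega> - I s \<omega>\<bar> \<le> R / 2"
              then have "\<omega> \<in> E n" unfolding E_def using that \<omega> by (intro CollectI conjI bexI[of _ s]) auto
              then show False using out by simp
            qed
            then show "\<bar>J n (grid h n (k + l)) \<omega> - I (grid h n (k + l)) \<omega>\<bar> \<le> R / 2"
              "\<bar>J n (grid h n k) \<omega> - I (grid h n k) \<omega>\<bar> \<le> R / 2"
              using nodes by blast+
          qed
          ultimately show False using big unfolding node u_node by linarith
        qed
      qed
      then have "prob (A p) \<le> prob (E n \<union> B)"
        using E_sets B(1) by (intro finite_measure_mono) auto
      also have "\<dots> \<le> prob (E n) + prob B"
        using E_sets B(1) by (intro measure_subadditive) auto
      finally show ?thesis using B(2) by linarith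
    qed
    have "(\<lambda>n. prob (E n) + 4 * \<beta>\<^sup>2 * C / R\<^sup>2) \<longlonglongrightarrow> 0 + 4 * \<beta>\<^sup>2 * C / R\<^sup>2"
      by (intro tendsto_intros E_lim)
    moreover have "\<forall>\<^sub>F n in sequentially. prob (A p) \<le> prob (E n) + 4 * \<beta>\<^sup>2 * C / R\<^sup>2"
      using eventually_ge_at_top[of "max p v"] by eventually_elim (rule step)
    ultimately have "prob (A p) \<le> 0 + 4 * \<beta>\<^sup>2 * C / R\<^sup>2"
      by (rule tendsto_lowerbound) simp
    then show ?thesis by simp
  qed
  have "incseq A"
    unfolding incseq_Suc_iff
  proof (intro allI subsetI)
    fix p \<omega> assume "\<omega> \<in> A p"
    then obtain j where "\<omega> \<in> space P" "j \<le> 2 ^ p"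
      "\<bar>I (grid h p (u * 2 ^ p + (v - u) * j)) \<omega> - I (real u * h) \<omega>\<bar> > 2 * R + K"
      by (auto simp: A_def)
    moreover have "grid h p (u * 2 ^ p + (v - u) * j) = grid h (Suc p) (u * 2 ^ Suc p + (v - u) * (2 * j))"
      by (simp add: grid_def field_simps)
    ultimately show "\<omega> \<in> A (Suc p)"
      unfolding A_def by (intro CollectI conjI) (assumption, rule exI[of _ "2 * j"], simp)
  qed
  then have "(\<lambda>p. prob (A p)) \<longlonglongrightarrow> prob (\<Union>p. A p)"
    using A_sets by (intro finite_Lim_measure_incseq) auto
  then have "prob (\<Union>p. A p) \<le> 4 * \<beta>\<^sup>2 * C / R\<^sup>2"
    by (rule LIMSEQ_le_const2) (use A_bound in auto)
  moreover have "(\<Union>p. A p) = {\<omega>\<in>space P. \<exists>s\<in>{real u * h..real v * h}.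
      \<bar>I s \<omega> - I (real u * h) \<omega>\<bar> > 2 * R + K}"
  proof -
    have "(\<exists>s\<in>{real u * h..real v * h}. \<bar>I s \<omega> - I (real u * h) \<omega>\<bar> > 2 * R + K) \<longleftrightarrow>
      (\<exists>p. \<exists>j\<le>2 ^ p. \<bar>I (grid h p (u * 2 ^ p + (v - u) * j)) \<omega> - I (real u * h) \<omega>\<bar> > 2 * R + K)"
      if \<omega>: "\<omega> \<in> space P" for \<omega>
    proof -
      have node: "real u * h + (real v * h - real u * h) * real j / 2 ^ p
        = grid h p (u * 2 ^ p + (v - u) * j)" for p j
        using uv by (simp add: grid_def field_simps of_nat_diff)
      show ?thesis
        unfolding node[symmetric]
      proof (rule Bex_abs_gt_iff_dyadic[where Z = "\<lambda>s \<omega>. I s \<omega> - I (real u * h) \<omega>"])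
        show "real u * h \<le> real v * h" using uv h by simp
        fix s assume s: "s \<in> {real u * h..<real v * h}"
        have "0 \<le> real u * h" using h by simp
        then have "((\<lambda>s. I s \<omega>) \<longlongrightarrow> I s \<omega>) (at_right s)"
          using I_cad \<omega> s by (intro cadlag_on_tendsto_right[of "{0..}" _ s "real v * h"]) (auto simp:
            cadlag_process_def)
        then show "((\<lambda>s. I s \<omega> - I (real u * h) \<omega>) \<longlongrightarrow> I s \<omega> - I (real u * h) \<omega>) (at_right s)"
          by (intro tendsto_intros)
      qed
    qed
    then have "{\<omega>\<in>space P. \<exists>s\<in>{real u * h..real v * h}. \<bar>I s \<omega> - I (real u * h) \<omega>\<bar> > 2 * R + K} =
      {\<omega>\<in>space P. \<exists>p. \<exists>j\<le>2 ^ p. \<bar>I (grid h p (u * 2 ^ p + (v - u) * j)) \<omega> - I (real u * h) \<omega>\<bar> > 2 * R + K}"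
      by (intro Collect_cong conj_cong) auto
    then show ?thesis unfolding A_def by auto
  qed
  ultimately show ?thesis unfolding K_def by simp
qed

end

section \<open>Square integrable Levy noise\<close>

text \<open>After subtraction of a linear function, \<open>m\<close> vanishes at \<open>h\<close>, hence is \<open>h\<close>-periodic and bounded on the
half line; but an additive function \<open>g\<close> with \<open>g t \<noteq> 0\<close> is unbounded along the multiples of \<open>t\<close>.\<close>

lemma additive_bounded_imp_linear:
  fixes m :: "real \<Rightarrow> real"
  assumes add: "\<And>s t. 0 \<le> s \<Longrightarrow> 0 \<le> t \<Longrightarrow> m (s + t) = m s + m t"
    and h: "h > 0" and bound: "\<And>t. t \<in> {0..h} \<Longrightarrow> \<bar>m t\<bar> \<le> B"
    and t: "t \<ge> 0"
  shows "m t = m h / h * t"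
proof -
  define g where "g t = m t - m h / h * t" for t
  have g_add: "g (s + t) = g s + g t" if "0 \<le> s" "0 \<le> t" for s t
    using add[OF that] by (simp add: g_def distrib_left)
  have g_mult: "g (real n * t) = real n * g t" if "0 \<le> t" for n t
  proof (induction n)
    case 0
    show ?case using g_add[of 0 0] by simp
  next
    case (Suc n)
    then show ?case using g_add[of "real n * t" t] that by (simp add: distrib_right add.commute)
  qed
  have gh: "g h = 0" using h by (simp add: g_def)
  have g_bound: "\<bar>g t\<bar> \<le> B + \<bar>m h\<bar>" if "0 \<le> t" for t
  proof -
    \<comment> \<open>Reduce \<open>t\<close> modulo \<open>h\<close>.\<close>
    define k where "k = nat \<lfloor>t / h\<rfloor>"
    have "\<lfloor>t / h\<rfloor> \<ge> 0" using that h by simp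
    then have "real k = of_int \<lfloor>t / h\<rfloor>" by (simp add: k_def)
    then have "real k \<le> t / h" "t / h \<le> real k + 1" by linarith+
    then have r: "t - real k * h \<in> {0..h}" using h by (auto simp: field_simps)
    have "g t = g (real k * h) + g (t - real k * h)"
      using g_add[of "real k * h" "t - real k * h"] r h by simp
    also have "\<dots> = m (t - real k * h) - m h / h * (t - real k * h)"
      using g_mult[of h k] h gh by (simp add: g_def)
    finally have "\<bar>g t\<bar> \<le> \<bar>m (t - real k * h)\<bar> + \<bar>m h / h * (t - real k * h)\<bar>"
      by (metis abs_triangle_ineq4)
    also have "\<bar>m h / h * (t - real k * h)\<bar> = \<bar>m h\<bar> * ((t - real k * h) / h)"
      using r h by (simp add: abs_mult)
    also have "\<dots> \<le> \<bar>m h\<bar> * 1" using r h by (intro mult_left_mono) auto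
    finally show ?thesis using bound[OF r] by simp
  qed
  have "g t = 0"
  proof (rule ccontr)
    assume "g t \<noteq> 0"
    then obtain n :: nat where "(B + \<bar>m h\<bar>) / \<bar>g t\<bar> < real n" using reals_Archimedean2 by blast
    then have "B + \<bar>m h\<bar> < real n * \<bar>g t\<bar>" using \<open>g t \<noteq> 0\<close> by (simp add: field_simps)
    then show False using g_bound[of "real n * t"] g_mult[OF t, of n] t by (simp add: abs_mult)
  qed
  then show ?thesis by (simp add: g_def)
qed

context filtered_space
begin

text \<open>Independence makes centred increments orthogonal to the past, and stationarity makes their second
moments depend on the length of the interval only.  What has to be shown is that the mean \<open>m t\<close> of
\<open>M t\<close> is linear.  It is additive, so it suffices to bound it on \<open>[0, h]\<close>: the variance
increases with time, so by Chebyshev's inequality \<open>M t\<close> is close to \<open>m t\<close> with probability above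
one half, while \<open>\<bar>M t\<bar>\<close> is below a common level for all \<open>t\<close> with probability above one half.\<close>

lemma levy_drift_decomposition:
  assumes M: "HSqL P F M" and h: "h > 0"
  shows "\<exists>c C. orthogonal_increments P F (\<lambda>t \<omega>. M t \<omega> - c * t) \<and>
    (\<forall>s\<ge>0. expectation (\<lambda>\<omega>. ((M (s + h) \<omega> - c * (s + h)) - (M s \<omega> - c * s))\<^sup>2) \<le> C)"
proof -
  have ad: "adapted_on F {0..} M" and cad: "cadlag_process P {0..} M" and sq: "square_integrable P M"
    and law: "\<And>s t. 0 \<le> s \<Longrightarrow> s \<le> t \<Longrightarrow> distr P borel (\<lambda>\<omega>. M t \<omega> - M s \<omega>) = distr P borel (M (t - s))"
    and ind: "\<And>s t. 0 \<le> s \<Longrightarrow> s \<le> t \<Longrightarrow> indep_set (sets (F s))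
          {(\<lambda>\<omega>. M t \<omega> - M s \<omega>) -` B \<inter> space P |B. B \<in> sets borel}"
    using M unfolding HSqL_def levy_process_def by blast+
  have M_meas: "M t \<in> borel_measurable P" if "t \<ge> 0" for t
    using ad that by (auto simp: adapted_on_def intro: measurable_F)
  have M_sq: "integrable P (\<lambda>\<omega>. (M t \<omega>)\<^sup>2)" if "t \<ge> 0" for t
    using sq that by (auto simp: square_integrable_def)
  have M_int: "integrable P (M t)" if "t \<ge> 0" for t
    using square_integrable_imp_integrable[OF M_meas M_sq] that by auto
  have incr_meas: "(\<lambda>\<omega>. M t \<omega> - M s \<omega>) \<in> borel_measurable P" if "0 \<le> s" "s \<le> t" for s t
    using M_meas[of s] M_meas[of t] that by simp
  have incr_sq: "integrable P (\<lambda>\<omega>. (M t \<omega> - M s \<omega>)\<^sup>2)" if "0 \<le> s" "s \<le> t" for s t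
    using integrable_add_square[of "M t" P "\<lambda>\<omega>. - M s \<omega>"] M_meas[of s] M_meas[of t] M_sq[of s] M_sq[of t] that
    by simp
  have E_incr: "expectation (\<lambda>\<omega>. f (M t \<omega> - M s \<omega>)) = expectation (\<lambda>\<omega>. f (M (t - s) \<omega>))"
    if "0 \<le> s" "s \<le> t" and f: "f \<in> borel_measurable borel" for s t and f :: "real \<Rightarrow> real"
  proof -
    have [measurable]: "M s \<in> borel_measurable P" "M t \<in> borel_measurable P" "M (t - s) \<in> borel_measurable P"
      using that by (auto intro: M_meas)
    have "expectation (\<lambda>\<omega>. f (M t \<omega> - M s \<omega>)) = integral\<^sup>L (distr P borel (\<lambda>\<omega>. M t \<omega> - M s \<omega>)) f"
      by (rule integral_distr[symmetric]) (use f in measurable)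
    also have "\<dots> = expectation (\<lambda>\<omega>. f (M (t - s) \<omega>))"
      unfolding law[OF that(1,2)] by (rule integral_distr) (use f in measurable)
    finally show ?thesis .
  qed
  have E_prod: "expectation (\<lambda>\<omega>. W \<omega> * (M t \<omega> - M s \<omega>)) = expectation W * expectation (\<lambda>\<omega>. M t \<omega> - M s \<omega>)"
    if st: "0 \<le> s" "s \<le> t" and W: "W \<in> borel_measurable (F s)" "integrable P W" for s t and W :: "'a \<Rightarrow> real"
  proof -
    define Z where "Z \<omega> = M t \<omega> - M s \<omega>" for \<omega>
    have [measurable]: "W \<in> borel_measurable P" by (rule measurable_F[OF W(1)])
    have [measurable]: "Z \<in> borel_measurable P"
      unfolding Z_def[abs_def] using M_meas[of s] M_meas[of t] st by simp
    have sigma: "sigma_sets (space P) {f -` A \<inter> space P |A. A \<in> sets borel} = {f -` A \<inter> space P |A. A \<in> sets borel}"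
      for f :: "'a \<Rightarrow> real"
      using sets_vimage_algebra2[of f "space P" borel] sets_vimage_algebra[of "space P" f borel] by simp
    have sub: "{W -` A \<inter> space P |A. A \<in> sets borel} \<subseteq> sets (F s)"
      using measurable_sets[OF W(1)] F_sub[of s] by (auto simp: subalgebra_def)
    have "indep_set (sets (F s)) {Z -` B \<inter> space P |B. B \<in> sets borel}"
      using ind[OF st] by (simp add: Z_def[abs_def])
    then have "indep_set {W -` A \<inter> space P |A. A \<in> sets borel} {Z -` B \<inter> space P |B. B \<in> sets borel}"
      unfolding indep_set_def
      by (rule indep_sets_mono_sets) (use sub in \<open>auto split: bool.split\<close>)
    then have "indep_var borel W borel Z"
      unfolding indep_var_eq sigma by simp
    from indep_var_lebesgue_integral[OF this W(2)] show ?thesis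
      unfolding Z_def[symmetric] using M_int[of s] M_int[of t] st by (simp add: Z_def[abs_def])
  qed
  define m where "m t = expectation (M t)" for t
  have E_diff: "expectation (\<lambda>\<omega>. M t \<omega> - M s \<omega>) = m (t - s)" if "0 \<le> s" "s \<le> t" for s t
    using E_incr[OF that, of "\<lambda>x. x"] by (simp add: m_def)
  have m_add: "m (s + t) = m s + m t" if "0 \<le> s" "0 \<le> t" for s t
    using E_diff[of s "s + t"] M_int[of s] M_int[of "s + t"] that by (simp add: m_def)
  have centred_sq: "integrable P (\<lambda>\<omega>. (M t \<omega> - a)\<^sup>2)" if "t \<ge> 0" for t a
    using integrable_add_square[of "M t" P "\<lambda>_. - a"] M_meas[OF that] M_sq[OF that] by simp
  define v where "v t = expectation (\<lambda>\<omega>. (M t \<omega> - m t)\<^sup>2)" for t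
  have v_mono: "v s \<le> v t" if st: "0 \<le> s" "s \<le> t" for s t
  proof -
    define W where "W \<omega> = M s \<omega> - m s" for \<omega>
    define Z where "Z \<omega> = M t \<omega> - M s \<omega> - m (t - s)" for \<omega>
    have W_meas: "W \<in> borel_measurable (F s)"
    proof -
      have [measurable]: "M s \<in> borel_measurable (F s)" using ad st by (simp add: adapted_on_def)
      show ?thesis unfolding W_def[abs_def] by measurable
    qed
    have W_int: "integrable P W" and W0: "expectation W = 0"
      using M_int[of s] st by (auto simp: W_def[abs_def] m_def prob_space)
    have W_sq: "integrable P (\<lambda>\<omega>. (W \<omega>)\<^sup>2)"
      unfolding W_def using st by (intro centred_sq)
    have WMZ: "integrable P (\<lambda>\<omega>. W \<omega> * (M t \<omega> - M s \<omega>))"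
      by (rule integrable_mult_of_squares[OF measurable_F[OF W_meas] incr_meas[OF st] W_sq incr_sq[OF st]])
    have Z_meas: "Z \<in> borel_measurable P" unfolding Z_def[abs_def] using incr_meas[OF st] by simp
    have Z_sq: "integrable P (\<lambda>\<omega>. (Z \<omega>)\<^sup>2)"
      using integrable_add_square[OF incr_meas[OF st] _ incr_sq[OF st], of "\<lambda>_. - m (t - s)"] by (simp add: Z_def)
    have WZ: "integrable P (\<lambda>\<omega>. W \<omega> * Z \<omega>)"
      by (rule integrable_mult_of_squares[OF measurable_F[OF W_meas] Z_meas W_sq Z_sq])
    have "expectation (\<lambda>\<omega>. W \<omega> * Z \<omega>) = expectation (\<lambda>\<omega>. W \<omega> * (M t \<omega> - M s \<omega>) - m (t - s) * W \<omega>)"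
      by (simp add: Z_def algebra_simps)
    also have "\<dots> = 0"
      using E_prod[OF st W_meas W_int] WMZ W_int W0 by simp
    finally have E0: "expectation (\<lambda>\<omega>. W \<omega> * Z \<omega>) = 0" .
    have "m t = m s + m (t - s)" using m_add[of s "t - s"] st by simp
    then have "W \<omega> + Z \<omega> = M t \<omega> - m t" for \<omega> by (simp add: W_def Z_def)
    then have "v t = expectation (\<lambda>\<omega>. (W \<omega> + Z \<omega>)\<^sup>2)" by (simp add: v_def)
    also have "\<dots> = expectation (\<lambda>\<omega>. (W \<omega>)\<^sup>2 + (Z \<omega>)\<^sup>2 + 2 * (W \<omega> * Z \<omega>))"
      by (simp add: power2_sum mult.assoc)
    also have "\<dots> = v s + expectation (\<lambda>\<omega>. (Z \<omega>)\<^sup>2)"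
      using W_sq Z_sq WZ E0 by (simp add: v_def W_def)
    finally show ?thesis by simp
  qed
  have "\<exists>B. \<forall>t\<in>{0..h}. \<bar>m t\<bar> \<le> B"
  proof -
    obtain K where K: "{\<omega>\<in>space P. \<exists>s\<in>{0..h}. \<bar>M s \<omega>\<bar> > K} \<in> sets P"
      "prob {\<omega>\<in>space P. \<exists>s\<in>{0..h}. \<bar>M s \<omega>\<bar> > K} < 1 / 2"
      using cadlag_process_tight_on_compact[of 0 h M "{0..}" "1 / 2"] h M_meas cad by auto
    \<comment> \<open>Chosen such that \<open>v h / L\<^sup>2 < 1/2\<close>.\<close>
    define L where "L = sqrt (2 * v h) + 1"
    have v0: "v h \<ge> 0" by (simp add: v_def)
    then have root: "sqrt (2 * v h) \<ge> 0" by simp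
    have "L\<^sup>2 = 2 * v h + 2 * sqrt (2 * v h) + 1" using v0 by (simp add: L_def power2_sum)
    with root have L: "L > 0" "2 * v h < L\<^sup>2" unfolding L_def by linarith+
    show ?thesis
    proof (intro exI[of _ "K + L"] ballI)
      fix t assume t: "t \<in> {0..h}"
      let ?A = "{\<omega>\<in>space P. \<exists>s\<in>{0..h}. \<bar>M s \<omega>\<bar> > K}"
      let ?B = "{\<omega>\<in>space P. (M t \<omega> - m t)\<^sup>2 \<ge> L\<^sup>2}"
      have [measurable]: "M t \<in> borel_measurable P" using t by (intro M_meas) auto
      have "prob ?B \<le> v t / L\<^sup>2"
        unfolding v_def using t L by (intro integral_Markov_inequality_measure[where A = "{}"] centred_sq) auto
      also have "\<dots> \<le> v h / L\<^sup>2" using v_mono[of t h] t by (intro divide_right_mono) auto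
      also have "\<dots> < 1 / 2" using L by (simp add: field_simps)
      finally have "prob ?A + prob ?B < 1" using K(2) by simp
      moreover have "prob (?A \<union> ?B) \<le> prob ?A + prob ?B"
        using K(1) by (intro measure_subadditive) auto
      ultimately have "?A \<union> ?B \<noteq> space P" using prob_space by auto
      moreover have "?A \<union> ?B \<subseteq> space P" by auto
      ultimately obtain \<omega> where "\<omega> \<in> space P" "\<omega> \<notin> ?A" "\<omega> \<notin> ?B" by blast
      then have "\<bar>M t \<omega>\<bar> \<le> K" "(M t \<omega> - m t)\<^sup>2 < L\<^sup>2" using t by (auto simp: not_less not_le)
      then have "\<bar>M t \<omega>\<bar> \<le> K" "\<bar>M t \<omega> - m t\<bar> < L"
        using L power2_less_imp_less[of "\<bar>M t \<omega> - m t\<bar>" L] by auto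
      then show "\<bar>m t\<bar> \<le> K + L" by linarith
    qed
  qed
  then obtain B where B: "\<And>t. t \<in> {0..h} \<Longrightarrow> \<bar>m t\<bar> \<le> B" by blast
  define c where "c = m h / h"
  have m_lin: "m t = c * t" if "t \<ge> 0" for t
    unfolding c_def by (rule additive_bounded_imp_linear[OF m_add h B that])
  have "orthogonal_increments P F (\<lambda>t \<omega>. M t \<omega> - c * t)"
    unfolding orthogonal_increments_def
  proof (intro conjI allI impI ballI)
    show "adapted_on F {0..} (\<lambda>t \<omega>. M t \<omega> - c * t)"
      using ad unfolding adapted_on_def by (intro ballI borel_measurable_diff borel_measurable_const) auto
    show "square_integrable P (\<lambda>t \<omega>. M t \<omega> - c * t)" by (auto simp: square_integrable_def intro: centred_sq)
    fix s t :: real and W :: "'a \<Rightarrow> real"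
    assume st: "0 \<le> s" "s \<le> t" and W: "W \<in> borel_measurable (F s)" "integrable P (\<lambda>\<omega>. (W \<omega>)\<^sup>2)"
    have W_meas: "W \<in> borel_measurable P" by (rule measurable_F[OF W(1)])
    have W_int: "integrable P W" by (rule square_integrable_imp_integrable[OF W_meas W(2)])
    have "integrable P (\<lambda>\<omega>. W \<omega> * (M t \<omega> - M s \<omega>))"
      by (intro integrable_mult_of_squares W_meas W incr_meas incr_sq st)
    then have "expectation (\<lambda>\<omega>. W \<omega> * (M t \<omega> - M s \<omega>) - c * (t - s) * W \<omega>) = 0"
      using E_prod[OF st W(1) W_int] E_diff[OF st] W_int st by (simp add: m_lin)
    then show "expectation (\<lambda>\<omega>. W \<omega> * (M t \<omega> - c * t - (M s \<omega> - c * s))) = 0"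
      by (simp add: algebra_simps)
  qed
  moreover have "expectation (\<lambda>\<omega>. ((M (s + h) \<omega> - c * (s + h)) - (M s \<omega> - c * s))\<^sup>2)
    \<le> expectation (\<lambda>\<omega>. (M h \<omega> - c * h)\<^sup>2)" if "s \<ge> 0" for s
  proof -
    have "expectation (\<lambda>\<omega>. ((M (s + h) \<omega> - c * (s + h)) - (M s \<omega> - c * s))\<^sup>2)
      = expectation (\<lambda>\<omega>. (M (s + h) \<omega> - M s \<omega> - c * h)\<^sup>2)" by (simp add: algebra_simps)
    also have "\<dots> = expectation (\<lambda>\<omega>. (M h \<omega> - c * h)\<^sup>2)"
      using E_incr[of s "s + h" "\<lambda>x. (x - c * h)\<^sup>2"] that h by simp
    finally show ?thesis by simp
  qed
  ultimately show ?thesis by blast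
qed

end

section \<open>Second moments of increments and quadratic variation\<close>

context filtered_space
begin

text \<open>The conditional expectation may be multiplied by anything square integrable known at time \<open>s\<close>.\<close>

lemma orthogonal_increments_of_martingale:
  assumes "martingale P F M" "square_integrable P M"
  shows "orthogonal_increments P F M"
  unfolding orthogonal_increments_def
proof (intro conjI allI impI ballI)
  show ad: "adapted_on F {0..} M" using assms(1) by (simp add: martingale_def)
  show "square_integrable P M" by fact
  fix s t :: real and W :: "'a \<Rightarrow> real"
  assume st: "0 \<le> s" "s \<le> t" and W: "W \<in> borel_measurable (F s)" "integrable P (\<lambda>\<omega>. (W \<omega>)\<^sup>2)"
  interpret S: finite_measure_subalgebra P "F s"
    by unfold_locales (rule F_sub)
  have meas: "M s \<in> borel_measurable P" "M t \<in> borel_measurable P"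
    using ad st by (auto simp: adapted_on_def intro: measurable_F)
  have WM: "integrable P (\<lambda>\<omega>. W \<omega> * M s \<omega>)" "integrable P (\<lambda>\<omega>. W \<omega> * M t \<omega>)"
    using assms(2) st meas by (auto simp: square_integrable_def intro!: integrable_mult_of_squares
      measurable_F[OF W(1)] W(2))
  have "AE \<omega> in P. real_cond_exp P (F s) (M t) \<omega> = M s \<omega>"
    using assms(1) st by (simp add: martingale_def)
  then have "expectation (\<lambda>\<omega>. W \<omega> * real_cond_exp P (F s) (M t) \<omega>) = expectation (\<lambda>\<omega>. W \<omega> * M s \<omega>)"
    using measurable_F[OF W(1)] meas by (intro integral_cong_AE) auto
  moreover have "expectation (\<lambda>\<omega>. W \<omega> * real_cond_exp P (F s) (M t) \<omega>) = expectation (\<lambda>\<omega>. W \<omega> * M t \<omega>)"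
    by (rule S.real_cond_exp_intg(2)[OF WM(2) W(1) meas(2)])
  ultimately show "expectation (\<lambda>\<omega>. W \<omega> * (M t \<omega> - M s \<omega>)) = 0"
    using WM by (simp add: right_diff_distrib)
qed

text \<open>With the left-point sums for \<open>\<integral> M\<^sub>- dM\<close>, the identity \<open>2 x (y - x) = y\<^sup>2 - x\<^sup>2 - (y - x)\<^sup>2\<close> shows that
the sums of squared increments along the dyadic grids converge to the increment \<open>\<Delta>\<close> of \<open>Q\<close> in
probability.  Their expectation is the second moment of the increment of \<open>M\<close> for every grid.  Fatou's
lemma would give the reverse inequality, so uniform integrability is essential; it comes from the
truncated estimate \<open>second_moment_le_truncated\<close>, in which the running maxima are dominated by their
supremum \<open>Ss\<close> over all grids.  The latter is square integrable by Doob's inequality, whence dominated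
convergence applies along an almost surely convergent subsequence, and once more as the truncation
level \<open>K\<close> tends to infinity.\<close>

lemma second_moment_increment_le_quadratic_variation:
  assumes orth: "orthogonal_increments P F M" and M_cad: "cadlag_process P {0..} M"
    and Q: "is_quadratic_variation P F M Q" and h: "h > 0" and uv: "u \<le> v"
    and Q_int: "integrable P (\<lambda>\<omega>. Q (real v * h) \<omega> - Q (real u * h) \<omega>)"
  shows "expectation (\<lambda>\<omega>. (M (real v * h) \<omega> - M (real u * h) \<omega>)\<^sup>2)
    \<le> expectation (\<lambda>\<omega>. Q (real v * h) \<omega> - Q (real u * h) \<omega>)"
proof -
  define U where "U = real u * h"
  define V where "V = real v * h"
  have UV: "0 \<le> U" "U \<le> V" "0 \<le> V" using h uv by (auto simp: U_def V_def)
  define \<Delta> where "\<Delta> \<omega> = Q V \<omega> - Q U \<omega>" for \<omega>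
  obtain I where I: "has_stoch_integral P F M (\<lambda>s \<omega>. left_lim (\<lambda>u. M u \<omega>) s) I"
    and QI: "AE \<omega> in P. \<forall>t\<ge>0. Q t \<omega> = (M t \<omega>)\<^sup>2 - (M 0 \<omega>)\<^sup>2 - 2 * I t \<omega>"
    using Q unfolding is_quadratic_variation_def by blast
  have M_ad: "adapted_on F {0..} M" using orth by (simp add: orthogonal_increments_def)
  have M_meas: "M t \<in> borel_measurable P" if "t \<ge> 0" for t
    using M_ad that by (auto simp: adapted_on_def intro: measurable_F)
  have I_cad: "cadlag_process P {0..} I" and I_ad: "adapted_on F {0..} I"
    using I unfolding has_stoch_integral_def by blast+
  have \<Delta>_int: "integrable P \<Delta>" using Q_int by (simp add: \<Delta>_def[abs_def] U_def V_def)
  have \<Delta>_nn: "0 \<le> \<Delta> \<omega>" if "\<omega> \<in> space P" for \<omega>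
    using Q that UV unfolding is_quadratic_variation_def \<Delta>_def by (auto intro: mono_onD)
  define k where "k n = u * 2 ^ n" for n :: nat
  define m where "m n = (v - u) * 2 ^ n" for n :: nat
  have km: "k n + m n = v * 2 ^ n" for n using uv by (simp add: k_def m_def flip: add_mult_distrib)
  have gk: "grid h n (k n) = U" and gkm: "grid h n (k n + m n) = V" for n
    unfolding km U_def V_def by (simp_all add: k_def grid_unit)
  define D where "D n i \<omega> = M (grid h n (Suc (k n + i))) \<omega> - M (grid h n (k n + i)) \<omega>" for n i \<omega>
  have od: "orthogonal_differences P (\<lambda>i. F (grid h n (k n + i))) (D n)" for n
    unfolding D_def[abs_def] by (rule orthogonal_differences_grid[OF orth]) (use h in simp)
  have psum: "(\<Sum>i<j. D n i \<omega>) = M (grid h n (k n + j)) \<omega> - M U \<omega>" for n j \<omega>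
    unfolding D_def using sum_lessThan_telescope[of "\<lambda>i. M (grid h n (k n + i)) \<omega>" j] by (simp add: gk)
  define S where "S n \<omega> = running_max (\<lambda>j. M (grid h n (k n + j)) \<omega> - M U \<omega>) (m n)" for n \<omega>
  define VV where "VV n \<omega> = (\<Sum>i<m n. (D n i \<omega>)\<^sup>2)" for n \<omega>
  define E2 where "E2 = expectation (\<lambda>\<omega>. (M V \<omega> - M U \<omega>)\<^sup>2)"
  have psum_eq: "orthogonal_differences.psum (D n) = (\<lambda>j \<omega>. M (grid h n (k n + j)) \<omega> - M U \<omega>)" for n
    unfolding orthogonal_differences.psum_def[OF od, abs_def] psum ..
  have S_int: "integrable P (\<lambda>\<omega>. (S n \<omega>)\<^sup>2)" for n
    using orthogonal_differences.running_max_square[OF od, of n "m n"] unfolding psum_eq S_def .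
  have S_E: "expectation (\<lambda>\<omega>. (S n \<omega>)\<^sup>2) \<le> 4 * E2" for n
    using orthogonal_differences.doob_L2[OF od, of n "m n"] unfolding psum_eq S_def E2_def gkm .
  \<comment> \<open>The factor \<open>min 1 (V / K)\<close> replaces the indicator of \<open>V > K\<close>, because it is continuous in \<open>V\<close>.\<close>
  have trunc: "E2 \<le> expectation (\<lambda>\<omega>. min (VV n \<omega>) (K + 4 * (S n \<omega>)\<^sup>2)) + 4 * expectation (\<lambda>\<omega>. (S n \<omega>)\<^sup>2 * min
    1 (VV n \<omega> / K))"
    if "K > 0" for n K
    using orthogonal_differences.second_moment_le_truncated[OF od that, of n "m n"]
    unfolding psum_eq S_def E2_def gkm VV_def .
  have VV_nn: "0 \<le> VV n \<omega>" for n \<omega> unfolding VV_def by (intro sum_nonneg) auto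
  have D_meas: "D n i \<in> borel_measurable P" for n i
    unfolding D_def[abs_def] using h M_meas[OF grid_nonneg, of h] by simp
  have VV_meas: "VV n \<in> borel_measurable P" for n
    unfolding VV_def[abs_def] using D_meas by (intro borel_measurable_sum borel_measurable_power) auto
  have S_meas: "S n \<in> borel_measurable P" for n
    using orthogonal_differences.measurable_G[OF od orthogonal_differences.running_max_meas[OF od], of n "m n"]
    unfolding psum_eq S_def[abs_def] .

  have S_mono: "S n \<omega> \<le> S (Suc n) \<omega>" for n \<omega>
  proof -
    obtain j where j: "j \<le> m n" "S n \<omega> = \<bar>M (grid h n (k n + j)) \<omega> - M U \<omega>\<bar>"
      using running_max_attained unfolding S_def by meson
    \<comment> \<open>Each grid is contained in the next one.\<close>
    have "grid h n (k n + j) = grid h (Suc n) (k (Suc n) + 2 * j)"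
      by (simp add: grid_def k_def field_simps)
    then show ?thesis
      using running_max_ge[of "2 * j" "m (Suc n)" "\<lambda>j. M (grid h (Suc n) (k (Suc n) + j)) \<omega> - M U \<omega>"] j
      unfolding S_def by (simp add: m_def)
  qed
  have S_nn: "0 \<le> S n \<omega>" for n \<omega> unfolding S_def by (rule running_max_nonneg)
  have grid_in: "grid h n (k n + j) \<in> {0..V}" if "j \<le> m n" for n j
    using grid_mono[of h "k n + j" "k n + m n" n] grid_nonneg[of h n "k n + j"] that h gkm by auto
  have S_bdd: "bdd_above (range (\<lambda>n. S n \<omega>))" if \<omega>: "\<omega> \<in> space P" for \<omega>
  proof -
    obtain B where B: "\<forall>s\<in>{0..V}. \<bar>M s \<omega>\<bar> \<le> B"
      using cadlag_on_bounded[of "{0..}" "\<lambda>s. M s \<omega>" 0 V] M_cad \<omega> by (auto simp: cadlag_process_def)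
    show ?thesis
    proof (rule bdd_aboveI2[where M = "2 * B"])
      fix n
      obtain j where j: "j \<le> m n" "S n \<omega> = \<bar>M (grid h n (k n + j)) \<omega> - M U \<omega>\<bar>"
        using running_max_attained unfolding S_def by meson
      then show "S n \<omega> \<le> 2 * B"
        using bspec[OF B grid_in[OF j(1)]] bspec[OF B, of U] UV by auto
    qed
  qed
  define Ss where "Ss \<omega> = (SUP n. S n \<omega>)" for \<omega>
  have S_lim: "(\<lambda>n. S n \<omega>) \<longlonglongrightarrow> Ss \<omega>" if "\<omega> \<in> space P" for \<omega>
    unfolding Ss_def using S_bdd[OF that] S_mono by (intro LIMSEQ_incseq_SUP incseq_SucI)
  have S_le: "S n \<omega> \<le> Ss \<omega>" if "\<omega> \<in> space P" for n \<omega>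
    unfolding Ss_def by (rule cSUP_upper[OF UNIV_I S_bdd[OF that]])
  have Ss_meas: "Ss \<in> borel_measurable P"
    by (rule borel_measurable_LIMSEQ_real[OF S_lim S_meas])
  have sq_le: "(S n \<omega>)\<^sup>2 \<le> (Ss \<omega>)\<^sup>2" if "\<omega> \<in> space P" for n \<omega>
    using S_le[OF that] S_nn by (intro power_mono) auto
  have Ss_int: "integrable P (\<lambda>\<omega>. (Ss \<omega>)\<^sup>2)"
  proof (rule integrableI_nonneg)
    have inc: "incseq (\<lambda>n \<omega>. ennreal ((S n \<omega>)\<^sup>2))"
      using S_mono S_nn by (intro incseq_SucI) (auto simp: le_fun_def intro!: ennreal_leI power_mono)
    have "ennreal ((Ss \<omega>)\<^sup>2) = (SUP n. ennreal ((S n \<omega>)\<^sup>2))" if "\<omega> \<in> space P" for \<omega>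
    proof (rule LIMSEQ_unique)
      show "(\<lambda>n. ennreal ((S n \<omega>)\<^sup>2)) \<longlonglongrightarrow> ennreal ((Ss \<omega>)\<^sup>2)"
        by (intro tendsto_ennrealI tendsto_power S_lim that)
      show "(\<lambda>n. ennreal ((S n \<omega>)\<^sup>2)) \<longlonglongrightarrow> (SUP n. ennreal ((S n \<omega>)\<^sup>2))"
        using inc by (intro LIMSEQ_SUP) (auto simp: incseq_def le_fun_def)
    qed
    then have "(\<integral>\<^sup>+\<omega>. ennreal ((Ss \<omega>)\<^sup>2) \<partial>P) = (\<integral>\<^sup>+\<omega>. (SUP n. ennreal ((S n \<omega>)\<^sup>2)) \<partial>P)"
      by (rule nn_integral_cong)
    also have "\<dots> = (SUP n. \<integral>\<^sup>+\<omega>. ennreal ((S n \<omega>)\<^sup>2) \<partial>P)"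
      using S_meas by (intro nn_integral_monotone_convergence_SUP inc) measurable
    also have "\<dots> \<le> ennreal (4 * E2)"
    proof (rule SUP_least)
      fix n
      show "(\<integral>\<^sup>+\<omega>. ennreal ((S n \<omega>)\<^sup>2) \<partial>P) \<le> ennreal (4 * E2)"
        using nn_integral_eq_integral[OF S_int[of n]] S_E[of n] by (simp add: ennreal_leI)
    qed
    finally have "(\<integral>\<^sup>+\<omega>. ennreal ((Ss \<omega>)\<^sup>2) \<partial>P) \<le> ennreal (4 * E2)" .
    then show "(\<integral>\<^sup>+\<omega>. ennreal ((Ss \<omega>)\<^sup>2) \<partial>P) < \<infinity>" by (simp add: le_less_trans)
  qed (use Ss_meas in auto)

  \<comment> \<open>Convergence in probability is \<open>L\<^sup>1\<close> convergence of the truncated distance.\<close>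
  define W where "W n \<omega> = min 1 \<bar>VV n \<omega> - \<Delta> \<omega>\<bar>" for n \<omega>
  have W_int: "integrable P (W n)" for n
    by (rule integrable_const_bound[where B = 1])
      (use VV_meas[of n] borel_measurable_integrable[OF \<Delta>_int] in \<open>auto simp: W_def[abs_def]\<close>)
  have W_lim: "(\<lambda>n. expectation (\<lambda>\<omega>. norm (W n \<omega>))) \<longlonglongrightarrow> 0"
  proof -
    define J where "J n = elementary_integral M (n * 2 ^ n) (grid h n) (\<lambda>i. M (grid h n i))" for n
    have ucp: "ucp_tendsto P J I"
      unfolding J_def
    proof (rule ucp_tendsto_grid[OF I h])
      show "M t \<in> borel_measurable (F t)" if "t \<ge> 0" for t using M_ad that by (simp add: adapted_on_def)
      show "\<exists>C. \<forall>s\<in>{0..T}. \<bar>M s \<omega>\<bar> \<le> C" if "\<omega> \<in> space P" for \<omega> T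
        using cadlag_on_bounded[of "{0..}" "\<lambda>s. M s \<omega>" 0 T] M_cad that by (auto simp: cadlag_process_def)
      show "((\<lambda>u. M u \<omega>) \<longlongrightarrow> left_lim (\<lambda>u. M u \<omega>) s) (at_left s)" if "\<omega> \<in> space P" "s > 0" for \<omega> s
        using M_cad that by (intro cadlag_on_left_lim[of "{0..}" _ 0]) (auto simp: cadlag_process_def)
    qed
    define E where "E \<epsilon> n = {\<omega>\<in>space P. \<exists>s\<in>{0..V}. \<bar>J n s \<omega> - I s \<omega>\<bar> > \<epsilon>}" for \<epsilon> n
    have E_lim: "(\<lambda>n. prob (E \<epsilon> n)) \<longlonglongrightarrow> 0" if "\<epsilon> > 0" for \<epsilon>
      using ucp[unfolded ucp_tendsto_def, rule_format, of V \<epsilon>] UV that unfolding E_def by simp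
    have E_sets: "E \<epsilon> n \<in> sets P" for \<epsilon> n
      unfolding E_def J_def
      by (rule sets_elementary_integral_deviation[OF M_cad M_ad I_cad I_ad])
        (use h UV in \<open>auto intro!: grid_nonneg M_meas\<close>)
    have W_E: "expectation (\<lambda>\<omega>. norm (W n \<omega>)) \<le> 4 * \<epsilon> + prob (E \<epsilon> n)" if n: "n \<ge> v" and \<epsilon>: "\<epsilon> > 0" for n \<epsilon>
    proof -
      have ind: "integrable P (indicat_real (E \<epsilon> n))"
        using E_sets by (intro integrable_real_indicator) (auto simp: less_top[symmetric])
      have "expectation (\<lambda>\<omega>. norm (W n \<omega>)) \<le> expectation (\<lambda>\<omega>. 4 * \<epsilon> + indicator (E \<epsilon> n) \<omega>)"
      proof (rule integral_mono_AE)
        show "AE \<omega> in P. norm (W n \<omega>) \<le> 4 * \<epsilon> + indicator (E \<epsilon> n) \<omega>"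
          using QI AE_space
        proof eventually_elim
          case (elim \<omega>)
          have "\<bar>VV n \<omega> - \<Delta> \<omega>\<bar> \<le> 4 * \<epsilon>" if out: "\<omega> \<notin> E \<epsilon> n"
          proof -
            have "(D n i \<omega>)\<^sup>2 = ((M (grid h n (Suc (k n + i))) \<omega>)\<^sup>2 - (M (grid h n (k n + i)) \<omega>)\<^sup>2)
              - 2 * (M (grid h n (k n + i)) \<omega> * D n i \<omega>)" for i
              by (simp add: D_def power2_eq_square algebra_simps)
            then have "VV n \<omega> = (\<Sum>i<m n. (M (grid h n (Suc (k n + i))) \<omega>)\<^sup>2 - (M (grid h n (k n + i)) \<omega>)\<^sup>2)
              - 2 * (\<Sum>i<m n. M (grid h n (k n + i)) \<omega> * D n i \<omega>)"
              unfolding VV_def by (simp add: sum_subtractf sum_distrib_left)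
            also have "(\<Sum>i<m n. (M (grid h n (Suc (k n + i))) \<omega>)\<^sup>2 - (M (grid h n (k n + i)) \<omega>)\<^sup>2)
              = (M V \<omega>)\<^sup>2 - (M U \<omega>)\<^sup>2"
              using sum_lessThan_telescope[of "\<lambda>i. (M (grid h n (k n + i)) \<omega>)\<^sup>2" "m n"] by (simp add: gk gkm)
            also have "(\<Sum>i<m n. M (grid h n (k n + i)) \<omega> * D n i \<omega>) = J n V \<omega> - J n U \<omega>"
            proof -
              have "k n + m n \<le> n * 2 ^ n" using n by (simp add: km)
              from elementary_integral_grid_increment[OF less_imp_le[OF h] this, of M n "\<lambda>i. M (grid h n i)" \<omega>]
              show ?thesis unfolding gk gkm J_def D_def by simp
            qed
            finally have VV: "VV n \<omega> = (M V \<omega>)\<^sup>2 - (M U \<omega>)\<^sup>2 - 2 * (J n V \<omega> - J n U \<omega>)" .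
            have "\<Delta> \<omega> = (M V \<omega>)\<^sup>2 - (M U \<omega>)\<^sup>2 - 2 * (I V \<omega> - I U \<omega>)"
              using elim(1) UV by (simp add: \<Delta>_def)
            then have eq: "VV n \<omega> - \<Delta> \<omega> = 2 * (J n U \<omega> - I U \<omega>) - 2 * (J n V \<omega> - I V \<omega>)"
              unfolding VV by (simp only: algebra_simps)
            have dev: "\<bar>J n s \<omega> - I s \<omega>\<bar> \<le> \<epsilon>" if "s \<in> {0..V}" for s
              using out elim(2) that unfolding E_def by (metis (mono_tags, lifting) mem_Collect_eq not_le)
            have "\<bar>x\<bar> \<le> 4 * e" if "x = 2 * y - 2 * z" "\<bar>y\<bar> \<le> e" "\<bar>z\<bar> \<le> e" for x y z e :: real
              using that by linarith
            from this[OF eq dev dev] show ?thesis using UV by simp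
          qed
          then show ?case using \<epsilon> by (auto simp: W_def indicator_def)
        qed
        show "integrable P (\<lambda>\<omega>. 4 * \<epsilon> + indicat_real (E \<epsilon> n) \<omega>)"
          by (intro Bochner_Integration.integrable_add integrable_const ind)
      qed (use W_int in auto)
      also have "\<dots> = 4 * \<epsilon> + prob (E \<epsilon> n)"
        using Bochner_Integration.integral_add[OF integrable_const ind, of "4 * \<epsilon>"] E_sets[of \<epsilon> n]
        by (simp add: prob_space)
      finally show ?thesis .
    qed
    show ?thesis
    proof (rule LIMSEQ_I)
      fix r :: real assume r: "r > 0"
      have "\<forall>\<^sub>F n in sequentially. prob (E (r / 8) n) < r / 2"
        using E_lim[of "r / 8"] r by (intro order_tendstoD) auto
      then obtain n0 where n0: "\<And>n. n \<ge> n0 \<Longrightarrow> prob (E (r / 8) n) < r / 2" by (auto simp: eventually_sequentially)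
      show "\<exists>no. \<forall>n\<ge>no. norm (expectation (\<lambda>\<omega>. norm (W n \<omega>)) - 0) < r"
      proof (intro exI[of _ "max n0 v"] allI impI)
        fix n assume n: "max n0 v \<le> n"
        have "expectation (\<lambda>\<omega>. norm (W n \<omega>)) < r" using W_E[of n "r / 8"] n0[of n] n r by simp
        moreover have "0 \<le> expectation (\<lambda>\<omega>. norm (W n \<omega>))" by simp
        ultimately show "norm (expectation (\<lambda>\<omega>. norm (W n \<omega>)) - 0) < r" by simp
      qed
    qed
  qed
  from tendsto_L1_AE_subseq[OF W_int W_lim] obtain \<rho> :: "nat \<Rightarrow> nat" where
    W_AE: "AE \<omega> in P. (\<lambda>n. W (\<rho> n) \<omega>) \<longlonglongrightarrow> 0" by blast
  have VV_AE: "AE \<omega> in P. (\<lambda>n. VV (\<rho> n) \<omega>) \<longlonglongrightarrow> \<Delta> \<omega>"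
    using W_AE
  proof eventually_elim
    case (elim \<omega>)
    have "\<forall>\<^sub>F n in sequentially. W (\<rho> n) \<omega> < 1" using elim by (rule order_tendstoD) simp
    then have "\<forall>\<^sub>F n in sequentially. W (\<rho> n) \<omega> = \<bar>VV (\<rho> n) \<omega> - \<Delta> \<omega>\<bar>"
      by eventually_elim (auto simp: W_def)
    from Lim_transform_eventually[OF elim this] show ?case
      by (simp add: tendsto_rabs_zero_iff LIM_zero_iff)
  qed

  have bound: "E2 \<le> expectation \<Delta> + 4 * expectation (\<lambda>\<omega>. (Ss \<omega>)\<^sup>2 * min 1 (\<Delta> \<omega> / K))" if K: "K > 0" for K
  proof -
    note [measurable] = Ss_meas VV_meas borel_measurable_integrable[OF \<Delta>_int]
    let ?f = "\<lambda>X \<omega>. min (X \<omega>) (K + 4 * (Ss \<omega>)\<^sup>2)" and ?g = "\<lambda>X \<omega>. (Ss \<omega>)\<^sup>2 * min 1 (X \<omega> / K)"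
    have dom: "integrable P (\<lambda>\<omega>. K + 4 * (Ss \<omega>)\<^sup>2)" using Ss_int by simp
    have i1: "integrable P (?f X)"
      if "X \<in> borel_measurable P" "\<And>\<omega>. \<omega> \<in> space P \<Longrightarrow> 0 \<le> X \<omega>" for X
    proof (rule Bochner_Integration.integrable_bound[OF dom])
      show "AE \<omega> in P. norm (min (X \<omega>) (K + 4 * (Ss \<omega>)\<^sup>2)) \<le> norm (K + 4 * (Ss \<omega>)\<^sup>2)"
        using that(2) K by (intro AE_I2) (auto simp: min_def)
    qed (use that(1) in measurable)
    have i2: "integrable P (?g X)"
      if "X \<in> borel_measurable P" "\<And>\<omega>. \<omega> \<in> space P \<Longrightarrow> 0 \<le> X \<omega>" for X
    proof (rule Bochner_Integration.integrable_bound[OF Ss_int])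
      show "AE \<omega> in P. norm ((Ss \<omega>)\<^sup>2 * min 1 (X \<omega> / K)) \<le> norm ((Ss \<omega>)\<^sup>2)"
        using that(2) K by (intro AE_I2) (auto simp: abs_mult intro!: mult_left_le)
    qed (use that(1) in measurable)
    have "(\<lambda>n. expectation (?f (VV (\<rho> n))))
      \<longlonglongrightarrow> expectation (?f \<Delta>)"
    proof (rule integral_dominated_convergence[OF _ _ dom])
      show "AE \<omega> in P. (\<lambda>n. min (VV (\<rho> n) \<omega>) (K + 4 * (Ss \<omega>)\<^sup>2)) \<longlonglongrightarrow> min (\<Delta> \<omega>) (K + 4 * (Ss \<omega>)\<^sup>2)"
        using VV_AE by eventually_elim (intro tendsto_intros)
      show "AE \<omega> in P. norm (min (VV (\<rho> n) \<omega>) (K + 4 * (Ss \<omega>)\<^sup>2)) \<le> K + 4 * (Ss \<omega>)\<^sup>2" for n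
        using VV_nn K by (intro AE_I2) (auto simp: min_def)
    qed measurable
    moreover have "(\<lambda>n. expectation (?g (VV (\<rho> n))))
      \<longlonglongrightarrow> expectation (?g \<Delta>)"
    proof (rule integral_dominated_convergence[OF _ _ Ss_int])
      show "AE \<omega> in P. (\<lambda>n. (Ss \<omega>)\<^sup>2 * min 1 (VV (\<rho> n) \<omega> / K)) \<longlonglongrightarrow> (Ss \<omega>)\<^sup>2 * min 1 (\<Delta> \<omega> / K)"
        using VV_AE by eventually_elim (use K in \<open>intro tendsto_intros, auto\<close>)
      show "AE \<omega> in P. norm ((Ss \<omega>)\<^sup>2 * min 1 (VV (\<rho> n) \<omega> / K)) \<le> (Ss \<omega>)\<^sup>2" for n
        using VV_nn K by (intro AE_I2) (auto simp: abs_mult intro!: mult_left_le)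
    qed measurable
    ultimately have lim: "(\<lambda>n. expectation (?f (VV (\<rho> n)))
        + 4 * expectation (?g (VV (\<rho> n))))
      \<longlonglongrightarrow> expectation (?f \<Delta>) + 4 * expectation (?g \<Delta>)"
      by (intro tendsto_intros)
    have "E2 \<le> expectation (?f \<Delta>) + 4 * expectation (?g \<Delta>)"
    proof (rule LIMSEQ_le_const[OF lim], intro exI allI impI)
      fix n
      have "expectation (\<lambda>\<omega>. min (VV (\<rho> n) \<omega>) (K + 4 * (S (\<rho> n) \<omega>)\<^sup>2))
        \<le> expectation (?f (VV (\<rho> n)))"
      proof (rule integral_mono)
        show "integrable P (\<lambda>\<omega>. min (VV (\<rho> n) \<omega>) (K + 4 * (S (\<rho> n) \<omega>)\<^sup>2))"
          by (rule Bochner_Integration.integrable_bound[OF i1[OF VV_meas VV_nn, of "\<rho> n"]])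
            (use S_meas[of "\<rho> n"] VV_nn K sq_le in \<open>auto intro!: AE_I2 simp: min_def, (smt (verit) zero_le_power2)+\<close>)
        show "min (VV (\<rho> n) \<omega>) (K + 4 * (S (\<rho> n) \<omega>)\<^sup>2) \<le> min (VV (\<rho> n) \<omega>) (K + 4 * (Ss \<omega>)\<^sup>2)"
          if "\<omega> \<in> space P" for \<omega>
          using sq_le[OF that, of "\<rho> n"] by (intro min.mono) auto
      qed (rule i1[OF VV_meas VV_nn])
      moreover have "expectation (\<lambda>\<omega>. (S (\<rho> n) \<omega>)\<^sup>2 * min 1 (VV (\<rho> n) \<omega> / K))
        \<le> expectation (?g (VV (\<rho> n)))"
      proof (rule integral_mono)
        show "integrable P (\<lambda>\<omega>. (S (\<rho> n) \<omega>)\<^sup>2 * min 1 (VV (\<rho> n) \<omega> / K))"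
        proof (rule Bochner_Integration.integrable_bound[OF S_int[of "\<rho> n"]])
          show "AE \<omega> in P. norm ((S (\<rho> n) \<omega>)\<^sup>2 * min 1 (VV (\<rho> n) \<omega> / K)) \<le> norm ((S (\<rho> n) \<omega>)\<^sup>2)"
            using VV_nn K by (intro AE_I2) (auto simp: abs_mult intro!: mult_left_le)
        qed (use S_meas[of "\<rho> n"] in measurable)
        show "(S (\<rho> n) \<omega>)\<^sup>2 * min 1 (VV (\<rho> n) \<omega> / K) \<le> (Ss \<omega>)\<^sup>2 * min 1 (VV (\<rho> n) \<omega> / K)"
          if "\<omega> \<in> space P" for \<omega>
          using sq_le[OF that, of "\<rho> n"] VV_nn[of "\<rho> n" \<omega>] K by (intro mult_right_mono) auto
      qed (rule i2[OF VV_meas VV_nn])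
      ultimately show "E2 \<le> expectation (?f (VV (\<rho> n)))
        + 4 * expectation (?g (VV (\<rho> n)))"
        using trunc[OF K, of "\<rho> n"] by linarith
    qed
    also have "expectation (?f \<Delta>) \<le> expectation \<Delta>"
      by (rule integral_mono) (auto intro!: i1 \<Delta>_int \<Delta>_nn)
    finally show ?thesis by simp
  qed
  have "(\<lambda>j. expectation (\<lambda>\<omega>. (Ss \<omega>)\<^sup>2 * min 1 (\<Delta> \<omega> / real (Suc j)))) \<longlonglongrightarrow> expectation (\<lambda>\<omega>. 0)"
  proof (rule integral_dominated_convergence[OF _ _ Ss_int])
    note [measurable] = Ss_meas borel_measurable_integrable[OF \<Delta>_int]
    show "AE \<omega> in P. norm ((Ss \<omega>)\<^sup>2 * min 1 (\<Delta> \<omega> / real (Suc j))) \<le> (Ss \<omega>)\<^sup>2" for j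
      using \<Delta>_nn by (intro AE_I2) (auto simp: abs_mult intro!: mult_left_le)
    show "AE \<omega> in P. (\<lambda>j. (Ss \<omega>)\<^sup>2 * min 1 (\<Delta> \<omega> / real (Suc j))) \<longlonglongrightarrow> 0"
    proof (rule AE_I2)
      fix \<omega>
      have "(\<lambda>j. \<Delta> \<omega> * inverse (real (Suc j))) \<longlonglongrightarrow> \<Delta> \<omega> * 0"
        by (intro tendsto_mult tendsto_const LIMSEQ_inverse_real_of_nat)
      then have "(\<lambda>j. (Ss \<omega>)\<^sup>2 * min 1 (\<Delta> \<omega> * inverse (real (Suc j)))) \<longlonglongrightarrow> (Ss \<omega>)\<^sup>2 * min 1 (\<Delta> \<omega> * 0)"
        by (rule tendsto_mult[OF tendsto_const tendsto_min[OF tendsto_const]])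
      then show "(\<lambda>j. (Ss \<omega>)\<^sup>2 * min 1 (\<Delta> \<omega> / real (Suc j))) \<longlonglongrightarrow> 0"
        by (simp add: divide_inverse)
    qed
    show "(\<lambda>\<omega>. (Ss \<omega>)\<^sup>2 * min 1 (\<Delta> \<omega> / real (Suc j))) \<in> borel_measurable P" for j by measurable
  qed simp
  then have "(\<lambda>j. expectation \<Delta> + 4 * expectation (\<lambda>\<omega>. (Ss \<omega>)\<^sup>2 * min 1 (\<Delta> \<omega> / real (Suc j))))
    \<longlonglongrightarrow> expectation \<Delta> + 4 * 0"
    by (intro tendsto_intros) simp
  then have "E2 \<le> expectation \<Delta> + 4 * 0"
    by (rule LIMSEQ_le_const) (use bound in auto)
  then show ?thesis by (simp add: E2_def \<Delta>_def[abs_def] U_def V_def)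
qed

end

section \<open>The Doleans measure of a strip\<close>

text \<open>An intersection-stable generator of the predictable \<open>\<sigma>\<close>-algebra, for use in Dynkin's argument.\<close>

definition predictable_rectangles :: "'a measure \<Rightarrow> (real \<Rightarrow> 'a measure) \<Rightarrow> (real \<times> 'a) set set" where
  "predictable_rectangles P F =
     {{0} \<times> A |A. A \<in> sets (F 0)} \<union>
     {{s<..t} \<times> A |s t A. 0 \<le> s \<and> s \<le> t \<and> A \<in> sets (F s)}"

context filtered_space
begin

lemma sets_F: "A \<in> sets (F t) \<Longrightarrow> A \<in> sets P"
  using F_sub[of t] by (auto simp: subalgebra_def)

lemma space_in_F: "space P \<in> sets (F t)"
  using F_sub[of t] sets.top[of "F t"] by (simp add: subalgebra_def)

lemma predictable_rectangles_subset: "predictable_rectangles P F \<subseteq> Pow ({0..} \<times> space P)"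
  using sets.sets_into_space[OF sets_F] by (fastforce simp: predictable_rectangles_def)

lemma sets_predictable: "sets (predictable P F) = sigma_sets ({0..} \<times> space P) (predictable_rectangles P F)"
  using predictable_rectangles_subset by (simp add: predictable_def predictable_rectangles_def)

lemma space_predictable: "space (predictable P F) = {0..} \<times> space P"
  using predictable_rectangles_subset by (simp add: predictable_def predictable_rectangles_def space_measure_of)

lemma predictable_strip:
  assumes "0 \<le> r" "r \<le> t"
  shows "{r<..t} \<times> space P \<in> sets (predictable P F)"
proof -
  have "{r<..t} \<times> space P \<in> predictable_rectangles P F"
    unfolding predictable_rectangles_def using assms space_in_F by blast
  then show ?thesis unfolding sets_predictable by (rule sigma_sets.Basic)
qed

lemma predictable_zero_slice: "{0} \<times> space P \<in> sets (predictable P F)"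
proof -
  have "{0} \<times> space P \<in> predictable_rectangles P F"
    unfolding predictable_rectangles_def using space_in_F by blast
  then show ?thesis unfolding sets_predictable by (rule sigma_sets.Basic)
qed

lemma Int_stable_predictable_rectangles: "Int_stable (predictable_rectangles P F)"
proof (rule Int_stableI)
  fix a b assume a: "a \<in> predictable_rectangles P F" and b: "b \<in> predictable_rectangles P F"
  have point: "{0} \<times> A \<in> predictable_rectangles P F" if "A \<in> sets (F 0)" for A
    using that by (auto simp: predictable_rectangles_def)
  have strip: "{s<..t} \<times> A \<in> predictable_rectangles P F" if "0 \<le> s" "s \<le> t" "A \<in> sets (F s)" for s t A
    using that by (auto simp: predictable_rectangles_def)
  have empty: "{} \<in> predictable_rectangles P F" using point[of "{}"] by simp
  from a consider (p) A where "a = {0} \<times> A" "A \<in> sets (F 0)"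
    | (s) s t A where "a = {s<..t} \<times> A" "0 \<le> s" "s \<le> t" "A \<in> sets (F s)"
    unfolding predictable_rectangles_def by blast
  note ca = this
  from b consider (p) A where "b = {0} \<times> A" "A \<in> sets (F 0)"
    | (s) s t A where "b = {s<..t} \<times> A" "0 \<le> s" "s \<le> t" "A \<in> sets (F s)"
    unfolding predictable_rectangles_def by blast
  note cb = this
  show "a \<inter> b \<in> predictable_rectangles P F"
  proof (cases rule: ca)
    case pa: (p A)
    show ?thesis
    proof (cases rule: cb)
      case (p B)
      have "a \<inter> b = {0} \<times> (A \<inter> B)" using pa p by auto
      then show ?thesis using pa p by (auto intro: point)
    next
      case (s s t B)
      then have "a \<inter> b = {}" using pa by auto
      then show ?thesis using empty by simp
    qed
  next
    case sa: (s s t A)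
    show ?thesis
    proof (cases rule: cb)
      case (p B)
      then have "a \<inter> b = {}" using sa by auto
      then show ?thesis using empty by simp
    next
      case sb: (s s' t' B)
      have eq: "a \<inter> b = {max s s'<..min t t'} \<times> (A \<inter> B)" using sa sb by auto
      show ?thesis
      proof (cases "max s s' \<le> min t t'")
        case True
        have "A \<inter> B \<in> sets (F (max s s'))"
          using F_mono[of s "max s s'"] F_mono[of s' "max s s'"] sa sb by auto
        then show ?thesis unfolding eq using sa sb True by (intro strip) auto
      next
        case False
        then have "{max s s'<..min t t'} = {}" by auto
        then have "a \<inter> b = {}" unfolding eq by simp
        then show ?thesis using empty by simp
      qed
    qed
  qed
qed

lemma subalgebra_predictable: "subalgebra (restrict_space lborel {0..} \<Otimes>\<^sub>M P) (predictable P F)"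
proof -
  have r: "B \<in> sets (restrict_space lborel {0..})" if "B \<in> sets borel" "B \<subseteq> {0::real..}" for B
    using that by (auto simp: sets_restrict_space_iff)
  have "predictable_rectangles P F \<subseteq> sets (restrict_space lborel {0..} \<Otimes>\<^sub>M P)"
    unfolding predictable_rectangles_def by (auto intro!: pair_measureI sets_F r)
  moreover have sp: "space (restrict_space lborel {0::real..} \<Otimes>\<^sub>M P) = {0..} \<times> space P"
    by (simp add: space_pair_measure space_restrict_space)
  ultimately show ?thesis
    unfolding subalgebra_def sets_predictable space_predictable
    using sets.sigma_sets_subset[of "predictable_rectangles P F" "restrict_space lborel {0..} \<Otimes>\<^sub>M P"] by simp
qed

lemma predictable_section: 
  assumes "A \<in> sets (predictable P F)"
  shows "(\<lambda>s. (s, \<omega>)) -` A \<in> sets borel"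
proof -
  have "A \<in> sets (restrict_space lborel {0..} \<Otimes>\<^sub>M P)"
    using assms subalgebra_predictable by (auto simp: subalgebra_def)
  then have "(\<lambda>s. (s, \<omega>)) -` A \<in> sets (restrict_space lborel {0..})" by (rule sets_Pair2)
  then show ?thesis by (auto simp: sets_restrict_space_iff)
qed

context
  fixes Q :: "real \<Rightarrow> 'a \<Rightarrow> real"
  assumes Q_ad: "adapted_on F {0..} Q" and Q_cad: "cadlag_process P {0..} Q"
    and Q_mono: "\<And>\<omega>. \<omega> \<in> space P \<Longrightarrow> mono_on {0..} (\<lambda>t. Q t \<omega>)"
begin

lemma emeasure_path_Ioc:
  assumes "\<omega> \<in> space P" "a \<le> b"
  shows "emeasure (interval_measure (\<lambda>t. Q (max 0 t) \<omega>)) {a<..b} = ennreal (Q (max 0 b) \<omega> - Q (max 0 a) \<omega>)"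
proof (rule emeasure_interval_measure_Ioc[OF assms(2)])
  show "Q (max 0 x) \<omega> \<le> Q (max 0 y) \<omega>" if "x \<le> y" for x y
    using Q_mono[OF assms(1)] that by (auto intro: mono_onD)
  show "continuous (at_right a) (\<lambda>t. Q (max 0 t) \<omega>)" for a
  proof -
    have "((\<lambda>t. Q t \<omega>) \<longlongrightarrow> Q (max 0 a) \<omega>) (at_right (max 0 a))"
      using Q_cad assms(1) by (intro cadlag_on_tendsto_right[of "{0..}" _ _ "max 0 a + 1"]) (auto simp:
        cadlag_process_def)
    then show ?thesis
    proof (cases "a < 0")
      case True
      have "\<forall>\<^sub>F t in at_right a. Q 0 \<omega> = Q (max 0 t) \<omega>"
        unfolding eventually_at_right_field using True by (intro exI[of _ 0]) (auto simp: max_def)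
      from Lim_transform_eventually[OF tendsto_const this] show ?thesis
        using True by (simp add: continuous_within max_def)
    next
      case False
      assume "((\<lambda>t. Q t \<omega>) \<longlongrightarrow> Q (max 0 a) \<omega>) (at_right (max 0 a))"
      then have "((\<lambda>t. Q t \<omega>) \<longlongrightarrow> Q a \<omega>) (at_right a)" using False by (simp add: max_def)
      moreover have "\<forall>\<^sub>F t in at_right a. Q t \<omega> = Q (max 0 t) \<omega>"
        unfolding eventually_at_right_field using False by (intro exI[of _ "a + 1"]) (auto simp: max_def)
      ultimately show ?thesis
        using False by (auto simp: continuous_within max_def intro: Lim_transform_eventually)
    qed
  qed
qed

text \<open>The path is extended by the constant \<open>Q 0\<close> to negative times and is right-continuous at 0, so that
the interval measure has no mass on the closed negative half line.\<close>

lemma emeasure_path_zero: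
  assumes "\<omega> \<in> space P" "B \<subseteq> {..0}" "B \<in> sets borel"
  shows "emeasure (interval_measure (\<lambda>t. Q (max 0 t) \<omega>)) B = 0"
proof -
  let ?\<mu> = "interval_measure (\<lambda>t. Q (max 0 t) \<omega>)"
  have "{..0::real} = (\<Union>n. {- real n<..0})"
  proof (intro set_eqI iffI)
    fix x :: real assume "x \<in> {..0}"
    moreover obtain n :: nat where "- x < real n" using reals_Archimedean2 by blast
    ultimately show "x \<in> (\<Union>n. {- real n<..0})" by (intro UN_I[of n]) auto
  qed auto
  moreover have "(\<Union>n. {- real n<..0}) \<in> null_sets ?\<mu>"
    using emeasure_path_Ioc[OF assms(1), of "- real n" 0 for n]
    by (intro null_sets_UN) (auto simp: null_sets_def max_def)
  ultimately show ?thesis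
    using assms by (metis emeasure_mono emeasure_eq_0 null_setsD1 null_setsD2)
qed

text \<open>Dynkin's argument on the predictable rectangles.  Complements require finite measures, so the paths
are cut off at time \<open>n\<close> first, and \<open>n\<close> tends to infinity afterwards.\<close>

lemma measurable_path_measure_of_section:
  assumes "A \<in> sets (predictable P F)"
  shows "(\<lambda>\<omega>. emeasure (interval_measure (\<lambda>t. Q (max 0 t) \<omega>)) ((\<lambda>s. (s, \<omega>)) -` A)) \<in> borel_measurable P"
proof -
  let ?\<mu> = "\<lambda>\<omega>. interval_measure (\<lambda>t. Q (max 0 t) \<omega>)"
  define f where "f n A \<omega> = emeasure (?\<mu> \<omega>) ((\<lambda>s. (s, \<omega>)) -` A \<inter> {..real n})" for n :: nat and A \<omega>
  have Q_meas: "Q t \<in> borel_measurable P" if "t \<ge> 0" for t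
    using Q_ad that by (auto simp: adapted_on_def intro: measurable_F)
  have f_meas: "f n A \<in> borel_measurable P" for n
    using Int_stable_predictable_rectangles predictable_rectangles_subset assms[unfolded sets_predictable]
  proof (induction rule: sigma_sets_induct_disjoint)
    case (basic A)
    then consider (p) B where "A = {0} \<times> B" "B \<in> sets (F 0)"
      | (s) s t B where "A = {s<..t} \<times> B" "0 \<le> s" "s \<le> t" "B \<in> sets (F s)"
      unfolding predictable_rectangles_def by blast
    then show ?case
    proof cases
      case p
      have "f n A \<omega> = 0" if "\<omega> \<in> space P" for \<omega>
        unfolding f_def
      proof (rule emeasure_path_zero[OF that])
        have "(\<lambda>s. (s, \<omega>)) -` A = (if \<omega> \<in> B then {0} else {})" by (auto simp: p)
        then show "(\<lambda>s. (s, \<omega>)) -` A \<inter> {..real n} \<in> sets borel" by auto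
      qed (auto simp: p)
      then show ?thesis by (subst measurable_cong[where g = "\<lambda>_. 0"]) auto
    next
      case s
      \<comment> \<open>The maximum with \<open>s\<close> makes the cut off interval \<open>(s, t']\<close> empty when \<open>n < s\<close>.\<close>
      define t' where "t' = max s (min t (real n))"
      have "f n A \<omega> = indicator B \<omega> * ennreal (Q t' \<omega> - Q s \<omega>)" if "\<omega> \<in> space P" for \<omega>
      proof -
        have "(\<lambda>s. (s, \<omega>)) -` A \<inter> {..real n} = (if \<omega> \<in> B then {s<..t'} else {})"
          by (auto simp: s t'_def)
        then show ?thesis
          using emeasure_path_Ioc[OF that, of s t'] s by (auto simp: f_def t'_def max_def)
      qed
      moreover have "(\<lambda>\<omega>. indicator B \<omega> * ennreal (Q t' \<omega> - Q s \<omega>)) \<in> borel_measurable P"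
        using Q_meas[of t'] Q_meas[of s] s sets_F[of B s] by (auto simp: t'_def)
      ultimately show ?thesis by (subst measurable_cong) auto
    qed
  next
    case empty
    then show ?case by (simp add: f_def[abs_def])
  next
    case (compl A)
    have "f n ({0..} \<times> space P - A) \<omega> = ennreal (Q (real n) \<omega> - Q 0 \<omega>) - f n A \<omega>" if \<omega>: "\<omega> \<in> space P" for \<omega>
    proof -
      let ?S = "(\<lambda>s. (s, \<omega>)) -` A"
      have sub: "A \<subseteq> {0..} \<times> space P"
        using compl(1) sigma_sets_into_sp[OF predictable_rectangles_subset] by blast
      have S: "?S \<in> sets borel" using compl(1) by (intro predictable_section) (simp add: sets_predictable)
      have S0: "?S \<subseteq> {0..}" using sub by auto
      have "{-1<..real n} = {-1<..<0} \<union> {0..real n}" by auto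
      then have whole: "emeasure (?\<mu> \<omega>) {0..real n} = ennreal (Q (real n) \<omega> - Q 0 \<omega>)"
      proof -
        have "{-1<..<0} \<in> null_sets (?\<mu> \<omega>)"
          by (intro null_setsI emeasure_path_zero[OF \<omega>]) auto
        then have "emeasure (?\<mu> \<omega>) ({0..real n} \<union> {-1<..<0}) = emeasure (?\<mu> \<omega>) {0..real n}"
          by (intro emeasure_Un_null_set) auto
        moreover have "emeasure (?\<mu> \<omega>) {-1<..real n} = ennreal (Q (real n) \<omega> - Q 0 \<omega>)"
          using emeasure_path_Ioc[OF \<omega>, of "-1" "real n"] by (simp add: max_absorb1 max_absorb2)
        ultimately show ?thesis using \<open>{-1<..real n} = {-1<..<0} \<union> {0..real n}\<close> by (simp add: Un_commute)
      qed
      have "(\<lambda>s. (s, \<omega>)) -` ({0..} \<times> space P - A) \<inter> {..real n} = {0..real n} - (?S \<inter> {..real n})"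
        using \<omega> by auto
      then have "f n ({0..} \<times> space P - A) \<omega> = emeasure (?\<mu> \<omega>) ({0..real n} - (?S \<inter> {..real n}))"
        by (simp add: f_def)
      also have "\<dots> = emeasure (?\<mu> \<omega>) {0..real n} - emeasure (?\<mu> \<omega>) (?S \<inter> {..real n})"
      proof (rule emeasure_Diff)
        have "emeasure (?\<mu> \<omega>) (?S \<inter> {..real n}) \<le> emeasure (?\<mu> \<omega>) {0..real n}"
          using S0 S by (intro emeasure_mono) auto
        then show "emeasure (?\<mu> \<omega>) (?S \<inter> {..real n}) \<noteq> \<infinity>"
          unfolding whole by (auto simp: top_unique)
      qed (use S0 S in auto)
      finally show ?thesis unfolding whole by (simp add: f_def)
    qed
    moreover have "(\<lambda>\<omega>. ennreal (Q (real n) \<omega> - Q 0 \<omega>) - f n A \<omega>) \<in> borel_measurable P"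
      using compl(2) Q_meas[of "real n"] Q_meas[of 0] by measurable
    ultimately show ?case by (subst measurable_cong) auto
  next
    case (union A)
    have "f n (\<Union>i. A i) \<omega> = (\<Sum>i. f n (A i) \<omega>)" for \<omega>
    proof -
      have "(\<lambda>s. (s, \<omega>)) -` (\<Union>i. A i) \<inter> {..real n} = (\<Union>i. (\<lambda>s. (s, \<omega>)) -` A i \<inter> {..real n})" by auto
      moreover have "(\<lambda>s. (s, \<omega>)) -` A i \<in> sets borel" for i
        using union(2) by (intro predictable_section) (auto simp: sets_predictable)
      moreover have "disjoint_family (\<lambda>i. (\<lambda>s. (s, \<omega>)) -` A i \<inter> {..real n})"
        using union(1) by (fastforce simp: disjoint_family_on_def)
      ultimately show ?thesis
        unfolding f_def by (subst suminf_emeasure) auto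
    qed
    moreover have "(\<lambda>\<omega>. \<Sum>i. f n (A i) \<omega>) \<in> borel_measurable P"
      using union(3) by measurable
    ultimately show ?case by (simp cong: measurable_cong)
  qed
  have "emeasure (?\<mu> \<omega>) ((\<lambda>s. (s, \<omega>)) -` A) = (SUP n. f n A \<omega>)" for \<omega>
  proof -
    have "(\<Union>n. (\<lambda>s. (s, \<omega>)) -` A \<inter> {..real n}) = (\<lambda>s. (s, \<omega>)) -` A"
      using real_arch_simple by auto
    moreover have "incseq (\<lambda>n. (\<lambda>s. (s, \<omega>)) -` A \<inter> {..real n})"
      by (auto simp: incseq_def)
    ultimately show ?thesis
      unfolding f_def using predictable_section[OF assms, of \<omega>] by (subst SUP_emeasure_incseq) auto
  qed
  then show ?thesis using f_meas by (simp cong: measurable_cong)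
qed

lemma predictable_into_space: "sets (predictable P F) \<subseteq> Pow ({0..} \<times> space P)"
  using sets.space_closed[of "predictable P F"] by (simp add: space_predictable)

lemma sets_doleans: "sets (doleans_measure P F Q) = sets (predictable P F)"
  unfolding doleans_measure_def
  using sets.sigma_sets_eq[of "predictable P F"] predictable_into_space by (simp add: space_predictable)

text \<open>The set function that defines the Doleans measure is countably additive, by monotone convergence and
because the measures of the sections are measurable; it is therefore the measure generated by it, and
on a strip its value is read off from the paths of \<open>Q\<close>.\<close>

lemma emeasure_doleans_strip:
  assumes "0 \<le> r" "r \<le> t"
  shows "emeasure (doleans_measure P F Q) ({r<..t} \<times> space P) = (\<integral>\<^sup>+\<omega>. ennreal (Q t \<omega> - Q r \<omega>) \<partial>P)"
proof -
  let ?\<mu> = "\<lambda>\<omega>. interval_measure (\<lambda>t. Q (max 0 t) \<omega>)"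
  let ?\<kappa> = "\<lambda>A. \<integral>\<^sup>+\<omega>. (\<integral>\<^sup>+s. indicator A (s, \<omega>) \<partial>?\<mu> \<omega>) \<partial>P"
  have kernel: "?\<kappa> A = (\<integral>\<^sup>+\<omega>. emeasure (?\<mu> \<omega>) ((\<lambda>s. (s, \<omega>)) -` A) \<partial>P)" if "A \<in> sets (predictable P F)" for A
  proof (intro nn_integral_cong)
    fix \<omega>
    have "(\<lambda>s. indicator A (s, \<omega>) :: ennreal) = indicator ((\<lambda>s. (s, \<omega>)) -` A)" by (auto simp: indicator_def)
    then show "(\<integral>\<^sup>+s. indicator A (s, \<omega>) \<partial>?\<mu> \<omega>) = emeasure (?\<mu> \<omega>) ((\<lambda>s. (s, \<omega>)) -` A)"
      using predictable_section[OF that, of \<omega>] by simp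
  qed
  have strip: "{r<..t} \<times> space P \<in> sets (predictable P F)"
    by (rule predictable_strip[OF assms])
  have "emeasure (doleans_measure P F Q) ({r<..t} \<times> space P) = ?\<kappa> ({r<..t} \<times> space P)"
  proof (rule emeasure_measure_of[OF doleans_measure_def predictable_into_space])
    show "positive (sets (doleans_measure P F Q)) ?\<kappa>" by (simp add: positive_def)
    show "countably_additive (sets (doleans_measure P F Q)) ?\<kappa>"
      unfolding countably_additive_def sets_doleans
    proof (intro allI impI)
      fix A :: "nat \<Rightarrow> (real \<times> 'a) set"
      assume A: "range A \<subseteq> sets (predictable P F)" "disjoint_family A" "(\<Union>i. A i) \<in> sets (predictable P F)"
      have Ai: "A i \<in> sets (predictable P F)" for i using A(1) by auto
      have "(\<Sum>i. ?\<kappa> (A i)) = (\<integral>\<^sup>+\<omega>. (\<Sum>i. emeasure (?\<mu> \<omega>) ((\<lambda>s. (s, \<omega>)) -` A i)) \<partial>P)"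
        unfolding kernel[OF Ai] by (intro nn_integral_suminf[symmetric] measurable_path_measure_of_section Ai)
      also have "\<dots> = (\<integral>\<^sup>+\<omega>. emeasure (?\<mu> \<omega>) ((\<lambda>s. (s, \<omega>)) -` (\<Union>i. A i)) \<partial>P)"
      proof (intro nn_integral_cong)
        fix \<omega>
        have "(\<Sum>i. emeasure (?\<mu> \<omega>) ((\<lambda>s. (s, \<omega>)) -` A i)) = emeasure (?\<mu> \<omega>) (\<Union>i. (\<lambda>s. (s, \<omega>)) -` A i)"
          using A(2) predictable_section[OF Ai, of \<omega>]
          by (intro suminf_emeasure) (auto simp: disjoint_family_on_def)
        then show "(\<Sum>i. emeasure (?\<mu> \<omega>) ((\<lambda>s. (s, \<omega>)) -` A i)) = emeasure (?\<mu> \<omega>) ((\<lambda>s. (s, \<omega>)) -` (\<Union>i. A i))"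
          by (simp add: vimage_UN)
      qed
      also have "\<dots> = ?\<kappa> (\<Union>i. A i)" by (rule kernel[OF A(3), symmetric])
      finally show "(\<Sum>i. ?\<kappa> (A i)) = ?\<kappa> (\<Union>i. A i)" .
    qed
  qed (use strip sets_doleans in simp)
  also have "\<dots> = (\<integral>\<^sup>+\<omega>. ennreal (Q t \<omega> - Q r \<omega>) \<partial>P)"
    unfolding kernel[OF strip]
  proof (intro nn_integral_cong)
    fix \<omega> assume \<omega>: "\<omega> \<in> space P"
    then have "(\<lambda>s. (s, \<omega>)) -` ({r<..t} \<times> space P) = {r<..t}" by auto
    then show "emeasure (?\<mu> \<omega>) ((\<lambda>s. (s, \<omega>)) -` ({r<..t} \<times> space P)) = ennreal (Q t \<omega> - Q r \<omega>)"
      using emeasure_path_Ioc[OF \<omega> assms(2)] assms by (simp add: max_def)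
  qed
  finally show ?thesis .
qed

lemma emeasure_time_prob_strip:
  assumes "0 \<le> r" "r \<le> t"
  shows "emeasure (time_prob_measure P F) ({r<..t} \<times> space P) = ennreal (t - r)"
proof -
  have "{r<..t} \<times> space P \<in> sets (predictable P F)"
    by (rule predictable_strip[OF assms])
  then have "emeasure (time_prob_measure P F) ({r<..t} \<times> space P)
    = emeasure (restrict_space lborel {0..} \<Otimes>\<^sub>M P) ({r<..t} \<times> space P)"
    unfolding time_prob_measure_def by (intro emeasure_restr_to_subalg subalgebra_predictable)
  also have "\<dots> = emeasure (restrict_space lborel {0..}) {r<..t} * emeasure P (space P)"
    using assms by (intro emeasure_pair_measure_Times) (auto simp: sets_restrict_space_iff)
  also have "\<dots> = ennreal (t - r)"
    using assms by (subst emeasure_restrict_space) (auto simp: emeasure_space_1)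
  finally show ?thesis .
qed

lemma sets_time_prob: "sets (time_prob_measure P F) = sets (predictable P F)"
  unfolding time_prob_measure_def by (rule sets_restr_to_subalg[OF subalgebra_predictable])

lemma sigma_finite_time_prob: "sigma_finite_measure (time_prob_measure P F)"
proof
  let ?T = "time_prob_measure P F"
  let ?N = "{0::real} \<times> space P"
  let ?A = "insert ?N (range (\<lambda>n. {0<..real n} \<times> space P))"
  note N = predictable_zero_slice
  have S: "{0<..real n} \<times> space P \<in> sets (predictable P F)" for n
    by (rule predictable_strip) auto
  have eN: "emeasure ?T ?N \<noteq> \<infinity>"
  proof -
    have "emeasure ?T ?N = emeasure (restrict_space lborel {0..} \<Otimes>\<^sub>M P) ?N"
      unfolding time_prob_measure_def by (rule emeasure_restr_to_subalg[OF subalgebra_predictable N])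
    also have "\<dots> = emeasure (restrict_space lborel {0..}) {0::real} * emeasure P (space P)"
      by (intro emeasure_pair_measure_Times) (auto simp: sets_restrict_space_iff)
    also have "\<dots> = 0" by (subst emeasure_restrict_space) auto
    finally show ?thesis by simp
  qed
  have sp: "space ?T = {0..} \<times> space P"
    unfolding time_prob_measure_def space_restr_to_subalg by (simp add: space_pair_measure space_restrict_space)
  have "\<Union>?A = {0::real..} \<times> space P"
  proof (intro subset_antisym subsetI)
    fix z :: "real \<times> 'a" assume z: "z \<in> {0..} \<times> space P"
    obtain n :: nat where "fst z \<le> real n" using real_arch_simple by blast
    with z show "z \<in> \<Union>?A" by (cases z) (auto simp: less_le)
  qed auto
  then show "\<exists>A. countable A \<and> A \<subseteq> sets ?T \<and> \<Union>A = space ?T \<and> (\<forall>a\<in>A. emeasure ?T a \<noteq> \<infinity>)"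
    using N S eN emeasure_time_prob_strip[of 0] unfolding sp sets_time_prob
    by (intro exI[of _ ?A]) auto
qed

text \<open>By Radon-Nikodym, the Doleans measure of a strip is the integral of the density over the strip, whose
measure under \<open>ds \<times> P\<close> is the length of the time interval.\<close>

lemma nn_integral_increment_le_of_RN_deriv_bound:
  assumes ac: "absolutely_continuous (time_prob_measure P F) (doleans_measure P F Q)"
    and c: "c \<ge> 0" "AE z in time_prob_measure P F.
      RN_deriv (time_prob_measure P F) (doleans_measure P F Q) z \<le> ennreal c"
    and rt: "0 \<le> r" "r \<le> t"
  shows "(\<integral>\<^sup>+\<omega>. ennreal (Q t \<omega> - Q r \<omega>) \<partial>P) \<le> ennreal (c * (t - r))"
proof -
  let ?T = "time_prob_measure P F" and ?N = "doleans_measure P F Q"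
  let ?B = "{r<..t} \<times> space P"
  interpret T: sigma_finite_measure ?T by (rule sigma_finite_time_prob)
  have sets: "sets ?N = sets ?T" by (simp add: sets_doleans sets_time_prob)
  have B: "?B \<in> sets ?T"
    unfolding sets_time_prob by (rule predictable_strip[OF rt])
  have "(\<integral>\<^sup>+\<omega>. ennreal (Q t \<omega> - Q r \<omega>) \<partial>P) = emeasure ?N ?B"
    by (rule emeasure_doleans_strip[OF rt, symmetric])
  also have "\<dots> = emeasure (density ?T (RN_deriv ?T ?N)) ?B"
    by (simp add: T.density_RN_deriv[OF ac sets])
  also have "\<dots> = (\<integral>\<^sup>+z. RN_deriv ?T ?N z * indicator ?B z \<partial>?T)"
    by (rule emeasure_density[OF _ B]) simp
  also have "\<dots> \<le> (\<integral>\<^sup>+z. ennreal c * indicator ?B z \<partial>?T)"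
    using c(2) by (intro nn_integral_mono_AE) (auto elim!: eventually_mono intro!: mult_right_mono)
  also have "\<dots> = ennreal c * ennreal (t - r)"
    by (simp add: nn_integral_cmult_indicator[OF B] emeasure_time_prob_strip[OF rt])
  finally show ?thesis using c(1) rt by (simp add: ennreal_mult)
qed

end

lemma HDol_increment_second_moment:
  assumes M: "HDol P F M" and h: "h > 0"
  shows "orthogonal_increments P F M \<and>
    (\<exists>C. \<forall>u v. u \<le> v \<longrightarrow>
      expectation (\<lambda>\<omega>. (M (real v * h) \<omega> - M (real u * h) \<omega>)\<^sup>2) \<le> C * (real (v - u) * h))"
proof -
  obtain Q c where cad: "cadlag_process P {0..} M" and mart: "martingale P F M" and sq: "square_integrable P M"
    and Q: "is_quadratic_variation P F M Q"
    and ac: "absolutely_continuous (time_prob_measure P F) (doleans_measure P F Q)"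
    and c: "c > 0" "AE z in time_prob_measure P F.
      RN_deriv (time_prob_measure P F) (doleans_measure P F Q) z \<le> ennreal c"
    using M unfolding HDol_def by blast
  have orth: "orthogonal_increments P F M" by (rule orthogonal_increments_of_martingale[OF mart sq])
  have Q_ad: "adapted_on F {0..} Q" and Q_cad: "cadlag_process P {0..} Q"
    and Q_mono: "\<And>\<omega>. \<omega> \<in> space P \<Longrightarrow> mono_on {0..} (\<lambda>t. Q t \<omega>)"
    using Q unfolding is_quadratic_variation_def by blast+
  have "expectation (\<lambda>\<omega>. (M (real v * h) \<omega> - M (real u * h) \<omega>)\<^sup>2) \<le> c * (real (v - u) * h)" if uv: "u \<le> v" for u v
  proof -
    let ?D = "\<lambda>\<omega>. Q (real v * h) \<omega> - Q (real u * h) \<omega>"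
    have rt: "0 \<le> real u * h" "real u * h \<le> real v * h" using h uv by auto
    have nn: "(\<integral>\<^sup>+\<omega>. ennreal (?D \<omega>) \<partial>P) \<le> ennreal (c * (real v * h - real u * h))"
      by (rule nn_integral_increment_le_of_RN_deriv_bound[OF Q_ad Q_cad Q_mono ac less_imp_le[OF c(1)] c(2) rt])
    have meas: "?D \<in> borel_measurable P"
      using Q_ad rt unfolding adapted_on_def by (intro borel_measurable_diff measurable_F) auto
    have pos: "AE \<omega> in P. 0 \<le> ?D \<omega>"
      using mono_onD[OF Q_mono, of _ "real u * h" "real v * h"] rt by (intro AE_I2) auto
    have int: "integrable P ?D"
      by (rule integrableI_nonneg[OF meas pos]) (use nn in \<open>simp add: le_less_trans\<close>)
    have "ennreal (expectation ?D) \<le> ennreal (c * (real v * h - real u * h))"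
      using nn nn_integral_eq_integral[OF int pos] by simp
    then have "expectation ?D \<le> c * (real v * h - real u * h)"
      using c(1) rt by (subst (asm) ennreal_le_iff) auto
    also have "\<dots> = c * (real (v - u) * h)" using uv by (simp add: of_nat_diff left_diff_distrib)
    finally show ?thesis
      using second_moment_increment_le_quadratic_variation[OF orth cad Q h uv int] by linarith
  qed
  with orth show ?thesis by blast
qed

end

section \<open>Boundedness in probability\<close>

text \<open>The exceedance events of suprema over uncountably many times need not be measurable; it is enough to
enclose them in events of small probability.\<close>

lemma (in prob_space) bounded_above_in_probI:
  assumes ne: "J \<noteq> {}"
    and tail: "\<And>\<epsilon>. \<epsilon> > 0 \<Longrightarrow> \<exists>K. \<forall>\<eta>\<in>J. \<exists>B\<in>events. prob B \<le> \<epsilon> \<and> {\<omega>\<in>space M. Z \<eta> \<omega> \<ge> K} \<subseteq> B"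
  shows "bounded_above_in_prob M J Z"
  unfolding bounded_above_in_prob_def
proof (rule tendstoI)
  fix \<epsilon> :: real assume \<epsilon>: "\<epsilon> > 0"
  obtain K where K: "\<And>\<eta>. \<eta> \<in> J \<Longrightarrow> \<exists>B\<in>events. prob B \<le> \<epsilon> / 2 \<and> {\<omega>\<in>space M. Z \<eta> \<omega> \<ge> K} \<subseteq> B"
    using tail[of "\<epsilon> / 2"] \<epsilon> by auto
  show "\<forall>\<^sub>F R in at_top. dist (SUP \<eta>\<in>J. prob {\<omega>\<in>space M. Z \<eta> \<omega> \<ge> R}) 0 < \<epsilon>"
    using eventually_ge_at_top[of K]
  proof eventually_elim
    case (elim R)
    have le: "prob {\<omega>\<in>space M. Z \<eta> \<omega> \<ge> R} \<le> \<epsilon> / 2" if \<eta>: "\<eta> \<in> J" for \<eta>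
    proof -
      obtain B where B: "B \<in> events" "prob B \<le> \<epsilon> / 2" "{\<omega>\<in>space M. Z \<eta> \<omega> \<ge> K} \<subseteq> B" using K[OF \<eta>] by blast
      have "{\<omega>\<in>space M. Z \<eta> \<omega> \<ge> R} \<subseteq> B" using B(3) elim by auto
      then have "prob {\<omega>\<in>space M. Z \<eta> \<omega> \<ge> R} \<le> prob B" using B(1) by (rule finite_measure_mono)
      with B(2) show ?thesis by simp
    qed
    have "(SUP \<eta>\<in>J. prob {\<omega>\<in>space M. Z \<eta> \<omega> \<ge> R}) \<le> \<epsilon> / 2"
      by (rule cSUP_least[OF ne le])
    moreover obtain \<eta> where "\<eta> \<in> J" using ne by auto
    then have "0 \<le> (SUP \<eta>\<in>J. prob {\<omega>\<in>space M. Z \<eta> \<omega> \<ge> R})"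
      by (intro cSUP_upper2[where x = \<eta>]) (auto intro: bdd_aboveI2[where M = "\<epsilon> / 2"] le)
    ultimately show ?case using \<epsilon> by simp
  qed
qed

lemma (in prob_space) bounded_above_in_probD:
  assumes "bounded_above_in_prob M J Z" "\<epsilon> > 0"
  shows "\<exists>K>0. \<forall>\<eta>\<in>J. prob {\<omega>\<in>space M. Z \<eta> \<omega> \<ge> K} \<le> \<epsilon>"
proof -
  have "\<forall>\<^sub>F R in at_top. (SUP \<eta>\<in>J. prob {\<omega>\<in>space M. Z \<eta> \<omega> \<ge> R}) < \<epsilon>"
    using assms unfolding bounded_above_in_prob_def by (rule order_tendstoD)
  then obtain K0 where "\<And>R. R \<ge> K0 \<Longrightarrow> (SUP \<eta>\<in>J. prob {\<omega>\<in>space M. Z \<eta> \<omega> \<ge> R}) < \<epsilon>"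
    by (auto simp: eventually_at_top_linorder)
  from this[of "max K0 1"] have K: "(SUP \<eta>\<in>J. prob {\<omega>\<in>space M. Z \<eta> \<omega> \<ge> max K0 1}) < \<epsilon>" by simp
  have "prob {\<omega>\<in>space M. Z \<eta> \<omega> \<ge> max K0 1} \<le> \<epsilon>" if "\<eta> \<in> J" for \<eta>
  proof -
    have "prob {\<omega>\<in>space M. Z \<eta> \<omega> \<ge> max K0 1} \<le> (SUP \<eta>\<in>J. prob {\<omega>\<in>space M. Z \<eta> \<omega> \<ge> max K0 1})"
      by (rule cSUP_upper[OF that]) (auto intro!: bdd_aboveI2[where M = 1])
    with K show ?thesis by simp
  qed
  then show ?thesis by (intro exI[of _ "max K0 1"]) auto
qed

lemma bounded_below_in_prob_iff_uminus:
  "bounded_below_in_prob P J Z \<longleftrightarrow> bounded_above_in_prob P J (\<lambda>\<eta> \<omega>. - Z \<eta> \<omega>)"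
  unfolding bounded_below_in_prob_def bounded_above_in_prob_def by (simp add: le_minus_iff)

context filtered_space
begin

text \<open>Apart from the adapted cadlag paths, this is what the two classes of noise have in common.\<close>

lemma noise_decomposition:
  assumes M: "HDol P F M \<or> HSqL P F M" and \<tau>: "\<tau> > 0"
  shows "\<exists>N c C. orthogonal_increments P F N \<and> (\<forall>t \<omega>. M t \<omega> = N t \<omega> + c * t) \<and>
    (\<forall>m. expectation (\<lambda>\<omega>. (N (real (m + 2) * \<tau>) \<omega> - N (real m * \<tau>) \<omega>)\<^sup>2) \<le> C)"
  using M
proof
  assume "HDol P F M"
  from HDol_increment_second_moment[OF this \<tau>] obtain C where
    orth: "orthogonal_increments P F M" and
    C: "\<And>u v. u \<le> v \<Longrightarrow> expectation (\<lambda>\<omega>. (M (real v * \<tau>) \<omega> - M (real u * \<tau>) \<omega>)\<^sup>2) \<le> C * (real (v - u) * \<tau>)"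
    by blast
  have "expectation (\<lambda>\<omega>. (M (real (m + 2) * \<tau>) \<omega> - M (real m * \<tau>) \<omega>)\<^sup>2) \<le> C * (2 * \<tau>)" for m
    using C[of m "m + 2"] by simp
  with orth show ?thesis by (intro exI[of _ M] exI[of _ 0] exI[of _ "C * (2 * \<tau>)"]) simp
next
  assume "HSqL P F M"
  from levy_drift_decomposition[OF this, of "2 * \<tau>"] \<tau> obtain c C where
    orth: "orthogonal_increments P F (\<lambda>t \<omega>. M t \<omega> - c * t)" and
    C: "\<And>s. s \<ge> 0 \<Longrightarrow> expectation (\<lambda>\<omega>. ((M (s + 2 * \<tau>) \<omega> - c * (s + 2 * \<tau>)) - (M s \<omega> - c * s))\<^sup>2) \<le> C"
    by auto
  have "real (m + 2) * \<tau> = real m * \<tau> + 2 * \<tau>" for m by (simp add: algebra_simps)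
  then have "expectation (\<lambda>\<omega>. ((M (real (m + 2) * \<tau>) \<omega> - c * (real (m + 2) * \<tau>))
      - (M (real m * \<tau>) \<omega> - c * (real m * \<tau>)))\<^sup>2) \<le> C" for m
    using C[of "real m * \<tau>"] \<tau> by simp
  with orth show ?thesis by (intro exI[of _ "\<lambda>t \<omega>. M t \<omega> - c * t"] exI[of _ c] exI[of _ C]) simp
qed

lemma stoch_integral_tight_on_windows:
  assumes M: "HDol P F M \<or> HSqL P F M" and \<tau>: "\<tau> > 0"
    and I: "has_stoch_integral P F M H I"
    and H: "\<And>s \<omega>. s > 0 \<Longrightarrow> \<omega> \<in> space P \<Longrightarrow> \<bar>H s \<omega>\<bar> \<le> \<beta>" and \<epsilon>: "\<epsilon> > 0"
  shows "\<exists>R. \<forall>m. \<exists>B\<in>events. prob B \<le> \<epsilon> \<and>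
    (\<forall>\<omega>\<in>space P - B. \<forall>s\<in>{real m * \<tau>..real (m + 2) * \<tau>}. \<bar>I s \<omega> - I (real m * \<tau>) \<omega>\<bar> \<le> R)"
proof -
  obtain N c C where N: "orthogonal_increments P F N" and MN: "\<And>t \<omega>. M t \<omega> = N t \<omega> + c * t"
    and C: "\<And>m. expectation (\<lambda>\<omega>. (N (real (m + 2) * \<tau>) \<omega> - N (real m * \<tau>) \<omega>)\<^sup>2) \<le> C"
    using noise_decomposition[OF M \<tau>] by blast
  have cad: "cadlag_process P {0..} M" and ad: "adapted_on F {0..} M"
    using M by (auto simp: HDol_def HSqL_def levy_process_def martingale_def)
  have I_cad: "cadlag_process P {0..} I" and I_ad: "adapted_on F {0..} I"
    using I unfolding has_stoch_integral_def by blast+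
  have "0 \<le> expectation (\<lambda>\<omega>. (N (real (0 + 2) * \<tau>) \<omega> - N (real 0 * \<tau>) \<omega>)\<^sup>2)" by simp
  with C[of 0] have C0: "C \<ge> 0" by linarith
  \<comment> \<open>Chosen such that the bound \<open>4 \<beta>\<^sup>2 C / r\<^sup>2\<close> of the maximal inequality is at most \<open>\<epsilon>\<close>.\<close>
  define r where "r = sqrt (4 * \<beta>\<^sup>2 * C / \<epsilon>) + 1"
  have nn: "4 * \<beta>\<^sup>2 * C / \<epsilon> \<ge> 0" using C0 \<epsilon> by simp
  then have root: "sqrt (4 * \<beta>\<^sup>2 * C / \<epsilon>) \<ge> 0" by (rule real_sqrt_ge_zero)
  then have r: "r > 0" unfolding r_def by linarith
  have "r\<^sup>2 = 4 * \<beta>\<^sup>2 * C / \<epsilon> + 2 * sqrt (4 * \<beta>\<^sup>2 * C / \<epsilon>) + 1"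
    using nn unfolding r_def power2_sum by (simp only: real_sqrt_pow2) simp
  with root have "4 * \<beta>\<^sup>2 * C / \<epsilon> \<le> r\<^sup>2" by linarith
  then have small: "4 * \<beta>\<^sup>2 * C / r\<^sup>2 \<le> \<epsilon>" using r \<epsilon> by (simp add: field_simps)
  define R where "R = 2 * r + \<bar>c\<bar> * \<beta> * (2 * \<tau>)"
  show ?thesis
  proof (intro exI[of _ R] allI)
    fix m
    let ?B = "{\<omega>\<in>space P. \<exists>s\<in>{real m * \<tau>..real (m + 2) * \<tau>}. \<bar>I s \<omega> - I (real m * \<tau>) \<omega>\<bar> > R}"
    have mm: "real m * \<tau> \<le> real (m + 2) * \<tau>" using \<tau> by (intro mult_right_mono) auto
    have "prob ?B \<le> 4 * \<beta>\<^sup>2 * C / r\<^sup>2"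
      using stoch_integral_increment_bound[OF N cad ad MN C I H \<tau> _ r] by (simp add: R_def)
    moreover have "?B \<in> events"
      by (rule sets_increment_exceeds[OF I_cad I_ad _ mm]) (use \<tau> in simp)
    ultimately show "\<exists>B\<in>events. prob B \<le> \<epsilon> \<and>
      (\<forall>\<omega>\<in>space P - B. \<forall>s\<in>{real m * \<tau>..real (m + 2) * \<tau>}. \<bar>I s \<omega> - I (real m * \<tau>) \<omega>\<bar> \<le> R)"
      using small by (intro bexI[of _ ?B]) (auto simp: not_less)
  qed
qed

text \<open>For \<open>t > \<tau>\<close>, the times \<open>r\<close> and \<open>s\<close> are the end points of the interval \<open>[m\<tau>, (m + 2)\<tau>]\<close> that covers
the window, in the order given by the side on which \<open>a\<close> is bounded.  For \<open>t \<le> \<tau>\<close> the window reaches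
into the initial segment, and \<open>X\<close> is bounded in probability on the fixed interval \<open>[-\<tau>, \<tau>]\<close>.  The
maximum and minimum with 0 give both cases the same form.\<close>

lemma solution_window_bounds:
  assumes \<tau>: "\<tau> > 0" and M: "HDol P F M \<or> HSqL P F M"
    and a: "time_proper_locally_lipschitz \<tau> a" and b: "time_proper_locally_lipschitz \<tau> b"
    and X: "global_solution P F \<tau> a b M \<Phi> X"
    and a_bound: "(\<exists>\<alpha>max\<ge>0. \<forall>\<phi>\<in>D_space {-\<tau>..0}. \<forall>t\<ge>0. a \<phi> t \<le> \<alpha>max) \<or>
         (\<exists>\<alpha>min\<ge>0. \<forall>\<phi>\<in>D_space {-\<tau>..0}. \<forall>t\<ge>0. a \<phi> t \<ge> - \<alpha>min)"
    and \<beta>: "\<beta> \<ge> 0" "\<forall>\<phi>\<in>D_space {-\<tau>..0}. \<forall>t\<ge>0. (b \<phi> t)\<^sup>2 \<le> \<beta>\<^sup>2" and \<epsilon>: "\<epsilon> > 0"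
  shows "\<exists>K. \<forall>t\<ge>0. \<exists>B\<in>events. \<exists>r\<ge>0. \<exists>s\<ge>0. prob B \<le> \<epsilon> \<and>
    (\<forall>\<omega>\<in>space P - B. \<forall>\<theta>\<in>{-\<tau>..0}.
       X (t + \<theta>) \<omega> \<le> max 0 (X r \<omega>) + K \<and> X (t + \<theta>) \<omega> \<ge> min 0 (X s \<omega>) - K)"
proof -
  have X_ad: "adapted_on F {-\<tau>..} X" and X_cad: "cadlag_process P {-\<tau>..} X"
    using X unfolding global_solution_def by blast+
  obtain I where I: "has_stoch_integral P F M (\<lambda>s \<omega>. left_lim (\<lambda>u. b (segment \<tau> (\<lambda>v. X v \<omega>) u) u) s) I"
    and sol: "AE \<omega> in P. \<forall>t\<ge>0. X t \<omega> = \<Phi> 0 \<omega> + (LBINT s:{0..t}. a (segment \<tau> (\<lambda>v. X v \<omega>) s) s) + I t \<omega>"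
    using X unfolding global_solution_def by blast
  have seg: "segment \<tau> (\<lambda>v. X v \<omega>) t \<in> D_space {-\<tau>..0}" if "\<omega> \<in> space P" "t \<ge> 0" for \<omega> t
    using X_cad that by (intro segment_in_D_space) (auto simp: cadlag_process_def)
  have H: "\<bar>left_lim (\<lambda>u. b (segment \<tau> (\<lambda>v. X v \<omega>) u) u) s\<bar> \<le> \<beta>" if "s > 0" "\<omega> \<in> space P" for s \<omega>
  proof (rule cadlag_on_left_lim_abs_le[OF cadlag_on_coefficient[OF b] that(1)])
    show "cadlag_on {-\<tau>..} (\<lambda>v. X v \<omega>)" using X_cad that by (simp add: cadlag_process_def)
    fix t :: real assume "t \<ge> 0"
    then have "(b (segment \<tau> (\<lambda>v. X v \<omega>) t) t)\<^sup>2 \<le> \<beta>\<^sup>2" using \<beta>(2) seg[OF that(2)] by blast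
    then show "\<bar>b (segment \<tau> (\<lambda>v. X v \<omega>) t) t\<bar> \<le> \<beta>" using \<beta>(1) by (simp add: abs_le_square_iff[symmetric])
  qed
  obtain R where R: "\<And>m. \<exists>B\<in>events. prob B \<le> \<epsilon> \<and>
    (\<forall>\<omega>\<in>space P - B. \<forall>s\<in>{real m * \<tau>..real (m + 2) * \<tau>}. \<bar>I s \<omega> - I (real m * \<tau>) \<omega>\<bar> \<le> R)"
    using stoch_integral_tight_on_windows[OF M \<tau> I H \<epsilon>] by blast
  obtain N where N: "N \<in> null_sets P"
    "\<And>\<omega> t. \<omega> \<in> space P - N \<Longrightarrow> t \<ge> 0 \<Longrightarrow>
      X t \<omega> = \<Phi> 0 \<omega> + (LBINT s:{0..t}. a (segment \<tau> (\<lambda>v. X v \<omega>) s) s) + I t \<omega>"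
  proof -
    from sol obtain N where "{\<omega>\<in>space P. \<not> (\<forall>t\<ge>0. X t \<omega> = \<Phi> 0 \<omega> + (LBINT s:{0..t}. a (segment \<tau> (\<lambda>v. X v \<omega>) s)
      s) + I t \<omega>)} \<subseteq> N"
      "N \<in> null_sets P" by (auto simp: eventually_ae_filter)
    then show ?thesis by (intro that[of N]) auto
  qed
  obtain L where L: "L > 0" "{\<omega>\<in>space P. \<exists>s\<in>{-\<tau>..\<tau>}. \<bar>X s \<omega>\<bar> > L} \<in> events"
    "prob {\<omega>\<in>space P. \<exists>s\<in>{-\<tau>..\<tau>}. \<bar>X s \<omega>\<bar> > L} < \<epsilon>"
  proof -
    have "X s \<in> borel_measurable P" if "s \<in> {-\<tau>..\<tau>}" for s
      using X_ad that by (auto simp: adapted_on_def intro: measurable_F)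
    then show ?thesis
      using cadlag_process_tight_on_compact[of "-\<tau>" \<tau> X "{-\<tau>..}" \<epsilon>] X_cad \<tau> \<epsilon> that by auto
  qed
  obtain \<alpha> where \<alpha>: "\<alpha> \<ge> 0"
    "(\<forall>\<phi>\<in>D_space {-\<tau>..0}. \<forall>t\<ge>0. a \<phi> t \<le> \<alpha>) \<or> (\<forall>\<phi>\<in>D_space {-\<tau>..0}. \<forall>t\<ge>0. a \<phi> t \<ge> - \<alpha>)"
    using a_bound by blast
  define K where "K = L + 2 * \<alpha> * \<tau> + 2 * \<bar>R\<bar>"
  have window: "\<exists>r\<in>{0..}. \<exists>s\<in>{0..}. \<forall>\<omega>\<in>space P - (B \<union> N). \<forall>q\<in>{real m * \<tau>..real (m + 2) * \<tau>}.
      X q \<omega> \<le> X r \<omega> + K \<and> X q \<omega> \<ge> X s \<omega> - K"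
    if B: "\<forall>\<omega>\<in>space P - B. \<forall>s\<in>{real m * \<tau>..real (m + 2) * \<tau>}. \<bar>I s \<omega> - I (real m * \<tau>) \<omega>\<bar> \<le> R" for m B
  proof -
    define p where "p = real m * \<tau>"
    define e where "e = real (m + 2) * \<tau>"
    have pe: "0 \<le> p" "p \<le> e" "e - p = 2 * \<tau>" using \<tau> by (auto simp: p_def e_def algebra_simps)
    define A where "A \<omega> t = (LBINT s:{0..t}. a (segment \<tau> (\<lambda>v. X v \<omega>) s) s)" for \<omega> t
    have cad: "cadlag_on {0..} (\<lambda>s. a (segment \<tau> (\<lambda>v. X v \<omega>) s) s)" if "\<omega> \<in> space P" for \<omega>
      using X_cad that by (intro cadlag_on_coefficient[OF a]) (simp add: cadlag_process_def)
    have X_diff: "X t \<omega> - X s \<omega> = (A \<omega> t - A \<omega> s) + (I t \<omega> - I s \<omega>)"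
      if "\<omega> \<in> space P - (B \<union> N)" "0 \<le> s" "s \<le> t" for s t \<omega>
      using N(2)[of \<omega> s] N(2)[of \<omega> t] that by (simp add: A_def)
    have I_p: "\<bar>I q \<omega> - I p \<omega>\<bar> \<le> \<bar>R\<bar>" if "\<omega> \<in> space P - (B \<union> N)" "q \<in> {p..e}" for \<omega> q
    proof -
      have "\<bar>I q \<omega> - I p \<omega>\<bar> \<le> R" using B that unfolding p_def e_def by blast
      then show ?thesis by linarith
    qed
    have time: "\<alpha> * (t - s) \<le> 2 * \<alpha> * \<tau>" if "p \<le> s" "t \<le> e" for s t
    proof -
      have "\<alpha> * (t - s) \<le> \<alpha> * (2 * \<tau>)" using that pe \<alpha>(1) by (intro mult_left_mono) auto
      then show ?thesis by simp
    qed
    from \<alpha>(2) show ?thesis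
    proof
      assume up: "\<forall>\<phi>\<in>D_space {-\<tau>..0}. \<forall>t\<ge>0. a \<phi> t \<le> \<alpha>"
      have A_le: "A \<omega> t - A \<omega> s \<le> 2 * \<alpha> * \<tau>" if "\<omega> \<in> space P" "p \<le> s" "s \<le> t" "t \<le> e" for \<omega> s t
        using set_integral_cadlag_increment(1)[OF cad[OF that(1)], of s t \<alpha>] up seg[OF that(1)] time[of s t] that pe
        unfolding A_def by fastforce
      have "X q \<omega> \<le> X p \<omega> + K \<and> X q \<omega> \<ge> X e \<omega> - K" if "\<omega> \<in> space P - (B \<union> N)" "q \<in> {p..e}" for \<omega> q
        using X_diff[OF that(1), of p q] X_diff[OF that(1), of q e] A_le[of \<omega> p q] A_le[of \<omega> q e]
          I_p[OF that(1), of q] I_p[OF that(1), of e] that pe L(1) unfolding K_def by auto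
      then show ?thesis using pe unfolding p_def[symmetric] e_def[symmetric]
        by (intro bexI[of _ p] bexI[of _ e]) auto
    next
      assume down: "\<forall>\<phi>\<in>D_space {-\<tau>..0}. \<forall>t\<ge>0. a \<phi> t \<ge> - \<alpha>"
      have A_ge: "A \<omega> t - A \<omega> s \<ge> - (2 * \<alpha> * \<tau>)" if "\<omega> \<in> space P" "p \<le> s" "s \<le> t" "t \<le> e" for \<omega> s t
        using set_integral_cadlag_increment(2)[OF cad[OF that(1)], of s t "- \<alpha>"] down seg[OF that(1)] time[of
          s t] that pe
        unfolding A_def by fastforce
      have "X q \<omega> \<le> X e \<omega> + K \<and> X q \<omega> \<ge> X p \<omega> - K" if "\<omega> \<in> space P - (B \<union> N)" "q \<in> {p..e}" for \<omega> q
        using X_diff[OF that(1), of p q] X_diff[OF that(1), of q e] A_ge[of \<omega> p q] A_ge[of \<omega> q e]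
          I_p[OF that(1), of q] I_p[OF that(1), of e] that pe L(1) unfolding K_def by auto
      then show ?thesis using pe unfolding p_def[symmetric] e_def[symmetric]
        by (intro bexI[of _ e] bexI[of _ p]) auto
    qed
  qed
  show ?thesis
  proof (intro exI[of _ K] allI impI)
    fix t :: real assume t: "t \<ge> 0"
    show "\<exists>B\<in>events. \<exists>r\<ge>0. \<exists>s\<ge>0. prob B \<le> \<epsilon> \<and> (\<forall>\<omega>\<in>space P - B. \<forall>\<theta>\<in>{-\<tau>..0}.
       X (t + \<theta>) \<omega> \<le> max 0 (X r \<omega>) + K \<and> X (t + \<theta>) \<omega> \<ge> min 0 (X s \<omega>) - K)"
    proof (cases "t \<le> \<tau>")
      case True
      let ?B = "{\<omega>\<in>space P. \<exists>s\<in>{-\<tau>..\<tau>}. \<bar>X s \<omega>\<bar> > L}"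
      have "X (t + \<theta>) \<omega> \<le> max 0 (X 0 \<omega>) + K \<and> X (t + \<theta>) \<omega> \<ge> min 0 (X 0 \<omega>) - K"
        if "\<omega> \<in> space P - ?B" "\<theta> \<in> {-\<tau>..0}" for \<omega> \<theta>
      proof -
        have "\<bar>X (t + \<theta>) \<omega>\<bar> \<le> L" using that True t by (auto simp: not_less)
        moreover have "L \<le> K" unfolding K_def using \<alpha>(1) \<tau> by simp
        ultimately show ?thesis by auto
      qed
      then have "prob ?B \<le> \<epsilon> \<and> (\<forall>\<omega>\<in>space P - ?B. \<forall>\<theta>\<in>{-\<tau>..0}.
          X (t + \<theta>) \<omega> \<le> max 0 (X 0 \<omega>) + K \<and> X (t + \<theta>) \<omega> \<ge> min 0 (X 0 \<omega>) - K)"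
        using less_imp_le[OF L(3)] by blast
      then show ?thesis using L(2) order_refl[of "0::real"] by blast
    next
      case False
      define m where "m = nat \<lfloor>(t - \<tau>) / \<tau>\<rfloor>"
      have "\<lfloor>(t - \<tau>) / \<tau>\<rfloor> \<ge> 0" using False \<tau> by simp
      then have "real m = of_int \<lfloor>(t - \<tau>) / \<tau>\<rfloor>" by (simp add: m_def)
      then have "real m \<le> (t - \<tau>) / \<tau>" "(t - \<tau>) / \<tau> \<le> real m + 1" by linarith+
      then have m: "real m * \<tau> \<le> t - \<tau>" "t \<le> real (m + 2) * \<tau>" using \<tau> by (auto simp: field_simps)
      obtain B where B: "B \<in> events" "prob B \<le> \<epsilon>"
        "\<forall>\<omega>\<in>space P - B. \<forall>s\<in>{real m * \<tau>..real (m + 2) * \<tau>}. \<bar>I s \<omega> - I (real m * \<tau>) \<omega>\<bar> \<le> R"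
        using R[of m] by blast
      obtain r s where rs: "r \<ge> 0" "s \<ge> 0" "\<forall>\<omega>\<in>space P - (B \<union> N). \<forall>q\<in>{real m * \<tau>..real (m + 2) * \<tau>}.
          X q \<omega> \<le> X r \<omega> + K \<and> X q \<omega> \<ge> X s \<omega> - K"
        using window[OF B(3)] by auto
      have "X (t + \<theta>) \<omega> \<le> max 0 (X r \<omega>) + K \<and> X (t + \<theta>) \<omega> \<ge> min 0 (X s \<omega>) - K"
        if "\<omega> \<in> space P - (B \<union> N)" "\<theta> \<in> {-\<tau>..0}" for \<omega> \<theta>
      proof -
        have "t + \<theta> \<in> {real m * \<tau>..real (m + 2) * \<tau>}" using that m by auto
        with rs(3) that(1) have "X (t + \<theta>) \<omega> \<le> X r \<omega> + K \<and> X (t + \<theta>) \<omega> \<ge> X s \<omega> - K" by blast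
        then show ?thesis by auto
      qed
      moreover have "prob (B \<union> N) \<le> \<epsilon>" using B N(1) by (simp add: measure_Un_null_set)
      moreover have "B \<union> N \<in> events" using B N(1) by auto
      ultimately show ?thesis using rs(1,2) by blast
    qed
  qed
qed

end

theorem proposition3p5:
  fixes P :: "'a measure" and F :: "real \<Rightarrow> 'a measure"
    and \<tau> \<beta> :: real
    and a b :: "(real \<Rightarrow> real) \<Rightarrow> real \<Rightarrow> real"
    and M \<Phi> X :: "real \<Rightarrow> 'a \<Rightarrow> real"
  assumes "\<tau> > 0"
    and "prob_space P"
    and "usual_conditions P F"
    and "HDol P F M \<or> HSqL P F M"
    and "time_proper_locally_lipschitz \<tau> a"
    and "time_proper_locally_lipschitz \<tau> b"
    and "\<Phi> \<in> initial_processes P F \<tau>"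
    and "global_solution P F \<tau> a b M \<Phi> X"
    and "(\<exists>\<alpha>max\<ge>0. \<forall>\<phi>\<in>D_space {-\<tau>..0}. \<forall>t\<ge>0. a \<phi> t \<le> \<alpha>max) \<or>
         (\<exists>\<alpha>min\<ge>0. \<forall>\<phi>\<in>D_space {-\<tau>..0}. \<forall>t\<ge>0. a \<phi> t \<ge> - \<alpha>min)"
    and "\<beta> \<ge> 0"
    and "\<forall>\<phi>\<in>D_space {-\<tau>..0}. \<forall>t\<ge>0. (b \<phi> t)\<^sup>2 \<le> \<beta>\<^sup>2"
  shows "(bounded_in_prob P {0..} X \<longrightarrow>
            bounded_in_prob P {0..} (\<lambda>t \<omega>. sup_norm \<tau> (segment \<tau> (\<lambda>v. X v \<omega>) t))) \<and>
         (bounded_above_in_prob P {0..} X \<longrightarrow>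
            bounded_above_in_prob P {0..} (\<lambda>t \<omega>. SUP \<theta>\<in>{-\<tau>..0}. X (t + \<theta>) \<omega>)) \<and>
         (bounded_below_in_prob P {0..} X \<longrightarrow>
            bounded_below_in_prob P {0..} (\<lambda>t \<omega>. INF \<theta>\<in>{-\<tau>..0}. X (t + \<theta>) \<omega>))"
proof -
  interpret filtered_space P F by (rule filtered_space_of_usual_conditions[OF assms(2,3)])
  let ?tail = "\<lambda>f \<epsilon> K t. \<exists>B\<in>events. prob B \<le> \<epsilon> \<and>
    (\<forall>\<omega>\<in>space P - B. \<forall>\<theta>\<in>{-\<tau>..0}. f (X (t + \<theta>) \<omega>) \<le> (K :: real))"
  have X_ad: "adapted_on F {-\<tau>..} X" and X_cad: "cadlag_process P {-\<tau>..} X"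
    using assms(8) unfolding global_solution_def by blast+
  have X_meas: "X t \<in> borel_measurable P" if "t \<ge> 0" for t
    using X_ad that assms(1) by (auto simp: adapted_on_def intro: measurable_F)
  note window = solution_window_bounds[OF assms(1,4,5,6,8,9,10,11)]
  have ne: "{-\<tau>..0} \<noteq> {}" using assms(1) by simp
  \<comment> \<open>Either sign of \<open>X\<close> leads to the same statement, with \<open>f\<close> the identity or the negation below.\<close>
  have upper: "\<exists>K. \<forall>t\<ge>0. \<exists>B\<in>events. \<exists>r\<ge>0. prob B \<le> \<epsilon> \<and>
      (\<forall>\<omega>\<in>space P - B. \<forall>\<theta>\<in>{-\<tau>..0}. X (t + \<theta>) \<omega> \<le> max 0 (X r \<omega>) + K)" if "\<epsilon> > 0" for \<epsilon>
    using window[OF that] by meson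
  have lower: "\<exists>K. \<forall>t\<ge>0. \<exists>B\<in>events. \<exists>r\<ge>0. prob B \<le> \<epsilon> \<and>
      (\<forall>\<omega>\<in>space P - B. \<forall>\<theta>\<in>{-\<tau>..0}. - X (t + \<theta>) \<omega> \<le> max 0 (- X r \<omega>) + K)" if "\<epsilon> > 0" for \<epsilon>
  proof -
    have "- y \<le> max 0 (- x) + K" if "y \<ge> min 0 x - K" for x y K :: real using that by linarith
    then show ?thesis using window[OF that] by meson
  qed
  have tail: "\<exists>K. \<forall>t\<in>{0..}. ?tail f \<epsilon> K t"
    if X: "bounded_above_in_prob P {0..} (\<lambda>t \<omega>. f (X t \<omega>))"
      and win: "\<And>\<epsilon>. \<epsilon> > 0 \<Longrightarrow> \<exists>K. \<forall>t\<ge>0. \<exists>B\<in>events. \<exists>r\<ge>0. prob B \<le> \<epsilon> \<and>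
        (\<forall>\<omega>\<in>space P - B. \<forall>\<theta>\<in>{-\<tau>..0}. f (X (t + \<theta>) \<omega>) \<le> max 0 (f (X r \<omega>)) + K)"
      and f: "f \<in> borel_measurable borel" and \<epsilon>: "\<epsilon> > 0" for f :: "real \<Rightarrow> real" and \<epsilon>
  proof -
    obtain L where L: "\<And>t. t \<ge> 0 \<Longrightarrow> prob {\<omega>\<in>space P. f (X t \<omega>) \<ge> L} \<le> \<epsilon> / 2"
      using bounded_above_in_probD[OF X, of "\<epsilon> / 2"] \<epsilon> by auto
    obtain K where K: "\<And>t. t \<ge> 0 \<Longrightarrow> \<exists>B\<in>events. \<exists>r\<ge>0. prob B \<le> \<epsilon> / 2 \<and>
        (\<forall>\<omega>\<in>space P - B. \<forall>\<theta>\<in>{-\<tau>..0}. f (X (t + \<theta>) \<omega>) \<le> max 0 (f (X r \<omega>)) + K)"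
      using win[OF half_gt_zero[OF \<epsilon>]] by blast
    show ?thesis
    proof (intro exI[of _ "max 0 L + K"] ballI)
      fix t :: real assume "t \<in> {0..}"
      then have "t \<ge> 0" by simp
      from K[OF this] obtain B r where B: "B \<in> events" "prob B \<le> \<epsilon> / 2" "r \<ge> 0"
        "\<forall>\<omega>\<in>space P - B. \<forall>\<theta>\<in>{-\<tau>..0}. f (X (t + \<theta>) \<omega>) \<le> max 0 (f (X r \<omega>)) + K" by blast
      let ?C = "{\<omega>\<in>space P. f (X r \<omega>) \<ge> L}"
      have C: "?C \<in> events" using X_meas[OF B(3)] f by measurable
      have "prob (B \<union> ?C) \<le> prob B + prob ?C" using B(1) C by (intro measure_subadditive) auto
      then have "prob (B \<union> ?C) \<le> \<epsilon>" using B(2) L[OF B(3)] by simp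
      moreover have "f (X (t + \<theta>) \<omega>) \<le> max 0 L + K" if "\<omega> \<in> space P - (B \<union> ?C)" "\<theta> \<in> {-\<tau>..0}" for \<omega> \<theta>
      proof -
        have "f (X (t + \<theta>) \<omega>) \<le> max 0 (f (X r \<omega>)) + K" using B(4) that by blast
        moreover have "f (X r \<omega>) \<le> L" using that by auto
        ultimately show ?thesis by linarith
      qed
      ultimately show "?tail f \<epsilon> (max 0 L + K) t"
        using B(1) C by (intro bexI[of _ "B \<union> ?C"]) auto
    qed
  qed
  have above: "\<exists>K. \<forall>t\<in>{0..}. ?tail (\<lambda>x. x) \<epsilon> K t"
    if "bounded_above_in_prob P {0..} X" "\<epsilon> > 0" for \<epsilon>
    by (rule tail[of "\<lambda>x. x", OF that(1) upper _ that(2)]) auto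
  have below: "\<exists>K. \<forall>t\<in>{0..}. ?tail uminus \<epsilon> K t"
    if "bounded_below_in_prob P {0..} X" "\<epsilon> > 0" for \<epsilon>
    by (rule tail[of uminus, OF that(1)[unfolded bounded_below_in_prob_iff_uminus] lower _ that(2)]) auto
  have sup: "bounded_above_in_prob P {0..} (\<lambda>t \<omega>. SUP \<theta>\<in>{-\<tau>..0}. f (X (t + \<theta>) \<omega>))"
    if "\<And>\<epsilon>. \<epsilon> > 0 \<Longrightarrow> \<exists>K. \<forall>t\<in>{0..}. ?tail f \<epsilon> K t"
    for f :: "real \<Rightarrow> real"
  proof (rule bounded_above_in_probI)
    fix \<epsilon> :: real assume "\<epsilon> > 0"
    from that[OF this] obtain K where K: "\<And>t. t \<in> {0..} \<Longrightarrow>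
      ?tail f \<epsilon> K t" by blast
    show "\<exists>K. \<forall>t\<in>{0..}. \<exists>B\<in>events. prob B \<le> \<epsilon> \<and> {\<omega>\<in>space P. (SUP \<theta>\<in>{-\<tau>..0}. f (X (t + \<theta>) \<omega>)) \<ge> K} \<subseteq> B"
    proof (intro exI[of _ "K + 1"] ballI)
      fix t :: real assume "t \<in> {0..}"
      from K[OF this] obtain B where B: "B \<in> events" "prob B \<le> \<epsilon>"
        "\<forall>\<omega>\<in>space P - B. \<forall>\<theta>\<in>{-\<tau>..0}. f (X (t + \<theta>) \<omega>) \<le> K" by blast
      have "(SUP \<theta>\<in>{-\<tau>..0}. f (X (t + \<theta>) \<omega>)) \<le> K" if "\<omega> \<in> space P - B" for \<omega>
        by (rule cSUP_least[OF ne]) (use B(3) that in blast)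
      then have "{\<omega>\<in>space P. (SUP \<theta>\<in>{-\<tau>..0}. f (X (t + \<theta>) \<omega>)) \<ge> K + 1} \<subseteq> B" by fastforce
      with B show "\<exists>B\<in>events. prob B \<le> \<epsilon> \<and> {\<omega>\<in>space P. (SUP \<theta>\<in>{-\<tau>..0}. f (X (t + \<theta>) \<omega>)) \<ge> K + 1} \<subseteq> B" by blast
    qed
  qed simp
  have norm_eq: "sup_norm \<tau> (segment \<tau> (\<lambda>v. X v \<omega>) t) = (SUP \<theta>\<in>{-\<tau>..0}. \<bar>X (t + \<theta>) \<omega>\<bar>)" for t \<omega>
    unfolding sup_norm_def segment_def by (intro SUP_cong) auto
  show ?thesis
  proof (intro conjI impI)
    assume "bounded_above_in_prob P {0..} X"
    from sup[of "\<lambda>x. x", OF above[OF this]]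
    show "bounded_above_in_prob P {0..} (\<lambda>t \<omega>. SUP \<theta>\<in>{-\<tau>..0}. X (t + \<theta>) \<omega>)" .
  next
    assume "bounded_below_in_prob P {0..} X"
    from sup[of uminus, OF below[OF this]]
    show "bounded_below_in_prob P {0..} (\<lambda>t \<omega>. INF \<theta>\<in>{-\<tau>..0}. X (t + \<theta>) \<omega>)"
      unfolding bounded_below_in_prob_iff_uminus by (simp add: Inf_real_def image_image)
  next
    assume X: "bounded_in_prob P {0..} X"
    show "bounded_in_prob P {0..} (\<lambda>t \<omega>. sup_norm \<tau> (segment \<tau> (\<lambda>v. X v \<omega>) t))"
      unfolding bounded_in_prob_def norm_eq
    proof
      show "bounded_above_in_prob P {0..} (\<lambda>t \<omega>. SUP \<theta>\<in>{-\<tau>..0}. \<bar>X (t + \<theta>) \<omega>\<bar>)"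
      proof (rule sup)
        fix \<epsilon> :: real assume \<epsilon>: "\<epsilon> > 0"
        obtain K1 where K1: "\<And>t. t \<in> {0..} \<Longrightarrow>
          \<exists>B\<in>events. prob B \<le> \<epsilon> / 2 \<and> (\<forall>\<omega>\<in>space P - B. \<forall>\<theta>\<in>{-\<tau>..0}. X (t + \<theta>) \<omega> \<le> K1)"
          using above[of "\<epsilon> / 2"] X \<epsilon> unfolding bounded_in_prob_def by (metis half_gt_zero)
        obtain K2 where K2: "\<And>t. t \<in> {0..} \<Longrightarrow>
          \<exists>B\<in>events. prob B \<le> \<epsilon> / 2 \<and> (\<forall>\<omega>\<in>space P - B. \<forall>\<theta>\<in>{-\<tau>..0}. - X (t + \<theta>) \<omega> \<le> K2)"
          using below[of "\<epsilon> / 2"] X \<epsilon> unfolding bounded_in_prob_def by (metis half_gt_zero)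
        show "\<exists>K. \<forall>t\<in>{0..}. ?tail abs \<epsilon> K t"
        proof (intro exI[of _ "max K1 K2"] ballI)
          fix t :: real assume t: "t \<in> {0..}"
          from K1[OF t] obtain B1 where B1: "B1 \<in> events" "prob B1 \<le> \<epsilon> / 2"
            "\<And>\<omega> \<theta>. \<omega> \<in> space P - B1 \<Longrightarrow> \<theta> \<in> {-\<tau>..0} \<Longrightarrow> X (t + \<theta>) \<omega> \<le> K1" by blast
          from K2[OF t] obtain B2 where B2: "B2 \<in> events" "prob B2 \<le> \<epsilon> / 2"
            "\<And>\<omega> \<theta>. \<omega> \<in> space P - B2 \<Longrightarrow> \<theta> \<in> {-\<tau>..0} \<Longrightarrow> - X (t + \<theta>) \<omega> \<le> K2" by blast
          have "prob (B1 \<union> B2) \<le> prob B1 + prob B2" using B1 B2 by (intro measure_subadditive) auto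
          then have "prob (B1 \<union> B2) \<le> \<epsilon>" using B1(2) B2(2) by simp
          moreover have "\<bar>X (t + \<theta>) \<omega>\<bar> \<le> max K1 K2" if "\<omega> \<in> space P - (B1 \<union> B2)" "\<theta> \<in> {-\<tau>..0}" for \<omega> \<theta>
          proof -
            have "X (t + \<theta>) \<omega> \<le> K1" "- X (t + \<theta>) \<omega> \<le> K2" using B1(3) B2(3) that by blast+
            then show ?thesis by linarith
          qed
          ultimately show "?tail abs \<epsilon> (max K1 K2) t"
            using B1(1) B2(1) by (intro bexI[of _ "B1 \<union> B2"]) auto
        qed
      qed
      have "0 \<le> (SUP \<theta>\<in>{-\<tau>..0}. \<bar>X (t + \<theta>) \<omega>\<bar>)" if \<omega>: "\<omega> \<in> space P" and t: "t \<ge> 0" for \<omega> t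
      proof -
        have "{t - \<tau>..t} \<subseteq> {-\<tau>..}" using t by auto
        then obtain B where B: "\<forall>s\<in>{t - \<tau>..t}. \<bar>X s \<omega>\<bar> \<le> B"
          using cadlag_on_bounded[of "{-\<tau>..}" "\<lambda>s. X s \<omega>"] X_cad \<omega> unfolding cadlag_process_def by blast
        show ?thesis
        proof (rule cSUP_upper2)
          show "bdd_above ((\<lambda>\<theta>. \<bar>X (t + \<theta>) \<omega>\<bar>) ` {-\<tau>..0})"
            by (rule bdd_aboveI2[where M = B]) (use B in auto)
        qed (use assms(1) in \<open>auto intro: abs_ge_zero[of "X (t + 0) \<omega>"]\<close>)
      qed
      then have "{\<omega>\<in>space P. - (SUP \<theta>\<in>{-\<tau>..0}. \<bar>X (t + \<theta>) \<omega>\<bar>) \<ge> 1} = {}" if "t \<ge> 0" for t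
        using that by fastforce
      then show "bounded_below_in_prob P {0..} (\<lambda>t \<omega>. SUP \<theta>\<in>{-\<tau>..0}. \<bar>X (t + \<theta>) \<omega>\<bar>)"
        unfolding bounded_below_in_prob_iff_uminus
        by (intro bounded_above_in_probI exI[of _ 1] ballI bexI[of _ "{}"]) auto
    qed
  qed
qed

end
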